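(* Let $\gamma\in(0,1]$, $\rho\in(0,+\infty)$ and let $\tau$ be a compactly supported probability measure on $[0,+\infty)$. Define the differentiable functions $$\omega_{\rho,\tau,\gamma}:\mathbb R\setminus\mathrm{supp}(\mu_{\rho,\tau,\gamma})\to\mathbb R,\quad x\mapsto x(1-\rho^2\gamma g_{\mu_{\rho,\tau,\gamma}}(x))^2-\rho^2(1-\gamma)(1-\rho^2\gamma g_{\mu_{\rho,\tau,\gamma}}(x)),$$ $$\Phi_{\rho,\tau,\gamma}:\mathbb R\setminus\mathrm{supp}(\tau)\to\mathbb R,\quad x\mapsto x(1+\gamma\rho^2g_\tau(x))^2+\rho^2(1-\gamma)(1+\gamma\rho^2g_\tau(x)),$$ and the set $$\mathcal E_{\rho,\tau,\gamma}=\left\{x\in\mathbb R\setminus\mathrm{supp}(\tau):\ \Phi_{\rho,\tau,\gamma}'(x)>0,\ g_\tau(x)>-\frac1{\rho^2\gamma}\right\}.$$ Then: A) 1. If $\gamma<1$ then $0\notin\mathrm{supp}(\mu_{\rho,\tau,\gamma})$. 2. $0\notin\mathrm{supp}(\mu_{\rho,\tau,1})$ if and only if $0\notin\mathrm{supp}(\tau)$ and $g_\tau(0)>-\frac1{\rho^2}$. B) $\omega_{\rho,\tau,\gamma}$ is an increasing analytic diffeomorphism with positive derivative from $\mathbb R\setminus\mathrm{supp}(\mu_{\rho,\tau,\gamma})$ to $\mathcal E_{\rho,\tau,\gamma}$, with inverse $\Phi_{\rho,\tau,\gamma}$. C) Let $a\in\mathbb R\setminus\mathrm{supp}(\mu_{\rho,\tau,\gamma})$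 be such that $\omega_{\rho,\tau,\gamma}(a)\le0$. Then $a$ is to the left of $\mathrm{supp}(\mu_{\rho,\tau,\gamma})$. D) Assume that the support of $\tau$ is a finite union of disjoint (possibly degenerate) closed bounded intervals. There exist an integer $p\geq 1$ and $u_1<v_1<u_2<\cdots<u_p<v_p$ (depending on $\rho,\tau,\gamma$) such that $$\mathcal E_{\rho,\tau,\gamma}=(-\infty,u_1)\cup\bigcup_{l=1}^{p-1}(v_l,u_{l+1})\cup(v_p,+\infty).$$ We have $\mathrm{supp}(\tau)\subset\bigcup_{l=1}^p[u_l,v_l]$ and, for each $l\in\{1,\ldots,p\}$, $[u_l,v_l]\cap\mathrm{supp}(\tau)\ne\emptyset$. Moreover, $$\mathrm{supp}(\mu_{\rho,\tau,\gamma})=\bigcup_{l=1}^p[\Phi_{\rho,\tau,\gamma}(u_l^-),\Phi_{\rho,\tau,\gamma}(v_l^+)],$$ with $$\Phi_{\rho,\tau,\gamma}(u_1^-)<\Phi_{\rho,\tau,\gamma}(v_1^+)<\Phi_{\rho,\tau,\gamma}(u_2^-)<\Phi_{\rho,\tau,\gamma}(v_2^+)<\cdots<\Phi_{\rho,\tau,\gamma}(u_p^-)<\Phi_{\rho,\tau,\gamma}(v_p^+),$$ where $\Phi_{\rho,\tau,\gamma}(u_l^-)=\lim_{u\uparrow u_l}\Phi_{\rho,\tau,\gamma}(u)$ and $\Phi_{\rho,\tau,\gamma}(v_l^+)=\lim_{u\downarrow v_l}\Phi_{\rho,\tau,\gamma}(u)$. Finally, for each $l\in\{1,\ldots,p\}$,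 $$\mu_{\rho,\tau,\gamma}\big([\Phi_{\rho,\tau,\gamma}(u_l^-),\Phi_{\rho,\tau,\gamma}(v_l^+)]\big)=\tau([u_l,v_l]).$$
   Context: For a probability measure $\tau$ on $\mathbb R$, $g_\tau(z)=\int\frac{d\tau(t)}{z-t}$ for $z\in\mathbb C\setminus\mathrm{supp}(\tau)$. For $\rho>0$, $0<\gamma\le1$ and a probability measure $\tau$ on $[0,+\infty)$, $\mu_{\rho,\tau,\gamma}$ denotes the unique probability measure on $[0,+\infty)$ whose Stieltjes transform $m=g_{\mu_{\rho,\tau,\gamma}}$ satisfies, for all $z\in\mathbb C^+$, $$m(z)=\int\frac{1}{(1-\rho^2\gamma m(z))z-\frac{t}{1-\rho^2\gamma m(z)}-\rho^2(1-\gamma)}\,d\tau(t).$$ It is the almost sure weak limit, as $N\to\infty$ and $n/N\to\gamma$, of the empirical spectral measures of information-plus-noise matrices $(\rho X_N/\sqrt N+A_N)(\rho X_N/\sqrt N+A_N)^*$ when the empirical spectral measure of $A_NA_N^*$ converges weakly to $\tau$. "$a$ is to the left of $\mathrm{supp}(\mu)$" means $a<\min\mathrm{supp}(\mu)$. *)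

theory Defs
  imports "HOL-Probability.Probability"
begin

definition measure_support :: "real measure \<Rightarrow> real set" where
  "measure_support \<mu> = {x. \<forall>U. open U \<and> x \<in> U \<longrightarrow> emeasure \<mu> U > 0}"

text \<open>Borel probability measures on the half-line, viewed as measures on the whole real line.\<close>

definition prob_on_halfline :: "real measure \<Rightarrow> bool" where
  "prob_on_halfline \<mu> \<longleftrightarrow> real_distribution \<mu> \<and> measure \<mu> {0..} = 1"

text \<open>The polymorphic type lets the same formula be used at complex arguments (in the equation
  characterising the limit law) and at real arguments outside the support, where it is real valued;
  the lemma below says that the two readings agree.\<close>

definition stieltjes ::
  "real measure \<Rightarrow> 'a \<Rightarrow> 'a::{real_normed_field, banach, second_countable_topology}" where
  "stieltjes \<tau> z = (\<integral>t. 1 / (z - of_real t) \<partial>\<tau>)"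

lemma stieltjes_complex_of_real: "stieltjes \<tau> (complex_of_real x) = complex_of_real (stieltjes \<tau> x)"
  unfolding stieltjes_def integral_complex_of_real[symmetric] by simp

text \<open>The law \<open>\<mu>\<close> with parameters \<open>\<rho>, \<tau>, \<gamma>\<close> is the only measure satisfying this predicate. The
  denominator never vanishes: for \<open>Im z > 0\<close> and \<open>t \<ge> 0\<close> its imaginary part is at least \<open>Im z\<close>.\<close>

definition info_plus_noise_law :: "real \<Rightarrow> real measure \<Rightarrow> real \<Rightarrow> real measure \<Rightarrow> bool" where
  "info_plus_noise_law \<rho> \<tau> \<gamma> \<mu> \<longleftrightarrow>
     prob_on_halfline \<mu> \<and>
     (\<forall>z::complex. Im z > 0 \<longrightarrow>
        stieltjes \<mu> z =
          (\<integral>t. 1 / ((1 - of_real (\<rho>\<^sup>2 * \<gamma>) * stieltjes \<mu> z) * z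
                   - of_real t / (1 - of_real (\<rho>\<^sup>2 * \<gamma>) * stieltjes \<mu> z)
                   - of_real (\<rho>\<^sup>2 * (1 - \<gamma>))) \<partial>\<tau>))"

text \<open>The last argument of \<open>omega\<close> is meant to be the law with parameters \<open>\<rho>, \<tau>, \<gamma>\<close>; \<open>omega\<close>
  depends on \<open>\<tau>\<close> only through it. Both functions are only meaningful off the supports of the
  respective measures.\<close>

definition omega :: "real \<Rightarrow> real \<Rightarrow> real measure \<Rightarrow> real \<Rightarrow> real" where
  "omega \<rho> \<gamma> \<mu> x =
     x * (1 - \<rho>\<^sup>2 * \<gamma> * stieltjes \<mu> x)\<^sup>2 - \<rho>\<^sup>2 * (1 - \<gamma>) * (1 - \<rho>\<^sup>2 * \<gamma> * stieltjes \<mu> x)"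

definition Phi :: "real \<Rightarrow> real measure \<Rightarrow> real \<Rightarrow> real \<Rightarrow> real" where
  "Phi \<rho> \<tau> \<gamma> x =
     x * (1 + \<gamma> * \<rho>\<^sup>2 * stieltjes \<tau> x)\<^sup>2 + \<rho>\<^sup>2 * (1 - \<gamma>) * (1 + \<gamma> * \<rho>\<^sup>2 * stieltjes \<tau> x)"

definition E_set :: "real \<Rightarrow> real measure \<Rightarrow> real \<Rightarrow> real set" where
  "E_set \<rho> \<tau> \<gamma> =
     {x \<in> - measure_support \<tau>. deriv (Phi \<rho> \<tau> \<gamma>) x > 0 \<and> stieltjes \<tau> x > - (1 / (\<rho>\<^sup>2 * \<gamma>))}"

definition real_analytic_on :: "(real \<Rightarrow> real) \<Rightarrow> real set \<Rightarrow> bool" where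
  "real_analytic_on f S \<longleftrightarrow> (\<forall>x\<in>S. \<exists>F. (\<lambda>h. f (x + h)) has_fps_expansion F)"

text \<open>\<open>a\<close> lies strictly below the minimum \<open>m\<close> of the support.\<close>

definition left_of_support :: "real \<Rightarrow> real measure \<Rightarrow> bool" where
  "left_of_support a \<mu> \<longleftrightarrow>
     (\<exists>m\<in>measure_support \<mu>. (\<forall>x\<in>measure_support \<mu>. m \<le> x) \<and> a < m)"

definition finite_union_of_disjoint_intervals :: "real set \<Rightarrow> bool" where
  "finite_union_of_disjoint_intervals S \<longleftrightarrow>
     (\<exists>\<I>. finite \<I> \<and> disjoint \<I> \<and> (\<forall>J\<in>\<I>. \<exists>a b. a \<le> b \<and> J = {a..b}) \<and> S = \<Union>\<I>)"

end

theory Submission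
  imports Defs "HOL-Complex_Analysis.Complex_Analysis"
begin

text \<open>
  Write \<open>m\<close> for the Stieltjes transform of \<open>\<mu>\<close>, \<open>c = \<rho>\<^sup>2\<gamma>\<close>, \<open>d = \<rho>\<^sup>2(1 - \<gamma>)\<close>, \<open>b = 1 - c m\<close> and \<open>G = 1 + c g_\<tau>\<close>. The
  fixed-point equation says \<open>b(z) G(\<omega>(z)) = 1\<close>, which gives \<open>\<Phi>(\<omega>(z)) = z\<close>, and taking imaginary
  parts gives \<open>Im \<omega>(z) \<ge> Im z\<close> on the upper half-plane. Off the support of \<open>\<mu>\<close> this forces
  \<open>\<omega>' \<ge> 1\<close>, hence \<open>b > 0\<close>, so \<open>\<omega>\<close> is locally invertible; continuing \<open>g_\<tau>\<close> across the real line by means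
  of the inverse shows that \<open>\<omega>\<close> takes values in \<open>\<E>\<close>. Conversely, a Cauchy-Schwarz estimate shows
  that \<open>z\<close> has at most one preimage under \<open>\<Phi>\<close> in the relevant part of the upper half-plane, so near a
  point of \<open>\<E>\<close> the local inverse of \<open>\<Phi>\<close> is \<open>\<omega>\<close>, and \<open>m\<close> continues across the real line there. The real
  version of that estimate makes \<open>\<Phi>\<close> increasing on \<open>\<E>\<close>.

  For the masses, \<open>m dz\<close> equals \<open>g_\<tau> d\<omega>\<close> up to an exact differential that is real on the real line.
  Comparing imaginary parts of the primitives gives \<open>\<mu>(x, \<infinity>) = \<tau>(\<omega>(x), \<infinity>)\<close> off the support of \<open>\<mu>\<close>.
  Hence two points of \<open>\<E>\<close> in one gap of the support of \<open>\<tau>\<close> bound an interval contained in \<open>\<E>\<close>, so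
  every component of the complement of \<open>\<E>\<close> meets the support of \<open>\<tau>\<close>. No component of the complement
  of \<open>\<E>\<close> or of the support of \<open>\<mu>\<close> is a point, since near an isolated atom \<open>G\<close>, respectively \<open>b\<close>,
  would become negative.
\<close>

section \<open>Supports and Stieltjes transforms\<close>

text \<open>The computations rest on the factorisation \<open>F = G L\<close> with
  \<open>L u = u G u + d\<close>. The divided differences of the two factors are
  \<open>- c * res2\<close> and \<open>1 - c * tres2\<close>, kernels to which Cauchy-Schwarz
  applies separately. At the pair \<open>u, cnj u\<close> they give imaginary parts and at
  \<open>u, u\<close> derivatives, so the real and the complex estimates have the same shape. The
  uniqueness estimate works where \<open>c * tsqres \<tau> u < 1\<close>, which in the upper
  half-plane means \<open>Im (L u) > 0\<close>. Values of \<open>w\<close> satisfy this because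
  \<open>L (w z) = z b z = q z + d\<close>. Near a point of \<open>E\<close> it has to be proved,
  and this is why \<open>L\<close> is studied there along with \<open>F\<close>. Full Stieltjes
  inversion is avoided: null mass comes from a Poisson kernel bound, and masses are compared through
  primitives on the upper half-plane. That domain is convex, so a single constant of integration
  serves all gaps of the support at once, and it can be evaluated far to the left.\<close>

lemma closed_measure_support: "closed (measure_support M)"
proof -
  have "open (- measure_support M)"
  proof (subst open_subopen, intro ballI)
    fix x assume "x \<in> - measure_support M"
    then obtain U where "open U" "x \<in> U" "emeasure M U = 0"
      by (auto simp: measure_support_def)
    then show "\<exists>T. open T \<and> x \<in> T \<and> T \<subseteq> - measure_support M"
      by (intro exI[of _ U]) (auto simp: measure_support_def)
  qed
  then show ?thesis by (simp add: closed_def)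
qed

text \<open>The complement of the support is a union of open null sets; by Lindelof countably many
  of them suffice, so the union is null.\<close>

lemma AE_measure_support:
  assumes "sets M = sets borel"
  shows "AE t in M. t \<in> measure_support M"
proof -
  define F where "F = {U. open U \<and> emeasure M U = 0}"
  obtain F' where F': "F' \<subseteq> F" "countable F'" "\<Union>F' = \<Union>F"
    using Lindelof[of F] unfolding F_def by auto
  have "(\<Union>U\<in>F'. U) \<in> null_sets M"
  proof (rule null_sets_UN'[OF F'(2)])
    fix U assume "U \<in> F'"
    then show "U \<in> null_sets M" using F'(1) assms by (auto simp: F_def null_sets_def)
  qed
  then have "\<Union>F \<in> null_sets M" using F'(3) by simp
  moreover have "\<Union>F = - measure_support M"
    by (auto simp: F_def measure_support_def)
  ultimately show ?thesis by (auto intro!: AE_I')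
qed

lemma emeasure_support_disjoint:
  assumes "sets M = sets borel" "A \<in> sets borel" "A \<inter> measure_support M = {}"
  shows "emeasure M A = 0"
proof -
  have "AE t in M. t \<notin> A" using AE_measure_support[OF assms(1)] assms(3) by auto
  then show ?thesis using assms by (subst (asm) AE_iff_measurable[of A]) (auto dest: sets_eq_imp_space_eq)
qed

lemma measure_support_ne:
  assumes "real_distribution M"
  shows "measure_support M \<noteq> {}"
proof
  interpret real_distribution M by fact
  assume "measure_support M = {}"
  then have "emeasure M UNIV = 0" using emeasure_support_disjoint[of M UNIV] by simp
  then show False using emeasure_space_1 by simp
qed

lemma not_in_measure_supportI:
  assumes "open U" "x \<in> U" "emeasure M U = 0"
  shows "x \<notin> measure_support M"
  using assms by (auto simp: measure_support_def)

lemma AE_far_from_support_real: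
  fixes x :: real
  assumes "sets M = sets borel" "x \<notin> measure_support M"
  obtains r where "r > 0" "AE t in M. r \<le> \<bar>x - t\<bar>"
proof -
  obtain r where r: "r > 0" "ball x r \<subseteq> - measure_support M"
    using assms(2) closed_measure_support[of M] by (metis Compl_iff openE closed_def)
  have "AE t in M. r \<le> \<bar>x - t\<bar>"
    using AE_measure_support[OF assms(1)]
  proof eventually_elim
    case (elim t) then have "t \<notin> ball x r" using r(2) by auto
    then show ?case by (simp add: dist_real_def)
  qed
  then show ?thesis using r(1) that by blast
qed

lemma prob_on_halfline_AE:
  assumes "prob_on_halfline M"
  shows "AE t in M. 0 \<le> t"
proof -
  interpret real_distribution M using assms by (simp add: prob_on_halfline_def)
  have "AE t in M. t \<in> {0..}"
    using assms by (subst prob_Collect_eq_1[symmetric]) (auto simp: prob_on_halfline_def atLeast_def)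
  then show ?thesis by simp
qed

lemma prob_on_halfline_support:
  assumes "prob_on_halfline M"
  shows "measure_support M \<subseteq> {0..}"
proof
  interpret real_distribution M using assms by (simp add: prob_on_halfline_def)
  fix x assume x: "x \<in> measure_support M"
  show "x \<in> {0..}"
  proof (rule ccontr)
    assume "x \<notin> {0..}"
    then have "emeasure M {..<0} > 0" using x by (auto simp: measure_support_def)
    moreover have "AE t in M. t \<notin> {..<0}"
      using prob_on_halfline_AE[OF assms] by eventually_elim auto
    then have "emeasure M {..<0} = 0" 
      by (subst (asm) AE_iff_measurable[of "{..<0}"]) auto
    ultimately show False by simp
  qed
qed

text \<open>Dominated convergence along sequences: on the convex set \<open>S\<close> the mean value
  inequality bounds all difference quotients by the bound \<open>B\<close> on the derivative. The
  field is left general to cover real and complex arguments at once.\<close>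

lemma has_field_derivative_integral:
  fixes f :: "'a::{real_normed_field, banach, second_countable_topology} \<Rightarrow> real \<Rightarrow> 'a"
  assumes S: "convex S" "open S" "z \<in> S"
    and fin: "finite_measure M"
    and int: "\<And>w. w \<in> S \<Longrightarrow> integrable M (f w)"
    and meas: "f' z \<in> borel_measurable M"
    and der: "AE t in M. \<forall>w\<in>S. ((\<lambda>w. f w t) has_field_derivative f' w t) (at w) \<and> norm (f' w t) \<le> B"
  shows "((\<lambda>w. \<integral>t. f w t \<partial>M) has_field_derivative (\<integral>t. f' z t \<partial>M)) (at z)"
proof -
  interpret finite_measure M by fact
  have "((\<lambda>w. ((\<integral>t. f w t \<partial>M) - (\<integral>t. f z t \<partial>M)) / (w - z)) \<longlongrightarrow> (\<integral>t. f' z t \<partial>M)) (at z within S)"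
  proof (subst tendsto_at_iff_sequentially, intro allI impI)
    fix X :: "nat \<Rightarrow> 'a" assume X: "\<forall>i. X i \<in> S - {z}" "X \<longlonglongrightarrow> z"
    have "(\<lambda>n. \<integral>t. (f (X n) t - f z t) / (X n - z) \<partial>M) \<longlonglongrightarrow> (\<integral>t. f' z t \<partial>M)"
    proof (rule integral_dominated_convergence[where w = "\<lambda>_. B"])
      show "f' z \<in> borel_measurable M" by (rule meas)
      show "(\<lambda>t. (f (X n) t - f z t) / (X n - z)) \<in> borel_measurable M" for n
        using int[of "X n"] int[of z] X(1) S(3)
        by (intro borel_measurable_integrable integrable_divide_zero Bochner_Integration.integrable_diff) auto
      show "integrable M (\<lambda>_. B)" by simp
      show "AE t in M. (\<lambda>n. (f (X n) t - f z t) / (X n - z)) \<longlonglongrightarrow> f' z t"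
        using der
      proof eventually_elim
        case (elim t)
        then have "((\<lambda>w. (f w t - f z t) / (w - z)) \<longlongrightarrow> f' z t) (at z)"
          using S(3) by (simp add: has_field_derivative_iff)
        then show ?case using X by (auto simp: tendsto_at_iff_sequentially comp_def)
      qed
      show "AE t in M. norm ((f (X n) t - f z t) / (X n - z)) \<le> B" for n
        using der
      proof eventually_elim
        case (elim t)
        have "norm (f (X n) t - f z t) \<le> B * norm (X n - z)"
          by (rule field_differentiable_bound[OF S(1), of "\<lambda>w. f w t" "\<lambda>w. f' w t"])
             (use elim X S(3) in \<open>auto intro: has_field_derivative_at_within\<close>)
        then show ?case using X(1) by (simp add: norm_divide divide_simps)
      qed
    qed
    also have "(\<lambda>n. \<integral>t. (f (X n) t - f z t) / (X n - z) \<partial>M) =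
       (\<lambda>n. ((\<integral>t. f (X n) t \<partial>M) - (\<integral>t. f z t \<partial>M)) / (X n - z))"
      using X(1) S(3) int by (auto simp: Bochner_Integration.integral_diff)
    finally show "((\<lambda>w. ((\<integral>t. f w t \<partial>M) - (\<integral>t. f z t \<partial>M)) / (w - z)) \<circ> X) \<longlonglongrightarrow> (\<integral>t. f' z t \<partial>M)"
      by (simp add: comp_def)
  qed
  then show ?thesis
    unfolding has_field_derivative_iff at_within_open[OF S(3,2)] .
qed

text \<open>At \<open>of_real t = z\<close> the value is \<open>1 / 0 = 0\<close>, so this is a
  function continuous off a closed set and extended by zero.\<close>

lemma borel_measurable_resolvent [measurable]:
  fixes z :: "'a::{real_normed_field, banach, second_countable_topology}"
  shows "(\<lambda>t. 1 / (z - of_real t)) \<in> borel_measurable borel"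
proof -
  have "continuous_on (- {t. of_real t = z}) (\<lambda>t. inverse (z - of_real t))"
    by (auto intro!: continuous_intros)
  moreover have "closed {t. (of_real t :: 'a) = z}"
    by (intro closed_Collect_eq) (auto intro!: continuous_intros)
  ultimately have "(\<lambda>t. if t \<in> - {t. of_real t = z} then inverse (z - of_real t) else 0) \<in> borel_measurable borel"
    by (intro borel_measurable_continuous_on_if) (auto simp: closed_def)
  also have "(\<lambda>t. if t \<in> - {t. of_real t = z} then inverse (z - of_real t) else 0) = (\<lambda>t. 1 / (z - of_real t))"
    by (auto simp: fun_eq_iff divide_inverse)
  finally show ?thesis .
qed

lemma far_integrable:
  fixes z :: "'a::{real_normed_field, banach, second_countable_topology}"
  assumes "real_distribution M" "r > 0" "AE t in M. r \<le> norm (z - of_real t)"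
  shows "integrable M (\<lambda>t. 1 / (z - of_real t))"
proof -
  interpret real_distribution M by fact
  show ?thesis
  proof (rule integrable_const_bound[where B = "1 / r"])
    show "AE t in M. norm (1 / (z - of_real t)) \<le> 1 / r"
      using assms(3) by eventually_elim (use assms(2) in \<open>auto simp: norm_divide divide_simps\<close>)
  qed simp
qed

lemma far_integrable_mult:
  fixes z w :: "'a::{real_normed_field, banach, second_countable_topology}"
  assumes "real_distribution M" "r > 0" "AE t in M. r \<le> norm (z - of_real t)"
    "AE t in M. r \<le> norm (w - of_real t)"
  shows "integrable M (\<lambda>t. 1 / ((z - of_real t) * (w - of_real t)))"
proof -
  interpret real_distribution M by fact
  have "integrable M (\<lambda>t. (1 / (z - of_real t)) * (1 / (w - of_real t)))"
  proof (rule integrable_const_bound[where B = "(1 / r) * (1 / r)"])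
    show "AE t in M. norm ((1 / (z - of_real t)) * (1 / (w - of_real t))) \<le> (1 / r) * (1 / r)"
      using assms(3,4)
    proof eventually_elim
      case (elim t)
      show ?case unfolding norm_mult
        by (rule mult_mono) (use elim assms(2) in \<open>auto simp: norm_divide divide_simps\<close>)
    qed
  qed simp
  then show ?thesis by simp
qed

lemma has_field_derivative_stieltjes:
  fixes z :: "'a::{real_normed_field, banach, second_countable_topology}"
  assumes "real_distribution M" "r > 0" "AE t in M. r \<le> norm (z - of_real t)"
  shows "(stieltjes M has_field_derivative (\<integral>t. - (1 / (z - of_real t)\<^sup>2) \<partial>M)) (at z)"
proof -
  interpret real_distribution M by fact
  \<comment> \<open>Giving up half of the distance leaves a margin that is uniform on a ball, whence
    the bound \<open>4 / r^2\<close> for the derivatives of the integrand.\<close>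
  have far: "AE t in M. \<forall>w\<in>ball z (r / 2). r / 2 \<le> norm (w - of_real t)"
    using assms(3)
  proof (eventually_elim, intro ballI)
    fix t w assume "r \<le> norm (z - of_real t)" "w \<in> ball z (r / 2)"
    moreover have "norm (z - of_real t) \<le> norm (z - w) + norm (w - of_real t)"
      using norm_triangle_ineq[of "z - w" "w - of_real t"] by simp
    ultimately show "r / 2 \<le> norm (w - of_real t)" by (simp add: dist_norm)
  qed
  show ?thesis unfolding stieltjes_def
  proof (rule has_field_derivative_integral[where S = "ball z (r/2)" and B = "4 / r\<^sup>2" and f' = "\<lambda>w t. - (1 / (w - of_real t)\<^sup>2)"])
    show "integrable M (\<lambda>t. 1 / (w - of_real t))" if "w \<in> ball z (r/2)" for w
      by (rule far_integrable[OF assms(1), of "r/2"]) (use far that assms(2) in auto)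
    have "(\<lambda>t. - ((1 / (z - of_real t)) * (1 / (z - of_real t)))) \<in> borel_measurable M"
      by simp
    then show "(\<lambda>t. - (1 / (z - of_real t)\<^sup>2)) \<in> borel_measurable M"
      by (simp add: power2_eq_square)
    show "AE t in M. \<forall>w\<in>ball z (r / 2).
       ((\<lambda>w. 1 / (w - of_real t)) has_field_derivative - (1 / (w - of_real t)\<^sup>2)) (at w) \<and>
       norm (- (1 / (w - of_real t)\<^sup>2)) \<le> 4 / r\<^sup>2"
      using far
    proof (eventually_elim, intro ballI conjI)
      fix t w assume far: "\<forall>w\<in>ball z (r / 2). r / 2 \<le> norm (w - of_real t)" and w: "w \<in> ball z (r / 2)"
      then have "r / 2 \<le> norm (w - of_real t)" by simp
      then have ne: "w - of_real t \<noteq> 0" using assms(2) by auto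
      then show "((\<lambda>w. 1 / (w - of_real t)) has_field_derivative - (1 / (w - of_real t)\<^sup>2)) (at w)"
        by (auto intro!: derivative_eq_intros simp: power2_eq_square)
      have "(r / 2)\<^sup>2 \<le> (norm (w - of_real t))\<^sup>2"
        using far w assms(2) by (intro power_mono) auto
      then show "norm (- (1 / (w - of_real t)\<^sup>2)) \<le> 4 / r\<^sup>2"
        using ne assms(2) by (simp add: norm_divide norm_mult divide_simps power2_eq_square mult_ac)
    qed
  qed (use assms in \<open>auto simp: finite_measure_axioms\<close>)
qed

lemma stieltjes_cnj: "stieltjes M (cnj z) = cnj (stieltjes M z)"
proof -
  have "cnj (stieltjes M z) = (\<integral>t. cnj (1 / (z - of_real t)) \<partial>M)"
    unfolding stieltjes_def by (rule Bochner_Integration.integral_cnj[symmetric])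
  then show ?thesis by (simp add: stieltjes_def del: integral_cnj)
qed

lemma far_upper:
  fixes z :: complex
  shows "\<bar>Im z\<bar> \<le> norm (z - of_real t)"
  using abs_Im_le_cmod[of "z - of_real t"] by simp

lemma AE_far_from_support_complex:
  fixes x :: real
  assumes "sets M = sets borel" "x \<notin> measure_support M"
  obtains r where "r > 0" "\<And>z::complex. dist (of_real x) z < r \<Longrightarrow> AE t in M. r \<le> norm (z - of_real t)"
proof -
  obtain r where r: "r > 0" "AE t in M. r \<le> \<bar>x - t\<bar>"
    using AE_far_from_support_real[OF assms] by blast
  show thesis
  proof (rule that[of "r/2"])
    fix z :: complex assume z: "dist (of_real x) z < r / 2"
    show "AE t in M. r / 2 \<le> norm (z - of_real t)"
      using r(2)
    proof eventually_elim
      case (elim t)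
      have "norm (of_real x - of_real t :: complex) \<le> norm (of_real x - z) + norm (z - of_real t)"
        using norm_triangle_ineq[of "of_real x - z" "z - of_real t"] by simp
      then show ?case using z elim by (simp add: dist_norm flip: of_real_diff)
    qed
  qed (use r in auto)
qed

section \<open>Imaginary parts and a weak form of Stieltjes inversion\<close>

lemma Im_stieltjes_neg:
  assumes "real_distribution M" "Im z > 0"
  shows "Im (stieltjes M z) < 0"
proof -
  interpret real_distribution M by fact
  have int: "integrable M (\<lambda>t. 1 / (z - of_real t))"
    by (rule far_integrable[OF assms(1), of "Im z"]) (use assms(2) far_upper[of z] in auto)
  have neg: "Im (1 / (z - of_real t)) < 0" for t
  proof -
    have "z \<noteq> of_real t" using assms(2) by auto
    moreover from this have "(cmod (z - of_real t))\<^sup>2 > 0" by simp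
    ultimately show ?thesis using assms(2) by (simp add: Im_divide cmod_def divide_simps)
  qed
  have int': "integrable M (\<lambda>t. - Im (1 / (z - of_real t)))"
    using integrable_Im[OF int] by (rule integrable_minus)
  have "(\<integral>t. - Im (1 / (z - of_real t)) \<partial>M) \<noteq> 0"
  proof
    assume "(\<integral>t. - Im (1 / (z - of_real t)) \<partial>M) = 0"
    then have "AE t in M. - Im (1 / (z - of_real t)) = 0"
      using neg by (subst (asm) integral_nonneg_eq_0_iff_AE[OF int']) (auto intro!: AE_I2 less_imp_le)
    then have "AE t in M. False"
      by eventually_elim (use neg in \<open>metis neg_equal_0_iff_equal less_irrefl\<close>)
    then show False by simp
  qed
  moreover have "(\<integral>t. - Im (1 / (z - of_real t)) \<partial>M) \<ge> 0"
    by (intro integral_nonneg_AE AE_I2) (use neg less_imp_le in \<open>fastforce\<close>)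
  ultimately show ?thesis unfolding stieltjes_def using integral_Im[OF int] by simp
qed

text \<open>With Bochner integrals the conclusion also holds where the integrand is not integrable,
  since the integral is then \<open>0\<close>.\<close>

lemma Im_stieltjes_nonneg:
  assumes "Im z \<le> 0"
  shows "Im (stieltjes M z) \<ge> 0"
proof (cases "integrable M (\<lambda>t. 1 / (z - of_real t))")
  case True
  have "Im (stieltjes M z) = (\<integral>t. Im (1 / (z - of_real t)) \<partial>M)"
    unfolding stieltjes_def using True by (rule integral_Im[symmetric])
  also have "\<dots> \<ge> 0"
    using assms by (intro integral_nonneg_AE AE_I2) (simp add: Im_divide divide_nonpos_nonneg)
  finally show ?thesis .
qed (simp add: stieltjes_def not_integrable_integral_eq)

text \<open>The Poisson kernel at height \<open>e\<close> is at least \<open>1 / (2 * e)\<close> on the interval of radius \<open>e\<close>.\<close>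

lemma measure_interval_le_Im_stieltjes:
  assumes "real_distribution M" "e > 0"
  shows "measure M {x - e..x + e} \<le> 2 * e * \<bar>Im (stieltjes M (Complex x e))\<bar>"
proof -
  interpret real_distribution M by fact
  let ?z = "Complex x e"
  have int: "integrable M (\<lambda>t. 1 / (?z - of_real t))"
    by (rule far_integrable[OF assms(1), of "Im ?z"]) (use assms(2) far_upper[of ?z] in auto)
  have eq: "- Im (1 / (?z - of_real t)) = e / ((x - t)\<^sup>2 + e\<^sup>2)" for t
    by (simp add: Im_divide)
  have "measure M {x - e..x + e} = (\<integral>t. indicator {x - e..x + e} t \<partial>M)"
    by simp
  also have "\<dots> \<le> (\<integral>t. 2 * e * (- Im (1 / (?z - of_real t))) \<partial>M)"
  proof (rule integral_mono)
    show "integrable M (\<lambda>t. 2 * e * (- Im (1 / (?z - of_real t))))"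
      using integrable_Im[OF int] by (intro integrable_mult_right integrable_minus)
    fix t
    show "indicator {x - e..x + e} t \<le> 2 * e * (- Im (1 / (?z - of_real t)))"
    proof (cases "t \<in> {x - e..x + e}")
      case True
      then have "(x - t)\<^sup>2 \<le> e\<^sup>2" using assms(2) by (intro abs_le_square_iff[THEN iffD1]) auto
      then have "(x - t)\<^sup>2 + e\<^sup>2 \<le> 2 * e * e" by (simp add: power2_eq_square)
      moreover have "(x - t)\<^sup>2 + e\<^sup>2 > 0" using assms(2) by (simp add: add_nonneg_pos)
      ultimately show ?thesis using True assms(2) unfolding eq by (simp add: divide_simps)
    next
      case False
      then show ?thesis unfolding eq using assms(2) by simp
    qed
  qed (auto intro!: integrable_real_indicator simp: less_top[symmetric])
  also have "\<dots> = 2 * e * (- Im (stieltjes M ?z))"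
    unfolding stieltjes_def using integral_Im[OF int] by simp
  also have "\<dots> \<le> 2 * e * \<bar>Im (stieltjes M ?z)\<bar>"
    using assms(2) by (intro mult_left_mono) auto
  finally show ?thesis .
qed

text \<open>The interval of radius \<open>a\<close> around \<open>x\<close> is covered by
  \<open>n\<close> intervals of radius \<open>e = a / n\<close>. By the Poisson kernel bound each
  has mass at most \<open>2 * e * \<delta>\<close> as soon as the transform at height
  \<open>e\<close> above its centre has imaginary part at most \<open>\<delta>\<close>; uniform
  continuity of \<open>h\<close> and its real boundary values ensure this for small
  \<open>e\<close>. The sum \<open>2 * a * \<delta>\<close> is arbitrarily small.\<close>

lemma not_in_support_of_continuation:
  assumes M: "real_distribution M"
    and S: "open S" "of_real x \<in> S"
    and h: "continuous_on S h"
    and real: "\<And>y. of_real y \<in> S \<Longrightarrow> Im (h (of_real y)) = 0"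
    and eq: "\<And>z. z \<in> S \<Longrightarrow> Im z > 0 \<Longrightarrow> stieltjes M z = h z"
  shows "x \<notin> measure_support M"
proof -
  interpret real_distribution M by fact
  obtain r where r: "r > 0" "cball (of_real x) r \<subseteq> S"
    using S open_contains_cball by blast
  \<comment> \<open>Half the radius, so that the rectangle of width \<open>a\<close> on either side
    of \<open>x\<close> and height \<open>a\<close> stays inside the ball of radius
    \<open>r\<close>.\<close>
  define a where "a = r / 2"
  have a: "a > 0" using r by (simp add: a_def)
  have inS: "Complex y e \<in> cball (of_real x) r" if "\<bar>y - x\<bar> \<le> a" "0 \<le> e" "e \<le> a" for y e
  proof -
    have "dist (of_real x) (Complex y e) \<le> \<bar>y - x\<bar> + \<bar>e\<bar>"
      using cmod_le[of "of_real x - Complex y e"] by (simp add: dist_norm abs_minus_commute)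
    then show ?thesis using that by (simp add: a_def)
  qed
  have uc: "uniformly_continuous_on (cball (of_real x) r) h"
    using h r by (intro compact_uniformly_continuous) (auto intro: continuous_on_subset)
  have small: "measure M {x - a..x + a} \<le> 2 * a * \<delta>" if "\<delta> > 0" for \<delta>
  proof -
    obtain d where d: "d > 0" "\<And>z w. z \<in> cball (of_real x) r \<Longrightarrow> w \<in> cball (of_real x) r \<Longrightarrow> dist w z < d \<Longrightarrow> dist (h w) (h z) < \<delta>"
      using uc \<open>\<delta> > 0\<close> unfolding uniformly_continuous_on_def by metis
    obtain n :: nat where n: "a / d < real n" using reals_Archimedean2 by blast
    have "0 < a / d" using a d by simp
    then have "0 < real n" using n by linarith
    then have "n > 0" by simp
    note n = n this
    define e where "e = a / n"
    have e: "e > 0" "e < d" "e \<le> a"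
      using a n d by (auto simp: e_def divide_simps mult.commute)
    \<comment> \<open>Centres of the \<open>n\<close> adjacent intervals of length
      \<open>2 * e\<close>, counted from the left end.\<close>
    define y where "y k = x - a + (2 * real k + 1) * e" for k :: nat
    have ne: "real n * e = a" using n by (simp add: e_def)
    have cover: "{x - a..x + a} \<subseteq> (\<Union>k<n. {y k - e..y k + e})"
    proof
      fix t assume t: "t \<in> {x - a..x + a}"
      show "t \<in> (\<Union>k<n. {y k - e..y k + e})"
      \<comment> \<open>At the right end the floor formula would return the index \<open>n\<close>,
        which is out of range; that point belongs to the last interval instead.\<close>
      proof (cases "t = x + a")
        case True
        have "real (n - 1) = real n - 1" using n by simp
        then have "y (n - 1) = t - e" using True ne by (simp add: y_def algebra_simps)
        then show ?thesis using e n by (intro UN_I[of "n - 1"]) auto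
      next
        case False
        define k where "k = nat \<lfloor>(t - (x - a)) / (2 * e)\<rfloor>"
        have pos: "0 \<le> (t - (x - a)) / (2 * e)" using t e by auto
        then have k: "real k \<le> (t - (x - a)) / (2 * e)" "(t - (x - a)) / (2 * e) < real k + 1"
          unfolding k_def by (simp_all add: of_nat_nat)
        have "(t - (x - a)) / (2 * e) < n" using t False ne e by (simp add: divide_simps)
        then have "k < n" using k by linarith
        moreover have "t \<in> {y k - e..y k + e}"
          using k e by (auto simp: y_def divide_simps algebra_simps)
        ultimately show ?thesis by blast
      qed
    qed
    have im: "\<bar>Im (stieltjes M (Complex (y k) e))\<bar> \<le> \<delta>" if "k < n" for k
    proof -
      have "real k + 1 \<le> real n" using that by simp
      then have "(2 * real k + 1) * e \<le> (2 * real n - 1) * e" using e by (intro mult_right_mono) auto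
      then have "(2 * real k + 1) * e \<le> 2 * a" using ne e by (simp add: algebra_simps)
      moreover have "0 \<le> (2 * real k + 1) * e" using e by simp
      ultimately have y: "\<bar>y k - x\<bar> \<le> a" by (simp add: y_def)
      have 1: "Complex (y k) e \<in> cball (of_real x) r" using inS[OF y] e by simp
      have "Complex (y k) 0 \<in> cball (of_real x) r" using inS[OF y, of 0] a by simp
      then have 2: "of_real (y k) \<in> cball (complex_of_real x) r" by (simp add: complex_of_real_def)
      have "dist (Complex (y k) e) (of_real (y k)) < d"
        using e by (simp add: dist_norm complex_of_real_def cmod_def)
      then have "dist (h (Complex (y k) e)) (h (of_real (y k))) < \<delta>"
        using d(2)[OF 2 1] by simp
      moreover have "Im (h (of_real (y k))) = 0" using real 2 r by blast
      ultimately have "\<bar>Im (h (Complex (y k) e))\<bar> < \<delta>"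
        using abs_Im_le_cmod[of "h (Complex (y k) e) - h (of_real (y k))"] by (simp add: dist_norm)
      then show ?thesis using eq[of "Complex (y k) e"] 1 r e by auto
    qed
    have "measure M {x - a..x + a} \<le> measure M (\<Union>k<n. {y k - e..y k + e})"
      using cover by (intro finite_measure_mono) auto
    also have "\<dots> \<le> (\<Sum>k<n. measure M {y k - e..y k + e})"
      by (rule measure_UNION_le) auto
    also have "\<dots> \<le> (\<Sum>k<n. 2 * e * \<delta>)"
    proof (rule sum_mono)
      fix k assume "k \<in> {..<n}"
      then show "measure M {y k - e..y k + e} \<le> 2 * e * \<delta>"
        using measure_interval_le_Im_stieltjes[OF M e(1), of "y k"] im[of k] e(1)
        by (meson lessThan_iff mult_left_mono mult_pos_pos order_trans less_imp_le zero_less_numeral)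
    qed
    also have "\<dots> = 2 * a * \<delta>" using ne by (simp add: algebra_simps)
    finally show ?thesis .
  qed
  have "measure M {x - a..x + a} \<le> 0"
  proof (rule field_le_epsilon)
    fix e :: real assume "e > 0"
    then show "measure M {x - a..x + a} \<le> 0 + e"
      using small[of "e / (2 * a)"] a by simp
  qed
  then have "measure M {x - a<..<x + a} \<le> 0"
    using finite_measure_mono[of "{x - a<..<x + a}" "{x - a..x + a}"] by fastforce
  then have "emeasure M {x - a<..<x + a} = 0"
    by (simp add: emeasure_eq_measure measure_le_0_iff)
  then show ?thesis
    using a by (intro not_in_measure_supportI[of "{x - a<..<x + a}"]) auto
qed

lemma stieltjes_nonpos:
  assumes "prob_on_halfline M" "x \<le> 0"
  shows "stieltjes M (x::real) \<le> 0"
proof -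
  have "0 \<le> (\<integral>t. - (1 / (x - t)) \<partial>M)"
    using prob_on_halfline_AE[OF assms(1)] assms(2)
    by (intro integral_nonneg_AE) (auto elim!: eventually_mono simp: divide_le_0_iff)
  then show ?thesis by (simp add: stieltjes_def)
qed

section \<open>Cauchy-Schwarz, resolvent kernels and divided differences\<close>

lemma integral_Cauchy_Schwarz:
  fixes f g :: "'b \<Rightarrow> 'a::{real_normed_field, banach, second_countable_topology}"
  assumes meas: "f \<in> borel_measurable M" "g \<in> borel_measurable M"
    and f: "integrable M (\<lambda>x. (norm (f x))\<^sup>2)" and g: "integrable M (\<lambda>x. (norm (g x))\<^sup>2)"
  shows "(norm (\<integral>x. f x * g x \<partial>M))\<^sup>2 \<le> (\<integral>x. (norm (f x))\<^sup>2 \<partial>M) * (\<integral>x. (norm (g x))\<^sup>2 \<partial>M)"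
proof -
  define A where "A = (\<integral>x. (norm (f x))\<^sup>2 \<partial>M)"
  define B where "B = (\<integral>x. (norm (g x))\<^sup>2 \<partial>M)"
  define C where "C = (\<integral>x. norm (f x) * norm (g x) \<partial>M)"
  have int: "integrable M (\<lambda>x. norm (f x) * norm (g x))"
  proof (rule Bochner_Integration.integrable_bound[OF Bochner_Integration.integrable_add[OF f g]])
    show "(\<lambda>x. norm (f x) * norm (g x)) \<in> borel_measurable M" using meas by simp
    have "norm (f x) * norm (g x) \<le> (norm (f x))\<^sup>2 + (norm (g x))\<^sup>2" for x
      using sum_squares_bound[of "norm (f x)" "norm (g x)"]
        mult_nonneg_nonneg[of "norm (f x)" "norm (g x)"] norm_ge_zero[of "f x"] norm_ge_zero[of "g x"]
      by linarith
    then show "AE x in M. norm (norm (f x) * norm (g x)) \<le> norm ((norm (f x))\<^sup>2 + (norm (g x))\<^sup>2)"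
      by (intro AE_I2) simp
  qed
  have C: "C \<ge> 0" and A: "A \<ge> 0" unfolding C_def A_def by (auto intro!: integral_nonneg_AE)
  \<comment> \<open>The usual quadratic in \<open>s\<close>, evaluated below at its vertex
    \<open>C / A\<close>. For \<open>A = 0\<close> there is no vertex, and the remaining linear
    function can only be nonnegative if \<open>C = 0\<close>.\<close>
  have quad: "0 \<le> s\<^sup>2 * A - 2 * s * C + B" for s :: real
  proof -
    have "0 \<le> (\<integral>x. (s * norm (f x) - norm (g x))\<^sup>2 \<partial>M)"
      by (intro integral_nonneg_AE) simp
    also have "\<dots> = (\<integral>x. s\<^sup>2 * (norm (f x))\<^sup>2 - 2 * s * (norm (f x) * norm (g x)) + (norm (g x))\<^sup>2 \<partial>M)"
      by (simp add: power2_diff power_mult_distrib algebra_simps)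
    also have "\<dots> = s\<^sup>2 * A - 2 * s * C + B"
      using f g int by (simp add: A_def B_def C_def)
    finally show ?thesis .
  qed
  have "C\<^sup>2 \<le> A * B"
  proof (cases "A = 0")
    case True
    have "C = 0"
    proof (rule ccontr)
      assume "C \<noteq> 0"
      then have "C > 0" using C by simp
      \<comment> \<open>With \<open>A = 0\<close> this value of \<open>s\<close> makes the
        expression equal to \<open>- 1\<close>.\<close>
      then show False using quad[of "(B + 1) / (2 * C)"] True by simp
    qed
    then show ?thesis using True by simp
  next
    case False
    then have "A > 0" using A by simp
    then show ?thesis using quad[of "C / A"] by (simp add: field_simps power2_eq_square)
  qed
  moreover have "norm (\<integral>x. f x * g x \<partial>M) \<le> C"
    unfolding C_def using integral_norm_bound[of M "\<lambda>x. f x * g x"] by (simp add: norm_mult)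
  then have "(norm (\<integral>x. f x * g x \<partial>M))\<^sup>2 \<le> C\<^sup>2" by (intro power_mono) auto
  ultimately show ?thesis unfolding A_def B_def by simp
qed

text \<open>Distance is measured to almost every point instead of to the support, so that one
  condition covers nonreal points and real points off the support, in either field.\<close>

definition far :: "real measure \<Rightarrow> 'a::real_normed_field \<Rightarrow> bool" where
  "far M z \<longleftrightarrow> (\<exists>r>0. AE t in M. r \<le> norm (z - of_real t))"

lemma far_real:
  assumes "real_distribution M" "x \<notin> measure_support M"
  shows "far M (x::real)"
proof -
  interpret real_distribution M by fact
  show ?thesis using AE_far_from_support_real[of M x] assms(2) unfolding far_def by auto
qed

lemma far_of_real: "far M (x::real) \<Longrightarrow> far M (complex_of_real x)"
  unfolding far_def by (simp flip: of_real_diff)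

lemma far_Im: "Im z \<noteq> 0 \<Longrightarrow> far M z"
  unfolding far_def using far_upper[of z] by (intro exI[of _ "\<bar>Im z\<bar>"]) auto

lemma far2:
  assumes "far M z" "far M w"
  obtains r where "r > 0" "AE t in M. r \<le> norm (z - of_real t)" "AE t in M. r \<le> norm (w - of_real t)"
proof -
  obtain r s where "r > 0" "s > 0" and *: "AE t in M. r \<le> norm (z - of_real t)"
      "AE t in M. s \<le> norm (w - of_real t)"
    using assms unfolding far_def by auto
  show ?thesis
  proof (rule that[of "min r s"])
    show "min r s > 0" using \<open>r > 0\<close> \<open>s > 0\<close> by simp
    show "AE t in M. min r s \<le> norm (z - of_real t)" using *(1) by eventually_elim simp
    show "AE t in M. min r s \<le> norm (w - of_real t)" using *(2) by eventually_elim simp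
  qed
qed

text \<open>Up to sign \<open>res2\<close> is the divided difference of \<open>stieltjes\<close>,
  and \<open>tres2\<close> that of \<open>z * stieltjes M z\<close>. The real quantities
  \<open>sqres\<close> and \<open>tsqres\<close> are their values at a real point taken twice, or at
  a complex point and its conjugate.\<close>

definition res2 :: "real measure \<Rightarrow> 'a \<Rightarrow> 'a \<Rightarrow> 'a::{real_normed_field, banach, second_countable_topology}"
  where "res2 M z w = (\<integral>t. 1 / ((z - of_real t) * (w - of_real t)) \<partial>M)"

definition tres2 :: "real measure \<Rightarrow> 'a \<Rightarrow> 'a \<Rightarrow> 'a::{real_normed_field, banach, second_countable_topology}"
  where "tres2 M z w = (\<integral>t. of_real t / ((z - of_real t) * (w - of_real t)) \<partial>M)"

definition sqres :: "real measure \<Rightarrow> 'a::real_normed_field \<Rightarrow> real"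
  where "sqres M z = (\<integral>t. 1 / (norm (z - of_real t))\<^sup>2 \<partial>M)"

definition tsqres :: "real measure \<Rightarrow> 'a::real_normed_field \<Rightarrow> real"
  where "tsqres M z = (\<integral>t. t / (norm (z - of_real t))\<^sup>2 \<partial>M)"

lemma integrable_far: "real_distribution M \<Longrightarrow> far M z \<Longrightarrow> 
    integrable M (\<lambda>t. 1 / (z - of_real t :: 'a::{real_normed_field, banach, second_countable_topology}))"
  unfolding far_def using far_integrable by blast

lemma integrable_far2: "real_distribution M \<Longrightarrow> far M z \<Longrightarrow> far M w \<Longrightarrow>
    integrable M (\<lambda>t. 1 / ((z - of_real t) * (w - of_real t :: 'a::{real_normed_field, banach, second_countable_topology})))"
  by (erule far2[of M z w]) (auto intro: far_integrable_mult)

lemma AE_far_ne: "far M z \<Longrightarrow> AE t in M. z \<noteq> of_real t"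
  unfolding far_def by (auto elim!: eventually_mono)

lemma integrable_tfar2:
  fixes z :: "'a::{real_normed_field, banach, second_countable_topology}"
  assumes "real_distribution M" "far M z" "far M w"
  shows "integrable M (\<lambda>t. of_real t / ((z - of_real t) * (w - of_real t)))"
proof -
  \<comment> \<open>Writing \<open>t = z - (z - t)\<close> in the numerator leaves two bounded
    integrands.\<close>
  have "integrable M (\<lambda>t. z * (1 / ((z - of_real t) * (w - of_real t))) - 1 / (w - of_real t))"
    by (intro Bochner_Integration.integrable_diff integrable_mult_right integrable_far integrable_far2 assms)
  moreover have "AE t in M. z * (1 / ((z - of_real t) * (w - of_real t))) - 1 / (w - of_real t) 
      = of_real t / ((z - of_real t) * (w - of_real t))"
    using AE_far_ne[OF assms(2)] AE_far_ne[OF assms(3)]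
    by eventually_elim (simp add: divide_simps)
  moreover interpret real_distribution M by fact
  have "(\<lambda>t. of_real t * ((1 / (z - of_real t)) * (1 / (w - of_real t)))) \<in> borel_measurable M"
    by (intro borel_measurable_times borel_measurable_of_real) simp_all
  then have "(\<lambda>t. of_real t / ((z - of_real t) * (w - of_real t))) \<in> borel_measurable M"
    by simp
  ultimately show ?thesis
    by (subst (asm) integrable_cong_AE) auto
qed

lemma stieltjes_diff:
  fixes z :: "'a::{real_normed_field, banach, second_countable_topology}"
  assumes "real_distribution M" "far M z" "far M w"
  shows "stieltjes M z - stieltjes M w = - (z - w) * res2 M z w"
proof -
  have "stieltjes M z - stieltjes M w = (\<integral>t. 1 / (z - of_real t) - 1 / (w - of_real t) \<partial>M)"
    unfolding stieltjes_def
    by (intro Bochner_Integration.integral_diff[symmetric] integrable_far assms)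
  also have "\<dots> = (\<integral>t. - (z - w) * (1 / ((z - of_real t) * (w - of_real t))) \<partial>M)"
  proof (rule integral_cong_AE)
    show "AE t in M. 1 / (z - of_real t) - 1 / (w - of_real t) = - (z - w) * (1 / ((z - of_real t) * (w - of_real t)))"
      using AE_far_ne[OF assms(2)] AE_far_ne[OF assms(3)]
      by eventually_elim (simp add: field_simps)
  qed (intro borel_measurable_integrable Bochner_Integration.integrable_diff integrable_mult_right
      integrable_far integrable_far2 assms)+
  finally show ?thesis unfolding integral_mult_right_zero res2_def .
qed

lemma mult_stieltjes_diff:
  fixes z :: "'a::{real_normed_field, banach, second_countable_topology}"
  assumes "real_distribution M" "far M z" "far M w"
  shows "z * stieltjes M z - w * stieltjes M w = - (z - w) * tres2 M z w"
proof -
  have "z * stieltjes M z - w * stieltjes M w = (\<integral>t. z * (1 / (z - of_real t)) - w * (1 / (w - of_real t)) \<partial>M)"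
    unfolding stieltjes_def integral_mult_right_zero[symmetric]
    by (intro Bochner_Integration.integral_diff[symmetric] integrable_mult_right integrable_far assms)
  also have "\<dots> = (\<integral>t. - (z - w) * (of_real t / ((z - of_real t) * (w - of_real t))) \<partial>M)"
  proof (rule integral_cong_AE)
    show "AE t in M. z * (1 / (z - of_real t)) - w * (1 / (w - of_real t)) = - (z - w) * (of_real t / ((z - of_real t) * (w - of_real t)))"
      using AE_far_ne[OF assms(2)] AE_far_ne[OF assms(3)]
      by eventually_elim (simp add: field_simps)
  qed (intro borel_measurable_integrable Bochner_Integration.integrable_diff integrable_mult_right
      integrable_far integrable_tfar2 assms)+
  finally show ?thesis unfolding integral_mult_right_zero tres2_def .
qed

lemma integrable_sqres:
  fixes z :: "'a::{real_normed_field, banach, second_countable_topology}"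
  assumes "real_distribution M" "far M z"
  shows "integrable M (\<lambda>t. 1 / (norm (z - of_real t))\<^sup>2)"
  using integrable_norm[OF integrable_far2[OF assms(1,2,2)]]
  by (simp add: norm_divide norm_mult power2_eq_square)

lemma integrable_tsqres:
  fixes z :: "'a::{real_normed_field, banach, second_countable_topology}"
  assumes "prob_on_halfline M" "far M z"
  shows "integrable M (\<lambda>t. t / (norm (z - of_real t))\<^sup>2)"
proof -
  interpret real_distribution M using assms(1) by (simp add: prob_on_halfline_def)
  have "integrable M (\<lambda>t. norm (of_real t / ((z - of_real t) * (z - of_real t))))"
    using integrable_norm[OF integrable_tfar2[OF real_distribution_axioms assms(2,2)]] .
  moreover have "AE t in M. norm (of_real t / ((z - of_real t) * (z - of_real t))) = t / (norm (z - of_real t))\<^sup>2"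
    using prob_on_halfline_AE[OF assms(1)]
    by eventually_elim (simp add: norm_divide norm_mult power2_eq_square)
  moreover have "(\<lambda>t. t * (1 / (norm (z - of_real t))\<^sup>2)) \<in> borel_measurable M"
    using borel_measurable_integrable[OF integrable_sqres[OF real_distribution_axioms assms(2)]]
    by (intro borel_measurable_times) auto
  ultimately show ?thesis
    by (subst (asm) integrable_cong_AE) (auto intro: borel_measurable_integrable)
qed

lemma sqres_nonneg: "sqres M z \<ge> 0"
  unfolding sqres_def by (intro integral_nonneg_AE AE_I2) simp

lemma tsqres_nonneg:
  assumes "prob_on_halfline M" shows "tsqres M z \<ge> 0"
  unfolding tsqres_def
  using prob_on_halfline_AE[OF assms] by (intro integral_nonneg_AE) (auto elim!: eventually_mono)

lemma norm_res2_le: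
  fixes z :: "'a::{real_normed_field, banach, second_countable_topology}"
  assumes "real_distribution M" "far M z" "far M w"
  shows "(norm (res2 M z w))\<^sup>2 \<le> sqres M z * sqres M w"
proof -
  interpret real_distribution M by fact
  have "(norm (\<integral>t. (1 / (z - of_real t)) * (1 / (w - of_real t)) \<partial>M))\<^sup>2
      \<le> (\<integral>t. (norm (1 / (z - of_real t)))\<^sup>2 \<partial>M) * (\<integral>t. (norm (1 / (w - of_real t)))\<^sup>2 \<partial>M)"
    by (rule integral_Cauchy_Schwarz)
      (use integrable_sqres[OF assms(1)] assms in \<open>auto simp: norm_divide power_one_over power_divide\<close>)
  then show ?thesis by (simp add: res2_def sqres_def norm_divide power_divide)
qed

text \<open>The weight \<open>t\<close> is shared as \<open>sqrt t * sqrt t\<close> between the two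
  resolvents before Cauchy-Schwarz; this is where the restriction to the half-line enters.\<close>

lemma norm_tres2_le:
  fixes z :: "'a::{real_normed_field, banach, second_countable_topology}"
  assumes "prob_on_halfline M" "far M z" "far M w"
  shows "(norm (tres2 M z w))\<^sup>2 \<le> tsqres M z * tsqres M w"
proof -
  interpret real_distribution M using assms(1) by (simp add: prob_on_halfline_def)
  let ?f = "\<lambda>z t. of_real (sqrt t) * (1 / (z - of_real t)) :: 'a"
  have sq: "AE t in M. (norm (?f z t))\<^sup>2 = t / (norm (z - of_real t))\<^sup>2" for z
    using prob_on_halfline_AE[OF assms(1)]
    by eventually_elim (simp add: norm_mult norm_divide power_divide)
  have [measurable]: "?f z \<in> borel_measurable M" for z
    by (intro borel_measurable_times borel_measurable_of_real) simp_all
  have m2: "(\<lambda>t. (norm (?f z t))\<^sup>2) \<in> borel_measurable M" for z by measurable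
  have m3: "(\<lambda>t. t / (norm (z - of_real t))\<^sup>2) \<in> borel_measurable M" if "far M z" for z :: 'a
    using borel_measurable_integrable[OF integrable_tsqres[OF assms(1) that]] .
  have i: "integrable M (\<lambda>t. (norm (?f z t))\<^sup>2)" and e: "(\<integral>t. (norm (?f z t))\<^sup>2 \<partial>M) = tsqres M z" if "far M z" for z :: 'a
    using integrable_cong_AE[OF m2 m3[OF that] sq] integral_cong_AE[OF m2 m3[OF that] sq]
      integrable_tsqres[OF assms(1) that] by (simp_all add: tsqres_def)
  have "tres2 M z w = (\<integral>t. ?f z t * ?f w t \<partial>M)"
    unfolding tres2_def
  proof (rule integral_cong_AE)
    show "AE t in M. of_real t / ((z - of_real t) * (w - of_real t)) = ?f z t * ?f w t"
      using prob_on_halfline_AE[OF assms(1)]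
    proof eventually_elim
      case (elim t)
      then have "of_real t = of_real (sqrt t) * (of_real (sqrt t) :: 'a)" by (simp flip: of_real_mult)
      then show ?case by (simp add: mult_ac)
    qed
  qed (use borel_measurable_integrable[OF integrable_tfar2[OF real_distribution_axioms assms(2,3)]] in auto)
  then show ?thesis using integral_Cauchy_Schwarz[of "?f z" M "?f w"] i e assms by simp
qed

lemma res2_cnj: "res2 M z (cnj z) = of_real (sqres M z)"
  unfolding res2_def sqres_def integral_complex_of_real[symmetric]
  by (intro Bochner_Integration.integral_cong refl)
    (metis (no_types, lifting) complex_cnj_complex_of_real complex_cnj_diff complex_norm_square of_real_1 of_real_divide)

lemma tres2_cnj: "tres2 M z (cnj z) = of_real (tsqres M z)"
  unfolding tres2_def tsqres_def integral_complex_of_real[symmetric]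
  by (intro Bochner_Integration.integral_cong refl)
    (metis (no_types, lifting) complex_cnj_complex_of_real complex_cnj_diff complex_norm_square of_real_divide)

lemma res2_real: "res2 M x x = sqres M (x::real)"
  unfolding res2_def sqres_def by (simp add: power2_eq_square)

lemma tres2_real: "tres2 M x x = tsqres M (x::real)"
  unfolding tres2_def tsqres_def by (simp add: power2_eq_square)

lemma res2_of_real: "res2 M (complex_of_real x) (of_real y) = of_real (res2 M x y)"
  unfolding res2_def integral_complex_of_real[symmetric] by simp

lemma tres2_of_real: "tres2 M (complex_of_real x) (of_real y) = of_real (tres2 M x y)"
  unfolding tres2_def integral_complex_of_real[symmetric] by simp

lemma stieltjes_deriv:
  fixes z :: "'a::{real_normed_field, banach, second_countable_topology}"
  assumes "real_distribution M" "far M z"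
  shows "(stieltjes M has_field_derivative - res2 M z z) (at z)"
proof -
  obtain r where "r > 0" "AE t in M. r \<le> norm (z - of_real t)"
    using assms(2) by (auto simp: far_def)
  from has_field_derivative_stieltjes[OF assms(1) this] show ?thesis
    by (simp add: res2_def power2_eq_square)
qed

text \<open>With \<open>c = \<rho>\<^sup>2\<gamma>\<close> and \<open>d = \<rho>\<^sup>2(1 - \<gamma>)\<close>, the map \<open>\<Phi>\<close> is \<open>pmap c d \<tau>\<close> and \<open>\<omega>\<close> is
  \<open>pmap (- c) (- d) \<mu>\<close>.\<close>

definition gfac :: "real \<Rightarrow> real measure \<Rightarrow> 'a \<Rightarrow> 'a::{real_normed_field, banach, second_countable_topology}"
  where "gfac c M z = 1 + of_real c * stieltjes M z"

definition lfac :: "real \<Rightarrow> real \<Rightarrow> real measure \<Rightarrow> 'a \<Rightarrow> 'a::{real_normed_field, banach, second_countable_topology}"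
  where "lfac c d M z = z * gfac c M z + of_real d"

definition pmap :: "real \<Rightarrow> real \<Rightarrow> real measure \<Rightarrow> 'a \<Rightarrow> 'a::{real_normed_field, banach, second_countable_topology}"
  where "pmap c d M z = gfac c M z * lfac c d M z"

lemma gfac_of_real: "gfac c M (complex_of_real x) = of_real (gfac c M x)"
  by (simp add: gfac_def stieltjes_complex_of_real)

lemma lfac_of_real: "lfac c d M (complex_of_real x) = of_real (lfac c d M x)"
  by (simp add: lfac_def gfac_of_real)

lemma pmap_of_real: "pmap c d M (complex_of_real x) = of_real (pmap c d M x)"
  by (simp add: pmap_def gfac_of_real lfac_of_real)

lemma gfac_diff:
  assumes "real_distribution M" "far M z" "far M w"
  shows "gfac c M z - gfac c M w = - (z - w) * (of_real c * res2 M z w)"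
proof -
  have "gfac c M z - gfac c M w = of_real c * (stieltjes M z - stieltjes M w)"
    by (simp add: gfac_def right_diff_distrib)
  then show ?thesis unfolding stieltjes_diff[OF assms] by (simp add: mult_ac)
qed

lemma lfac_diff:
  assumes "real_distribution M" "far M z" "far M w"
  shows "lfac c d M z - lfac c d M w = (z - w) * (1 - of_real c * tres2 M z w)"
proof -
  have "lfac c d M z - lfac c d M w = (z - w) + of_real c * (z * stieltjes M z - w * stieltjes M w)"
    by (simp add: lfac_def gfac_def algebra_simps)
  then show ?thesis unfolding mult_stieltjes_diff[OF assms] by (simp add: algebra_simps)
qed

lemma gfac_deriv:
  assumes "real_distribution M" "far M z"
  shows "(gfac c M has_field_derivative - (of_real c * res2 M z z)) (at z)"
  unfolding gfac_def using stieltjes_deriv[OF assms]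
  by (auto intro!: derivative_eq_intros)

text \<open>The product rule gives \<open>gfac c M z - z * c * res2 M z z\<close>. The identity
  \<open>tres2 = z * res2 - stieltjes\<close> brings it into the form of the divided difference in
  \<open>lfac_diff\<close> at coinciding points.\<close>

lemma lfac_deriv:
  fixes z :: "'a::{real_normed_field, banach, second_countable_topology}"
  assumes "real_distribution M" "far M z"
  shows "(lfac c d M has_field_derivative 1 - of_real c * tres2 M z z) (at z)"
proof -
  have "tres2 M z z = (\<integral>t. z * (1 / ((z - of_real t) * (z - of_real t))) - 1 / (z - of_real t) \<partial>M)"
    unfolding tres2_def
  proof (rule integral_cong_AE)
    show "AE t in M. of_real t / ((z - of_real t) * (z - of_real t)) = z * (1 / ((z - of_real t) * (z - of_real t))) - 1 / (z - of_real t)"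
      using AE_far_ne[OF assms(2)] by eventually_elim (simp add: divide_simps)
  qed (intro borel_measurable_integrable Bochner_Integration.integrable_diff integrable_mult_right
      integrable_far integrable_far2 integrable_tfar2 assms)+
  also have "\<dots> = z * res2 M z z - stieltjes M z"
    unfolding res2_def stieltjes_def integral_mult_right_zero[symmetric]
    by (intro Bochner_Integration.integral_diff integrable_mult_right integrable_far integrable_far2 assms)
  finally have eq: "tres2 M z z = z * res2 M z z - stieltjes M z" .
  have "1 - of_real c * tres2 M z z = gfac c M z + z * (- (of_real c * res2 M z z))"
    unfolding eq by (simp add: gfac_def algebra_simps)
  then show ?thesis
    unfolding lfac_def using gfac_deriv[OF assms, of c] by (auto intro!: derivative_eq_intros)
qed

lemma pmap_deriv:
  assumes "real_distribution M" "far M z"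
  shows "(pmap c d M has_field_derivative
      - (of_real c * res2 M z z) * lfac c d M z + gfac c M z * (1 - of_real c * tres2 M z z)) (at z)"
  unfolding pmap_def using gfac_deriv[OF assms, of c] lfac_deriv[OF assms, of c d]
  by (auto intro!: derivative_eq_intros simp: algebra_simps)

text \<open>The divided difference at \<open>z\<close> and \<open>cnj z\<close>, where the kernel is
  the real number \<open>sqres\<close>; \<open>Im_lfac\<close> arises in the same way.\<close>

lemma Im_gfac:
  assumes "real_distribution M" "Im z \<noteq> 0"
  shows "Im (gfac c M z) = - Im z * (c * sqres M z)"
proof -
  have "gfac c M (cnj z) = cnj (gfac c M z)" by (simp add: gfac_def stieltjes_cnj)
  then have "gfac c M z - cnj (gfac c M z) = - (z - cnj z) * of_real (c * sqres M z)"
    using gfac_diff[OF assms(1), of z "cnj z" c] far_Im[of z M] far_Im[of "cnj z" M] assms(2) by (simp add: res2_cnj)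
  then have "2 * Im (gfac c M z) = - (2 * Im z) * (c * sqres M z)"
    unfolding complex_diff_cnj by (simp add: complex_eq_iff)
  then show ?thesis by simp
qed

lemma Im_lfac:
  assumes "real_distribution M" "Im z \<noteq> 0"
  shows "Im (lfac c d M z) = Im z * (1 - c * tsqres M z)"
proof -
  have "lfac c d M (cnj z) = cnj (lfac c d M z)" by (simp add: lfac_def gfac_def stieltjes_cnj)
  then have "lfac c d M z - cnj (lfac c d M z) = (z - cnj z) * of_real (1 - c * tsqres M z)"
    using lfac_diff[OF assms(1), of z "cnj z" c d] far_Im[of z M] far_Im[of "cnj z" M] assms(2) by (simp add: tres2_cnj)
  then have "2 * Im (lfac c d M z) = (2 * Im z) * (1 - c * tsqres M z)"
    unfolding complex_diff_cnj by (simp add: complex_eq_iff)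
  then show ?thesis by simp
qed

section \<open>Boundary behaviour and local inversion at real points\<close>

lemma far_near_real:
  assumes "real_distribution M" "x \<notin> measure_support M"
  obtains r where "r > 0" "\<And>z::complex. z \<in> ball (of_real x) r \<Longrightarrow> far M z"
proof -
  interpret real_distribution M by fact
  obtain r where r: "r > 0" "\<And>z::complex. dist (of_real x) z < r \<Longrightarrow> AE t in M. r \<le> norm (z - of_real t)"
    using AE_far_from_support_complex[of M x] assms by auto
  show ?thesis by (rule that[OF r(1)]) (use r in \<open>auto simp: far_def\<close>)
qed

lemma holomorphic_far:
  assumes "real_distribution M" "open S" "\<And>z. z \<in> S \<Longrightarrow> far M z"
  shows "stieltjes M holomorphic_on S" "gfac c M holomorphic_on S" "lfac c d M holomorphic_on S" "pmap c d M holomorphic_on S"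
proof -
  show 1: "stieltjes M holomorphic_on S"
    using assms by (subst holomorphic_on_open) (auto intro: stieltjes_deriv)
  show "gfac c M holomorphic_on S" unfolding gfac_def by (intro holomorphic_intros 1)
  then show 2: "lfac c d M holomorphic_on S" unfolding lfac_def by (intro holomorphic_intros)
  show "pmap c d M holomorphic_on S" unfolding pmap_def by (intro holomorphic_intros \<open>gfac c M holomorphic_on S\<close> 2)
qed

text \<open>Since \<open>f\<close> is real at \<open>x\<close>, the difference quotient in the
  vertical direction has real part \<open>Im (f (Complex x e)) / e\<close>, and the bound passes to
  the limit.\<close>

lemma derivative_ge_of_Im_ge:
  fixes f :: "complex \<Rightarrow> complex"
  assumes "(f has_field_derivative of_real D) (at (of_real x))" "Im (f (of_real x)) = 0"
    and ge: "\<And>e. 0 < e \<Longrightarrow> k * e \<le> Im (f (Complex x e))"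
  shows "k \<le> D"
proof -
  have "((\<lambda>y. (f y - f (of_real x)) / (y - of_real x)) \<longlongrightarrow> of_real D) (at (of_real x))"
    using assms(1) by (simp add: has_field_derivative_iff)
  moreover have "filterlim (\<lambda>e. Complex x e) (at (of_real x)) (at_right 0)"
  proof (subst filterlim_at, intro conjI)
    show "((\<lambda>e. Complex x e) \<longlongrightarrow> of_real x) (at_right 0)"
      unfolding complex_of_real_def by (intro tendsto_intros)
    show "\<forall>\<^sub>F e in at_right 0. Complex x e \<in> UNIV \<and> Complex x e \<noteq> of_real x"
      using eventually_at_right_less[of "0::real"] by eventually_elim (auto simp: complex_eq_iff)
  qed
  ultimately have "((\<lambda>e. (f (Complex x e) - f (of_real x)) / (Complex x e - of_real x)) \<longlongrightarrow> of_real D) (at_right 0)"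
    by (rule filterlim_compose)
  from tendsto_Re[OF this]
  have lim: "((\<lambda>e. Re ((f (Complex x e) - f (of_real x)) / (Complex x e - of_real x))) \<longlongrightarrow> D) (at_right 0)"
    by simp
  show ?thesis
  proof (rule tendsto_lowerbound[OF lim])
    show "\<forall>\<^sub>F e in at_right 0. k \<le> Re ((f (Complex x e) - f (of_real x)) / (Complex x e - of_real x))"
      using eventually_at_right_less[of "0::real"]
    proof eventually_elim
      case (elim e)
      have eq: "Complex x e - of_real x = \<i> * of_real e" by (simp add: complex_eq_iff)
      have "Re (w / (\<i> * of_real e)) = Im w / e" for w
        using elim by (simp add: Re_divide power2_eq_square)
      then show ?case using ge[OF elim] assms(2) elim unfolding eq by (simp add: pos_le_divide_eq)
    qed
  qed simp
qed

text \<open>Beyond the inverse function theorem this records that near \<open>x\<close> the map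
  respects the upper half-plane and the real axis in both directions. The function
  \<open>f z - D * z\<close> has derivative at most \<open>D / 2\<close> near \<open>x\<close> and
  is real at \<open>Re z\<close>, so \<open>Im (f z)\<close> differs from \<open>D * Im z\<close> by
  at most \<open>D / 2 * \<bar>Im z\<bar>\<close> and has the same sign.\<close>

lemma real_local_inverse:
  assumes f: "f holomorphic_on S" "open S" "of_real x \<in> S"
    and real: "\<And>y. of_real y \<in> S \<Longrightarrow> Im (f (of_real y)) = 0"
    and D: "(f has_field_derivative of_real D) (at (of_real x))" "D > 0"
  obtains r h where "r > 0" "ball (of_real x) r \<subseteq> S" "open (f ` ball (of_real x) r)"
    "continuous_on (f ` ball (of_real x) r) h"
    "\<And>z. z \<in> ball (of_real x) r \<Longrightarrow> h (f z) = z"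
    "\<And>z. z \<in> ball (of_real x) r \<Longrightarrow> Im (f z) > 0 \<longleftrightarrow> Im z > 0"
    "\<And>z. z \<in> ball (of_real x) r \<Longrightarrow> Im (f z) = 0 \<longleftrightarrow> Im z = 0"
proof -
  have dD: "deriv f (of_real x) = of_real D" using D by (simp add: DERIV_imp_deriv)
  have "isCont (deriv f) (of_real x)"
    using holomorphic_deriv[OF f(1,2)] f holomorphic_on_imp_continuous_on continuous_on_eq_continuous_at by blast
  then obtain s where s: "s > 0" "\<And>z. dist z (of_real x) < s \<Longrightarrow> dist (deriv f z) (of_real D) < D / 2"
    unfolding continuous_at_eps_delta dD using D(2) by (metis half_gt_zero)
  obtain s' where s': "s' > 0" "ball (of_real x) s' \<subseteq> S" using f openE by blast
  define T where "T = ball (complex_of_real x) (min s s')"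
  have T: "T \<subseteq> S" "open T" "of_real x \<in> T" using s s' by (auto simp: T_def)
  have hT: "f holomorphic_on T" using f T by (meson holomorphic_on_subset)
  have sign: "\<bar>Im (f z) - D * Im z\<bar> \<le> D / 2 * \<bar>Im z\<bar>" if z: "z \<in> T" for z
  proof -
    define y where "y = complex_of_real (Re z)"
    have "norm (of_real x - y) \<le> norm (of_real x - z)"
      using abs_Re_le_cmod[of "of_real x - z"] by (simp add: y_def flip: of_real_diff)
    then have y: "y \<in> T" using z by (simp add: T_def dist_norm)
    have "norm ((f z - of_real D * z) - (f y - of_real D * y)) \<le> D / 2 * norm (z - y)"
    proof (rule field_differentiable_bound[of T _ "\<lambda>z. deriv f z - of_real D"])
      show "convex T" by (simp add: T_def)
      show "((\<lambda>z. f z - of_real D * z) has_field_derivative deriv f z - of_real D) (at z within T)" if "z \<in> T" for z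
        by (rule has_field_derivative_at_within)
          (use holomorphic_derivI[OF hT T(2) that, of UNIV] in \<open>auto intro!: derivative_eq_intros\<close>)
      show "norm (deriv f z - of_real D) \<le> D / 2" if "z \<in> T" for z
        using s(2)[of z] that by (simp add: T_def dist_norm norm_minus_commute)
    qed (use y z in auto)
    moreover have "Im ((f z - of_real D * z) - (f y - of_real D * y)) = Im (f z) - D * Im z"
      using real[of "Re z"] y T by (auto simp: y_def)
    moreover have "z - y = \<i> * of_real (Im z)" by (simp add: y_def complex_eq_iff)
    then have "norm (z - y) = \<bar>Im z\<bar>" by (simp add: norm_mult)
    ultimately show ?thesis
      using abs_Im_le_cmod[of "(f z - of_real D * z) - (f y - of_real D * y)"] by simp
  qed
  obtain r where r: "r > 0" "ball (of_real x) r \<subseteq> T" "open (f ` ball (of_real x) r)" "inj_on f (ball (of_real x) r)"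
    using has_complex_derivative_locally_invertible[OF hT T(3,2)] dD D(2) by auto
  obtain h where h: "h holomorphic_on f ` ball (of_real x) r" "\<And>z. z \<in> ball (of_real x) r \<Longrightarrow> h (f z) = z"
    using holomorphic_has_inverse[of f "ball (of_real x) r"] hT r by (metis holomorphic_on_subset open_ball)
  have pos: "Im (f z) > 0 \<longleftrightarrow> Im z > 0" and zero: "Im (f z) = 0 \<longleftrightarrow> Im z = 0" if z: "z \<in> ball (of_real x) r" for z
  proof -
    have z': "\<bar>Im (f z) - D * Im z\<bar> \<le> D / 2 * \<bar>Im z\<bar>" using sign z r by blast
    consider "Im z > 0" | "Im z = 0" | "Im z < 0" by linarith
    then have "(Im (f z) > 0 \<longleftrightarrow> Im z > 0) \<and> (Im (f z) = 0 \<longleftrightarrow> Im z = 0)"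
    proof cases
      case 1
      then have "D * Im z > 0" "\<bar>Im (f z) - D * Im z\<bar> \<le> D * Im z / 2" using D(2) z' by simp_all
      then show ?thesis using 1 by linarith
    next
      case 2
      then show ?thesis using z' by simp
    next
      case 3
      then have "D * Im z < 0" "\<bar>Im (f z) - D * Im z\<bar> \<le> - (D * Im z / 2)"
        using D(2) z' by (simp_all add: mult_pos_neg)
      then show ?thesis using 3 by linarith
    qed
    then show "Im (f z) > 0 \<longleftrightarrow> Im z > 0" "Im (f z) = 0 \<longleftrightarrow> Im z = 0" by auto
  qed
  show thesis
    by (rule that[OF r(1) _ r(3) holomorphic_on_imp_continuous_on[OF h(1)] h(2) pos zero])
      (use r T in auto)
qed

lemma isCont_far: "real_distribution M \<Longrightarrow> far M z \<Longrightarrow> isCont (gfac a M) z"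
    "real_distribution M \<Longrightarrow> far M z \<Longrightarrow> isCont (pmap a a' M) z"
  for z :: "'a::{real_normed_field, banach, second_countable_topology}"
  using gfac_deriv[of M z a] pmap_deriv[of M z a a'] by (auto dest: DERIV_isCont)

lemma tendsto_upper:
  "((\<lambda>e. Complex x e) \<longlongrightarrow> of_real x) (at_right 0)"
  unfolding complex_of_real_def by (intro tendsto_intros)

section \<open>Power series expansions\<close>

text \<open>The integrand is a geometric series with ratio \<open>q = - h / (x - t)\<close>, and
  \<open>\<bar>q\<bar> \<le> 1 / 2\<close> for \<open>\<bar>h\<bar> \<le> r / 2\<close>. The
  remainder after \<open>N\<close> terms is at most \<open>2 / r * (1 / 2) ^ N\<close> for almost
  all \<open>t\<close> simultaneously, so integrating term by term is justified by this bound
  alone.\<close>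

lemma has_fps_expansion_stieltjes:
  assumes M: "real_distribution M" and x: "x \<notin> measure_support M"
  shows "\<exists>F. (\<lambda>h. stieltjes M (x + h :: real)) has_fps_expansion F"
proof -
  interpret real_distribution M by fact
  obtain r where r: "r > 0" "AE t in M. r \<le> \<bar>x - t\<bar>"
    using AE_far_from_support_real[of M x] x by auto
  define a where "a n = (-1) ^ n * (\<integral>t. (1 / (x - t)) ^ (n + 1) \<partial>M)" for n
  have int: "integrable M (\<lambda>t. (1 / (x - t)) ^ (n + 1))" for n
  proof (rule integrable_const_bound[where B = "(1 / r) ^ (n + 1)"])
    show "AE t in M. norm ((1 / (x - t)) ^ (n + 1)) \<le> (1 / r) ^ (n + 1)"
      using r(2)
    proof eventually_elim
      case (elim t)
      then have "norm (1 / (x - t)) \<le> 1 / r" using r(1) by (simp add: norm_divide divide_simps)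
      then show ?case unfolding norm_power by (intro power_mono) auto
    qed
  qed simp
  have sums: "(\<lambda>n. a n * h ^ n) sums stieltjes M (x + h)" if h: "\<bar>h\<bar> \<le> r / 2" for h
  proof -
    have far: "far M (x + h)" unfolding far_def
    proof (intro exI conjI)
      show "AE t in M. r / 2 \<le> norm (x + h - of_real t)"
        using r(2) by eventually_elim (use h in \<open>simp add: abs_le_iff abs_if split: if_splits\<close>)
    qed (use r in simp)
    have part: "(\<Sum>n<N. a n * h ^ n) = (\<integral>t. (\<Sum>n<N. (- h) ^ n * (1 / (x - t)) ^ (n + 1)) \<partial>M)" for N
    proof -
      have "(\<integral>t. (\<Sum>n<N. (- h) ^ n * (1 / (x - t)) ^ (n + 1)) \<partial>M)
          = (\<Sum>n<N. (\<integral>t. (- h) ^ n * (1 / (x - t)) ^ (n + 1) \<partial>M))"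
        by (intro Bochner_Integration.integral_sum integrable_mult_right int)
      also have "\<dots> = (\<Sum>n<N. a n * h ^ n)"
        unfolding integral_mult_right_zero a_def
        by (intro sum.cong refl) (simp add: power_minus[of h])
      finally show ?thesis ..
    qed
    have rem: "\<bar>(\<Sum>n<N. a n * h ^ n) - stieltjes M (x + h)\<bar> \<le> 2 / r * (1 / 2) ^ N" for N
    proof -
      have intS: "integrable M (\<lambda>t. (\<Sum>n<N. (- h) ^ n * (1 / (x - t)) ^ (n + 1)))"
        by (intro Bochner_Integration.integrable_sum integrable_mult_right int)
      have intg: "integrable M (\<lambda>t. 1 / (x + h - t))" using integrable_far[OF M far] by simp
      have eq: "(\<Sum>n<N. a n * h ^ n) - stieltjes M (x + h) =
          (\<integral>t. (\<Sum>n<N. (- h) ^ n * (1 / (x - t)) ^ (n + 1)) - 1 / (x + h - t) \<partial>M)"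
        unfolding part stieltjes_def using intS intg by (subst Bochner_Integration.integral_diff) auto
      have "\<bar>(\<Sum>n<N. a n * h ^ n) - stieltjes M (x + h)\<bar> \<le> (\<integral>t. \<bar>(\<Sum>n<N. (- h) ^ n * (1 / (x - t)) ^ (n + 1)) - 1 / (x + h - t)\<bar> \<partial>M)"
        unfolding eq by (rule integral_abs_bound)
      also have "\<dots> \<le> (\<integral>t. 2 / r * (1 / 2) ^ N \<partial>M)"
      proof (rule integral_mono_AE)
        show "AE t in M. \<bar>(\<Sum>n<N. (- h) ^ n * (1 / (x - t)) ^ (n + 1)) - 1 / (x + h - t)\<bar> \<le> 2 / r * (1 / 2) ^ N"
          using r(2)
        proof eventually_elim
          case (elim t)
          define y where "y = 1 / (x - t)"
          define q where "q = - h * y"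
          have xt: "x - t \<noteq> 0" using elim r(1) by auto
          have y: "\<bar>y\<bar> \<le> 1 / r" using elim r(1) by (simp add: y_def abs_divide divide_simps)
          have "\<bar>q\<bar> \<le> (r / 2) * (1 / r)" unfolding q_def abs_mult abs_minus_cancel
            using y h r(1) by (intro mult_mono) auto
          then have q: "\<bar>q\<bar> \<le> 1 / 2" using r(1) by simp
          then have q1: "1 - q \<noteq> 0" "1 / 2 \<le> \<bar>1 - q\<bar>" by auto
          have "(\<Sum>n<N. (- h) ^ n * y ^ (n + 1)) = y * (\<Sum>n<N. q ^ n)"
            unfolding q_def power_mult_distrib sum_distrib_left by (intro sum.cong refl) simp
          also have "\<dots> = y * ((1 - q ^ N) / (1 - q))" using q1(1) by (simp add: sum_gp_strict)
          finally have S: "(\<Sum>n<N. (- h) ^ n * y ^ (n + 1)) = y * ((1 - q ^ N) / (1 - q))" .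
          have "(x - t) * (1 - q) = (x - t) + h * ((x - t) * y)" by (simp add: q_def algebra_simps)
          also have "\<dots> = x + h - t" using xt by (simp add: y_def)
          finally have "(x - t) * (1 - q) = x + h - t" .
          then have "1 / (x + h - t) = 1 / ((x - t) * (1 - q))" by simp
          also have "\<dots> = y / (1 - q)" by (simp add: y_def)
          finally have "(\<Sum>n<N. (- h) ^ n * y ^ (n + 1)) - 1 / (x + h - t) = - (y * q ^ N / (1 - q))"
            unfolding S using q1(1) by (simp add: field_simps)
          also have "\<bar>\<dots>\<bar> = \<bar>y\<bar> * \<bar>q\<bar> ^ N * (1 / \<bar>1 - q\<bar>)" by (simp add: abs_mult power_abs)
          also have "\<dots> \<le> (1 / r) * (1 / 2) ^ N * 2"
          proof (intro mult_mono)
            show "\<bar>q\<bar> ^ N \<le> (1 / 2) ^ N" using q by (intro power_mono) auto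
            have "1 / \<bar>1 - q\<bar> \<le> 1 / (1 / 2)" using q1(2) by (intro divide_left_mono) auto
            then show "1 / \<bar>1 - q\<bar> \<le> 2" by simp
          qed (use y r(1) in auto)
          finally show ?case by (simp add: y_def mult_ac)
        qed
      qed (use intS intg in auto)
      also have "\<dots> = 2 / r * (1 / 2) ^ N" by (simp add: prob_space[unfolded space_eq_univ])
      finally show ?thesis .
    qed
    have "(\<lambda>N. 2 / r * (1 / 2) ^ N) \<longlonglongrightarrow> 2 / r * 0"
      by (intro tendsto_mult tendsto_const LIMSEQ_power_zero) simp
    then have lim0: "(\<lambda>N. 2 / r * (1 / 2) ^ N) \<longlonglongrightarrow> 0" by simp
    have "(\<lambda>N. (\<Sum>n<N. a n * h ^ n) - stieltjes M (x + h)) \<longlonglongrightarrow> 0"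
      by (rule Lim_null_comparison[OF _ lim0]) (use rem in simp)
    then show ?thesis unfolding sums_def using LIM_zero_iff by blast
  qed
  have "(\<lambda>h. stieltjes M (x + h)) has_fps_expansion Abs_fps a"
    unfolding has_fps_expansion_def
  proof
    have "ereal (norm (r / 2)) \<le> conv_radius a"
      by (rule conv_radius_geI) (use sums[of "r / 2"] r(1) in \<open>auto simp: sums_iff\<close>)
    then show "0 < fps_conv_radius (Abs_fps a)"
      using r(1) by (simp add: fps_conv_radius_def) (metis ereal_less(2) half_gt_zero less_le_trans)
    have "eventually (\<lambda>h. h \<in> ball 0 (r / 2)) (nhds (0::real))"
      using r(1) by (intro eventually_nhds_in_open) auto
    then show "\<forall>\<^sub>F h in nhds 0. eval_fps (Abs_fps a) h = stieltjes M (x + h)"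
    proof eventually_elim
      case (elim h)
      then show ?case using sums[of h] by (simp add: eval_fps_def sums_iff dist_real_def)
    qed
  qed
  then show ?thesis ..
qed

lemma real_analytic_pmap:
  assumes "real_distribution M" "S \<inter> measure_support M = {}"
  shows "real_analytic_on (pmap c d M) S"
  unfolding real_analytic_on_def
proof
  fix x assume "x \<in> S"
  then obtain A where A: "(\<lambda>h. stieltjes M (x + h)) has_fps_expansion A"
    using has_fps_expansion_stieltjes[OF assms(1), of x] assms(2) by auto
  have "(\<lambda>h. (1 + c * stieltjes M (x + h)) * ((x + h) * (1 + c * stieltjes M (x + h)) + d))
    has_fps_expansion (fps_const 1 + fps_const c * A) * ((fps_const x + fps_X) * (fps_const 1 + fps_const c * A) + fps_const d)"
    by (intro has_fps_expansion_mult has_fps_expansion_add has_fps_expansion_const has_fps_expansion_fps_X A)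
  then show "\<exists>F. (\<lambda>h. pmap c d M (x + h)) has_fps_expansion F"
    by (auto simp: pmap_def lfac_def gfac_def)
qed

section \<open>Logarithmic potentials\<close>

text \<open>From above, the argument of \<open>x - t\<close> tends to \<open>0\<close> for
  \<open>t < x\<close> and to \<open>pi\<close> for \<open>t > x\<close>; boundary values of this
  integral therefore count the mass to the right of \<open>x\<close>.\<close>

definition arg_pot :: "real measure \<Rightarrow> complex \<Rightarrow> real" where
  "arg_pot M z = (\<integral>t. Im (Ln (z - of_real t)) \<partial>M)"

text \<open>A logarithmic potential, normalised at \<open>\<i>\<close> so that it converges for every probability measure.\<close>

definition log_pot :: "real measure \<Rightarrow> complex \<Rightarrow> complex" where
  "log_pot M z = (\<integral>t. Ln (z - of_real t) - Ln (\<i> - of_real t) \<partial>M)"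

lemma notin_nonpos_Reals_upper: "Im z > 0 \<Longrightarrow> z - of_real t \<notin> \<real>\<^sub>\<le>\<^sub>0"
  by (auto simp: complex_nonpos_Reals_iff)

lemma Ln_measurable: 
  assumes "Im z > 0" shows "(\<lambda>t. Ln (z - of_real t)) \<in> borel_measurable borel"
  by (intro borel_measurable_continuous_onI continuous_on_Ln' continuous_intros)
    (use notin_nonpos_Reals_upper[OF assms] in auto)

text \<open>On the half-plane \<open>Im w \<ge> e\<close> the derivative of \<open>Ln\<close> is at
  most \<open>1 / e\<close>, so the difference of the two logarithms is bounded independently of
  \<open>t\<close>.\<close>

lemma integrable_log_pot:
  assumes "real_distribution M" "Im z > 0"
  shows "integrable M (\<lambda>t. Ln (z - of_real t) - Ln (\<i> - of_real t))"
proof -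
  interpret real_distribution M by fact
  define e where "e = min 1 (Im z)"
  have e: "e > 0" using assms(2) by (simp add: e_def)
  show ?thesis
  proof (rule integrable_const_bound[where B = "1 / e * norm (z - \<i>)"])
    have "norm (Ln (z - of_real t) - Ln (\<i> - of_real t)) \<le> 1 / e * norm ((z - of_real t) - (\<i> - of_real t))" for t
    proof (rule field_differentiable_bound[of "{w. Im w \<ge> e}" Ln inverse])
      show "convex {w. e \<le> Im w}" by (rule convex_halfspace_Im_ge)
      fix w assume w: "w \<in> {w. e \<le> Im w}"
      then have "w \<notin> \<real>\<^sub>\<le>\<^sub>0" using e by (auto simp: complex_nonpos_Reals_iff)
      then show "(Ln has_field_derivative inverse w) (at w within {w. e \<le> Im w})"
        by (rule has_field_derivative_at_within[OF has_field_derivative_Ln])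
      have "e \<le> cmod w" using w abs_Im_le_cmod[of w] by simp
      then show "norm (inverse w) \<le> 1 / e" using e by (simp add: norm_inverse le_imp_inverse_le divide_inverse)
    qed (auto simp: e_def)
    then show "AE t in M. norm (Ln (z - of_real t) - Ln (\<i> - of_real t)) \<le> 1 / e * norm (z - \<i>)"
      by simp
    show "(\<lambda>t. Ln (z - of_real t) - Ln (\<i> - of_real t)) \<in> borel_measurable M"
      using Ln_measurable[OF assms(2)] Ln_measurable[of \<i>] by simp
  qed
qed

lemma log_pot_deriv:
  assumes M: "real_distribution M" and z: "Im z > 0"
  shows "(log_pot M has_field_derivative stieltjes M z) (at z)"
proof -
  interpret real_distribution M by fact
  let ?S = "{w. Im w > Im z / 2}"
  show ?thesis unfolding log_pot_def stieltjes_def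
  proof (rule has_field_derivative_integral[where S = ?S and B = "2 / Im z"
        and f' = "\<lambda>w t. 1 / (w - of_real t)"])
    show "convex ?S" by (rule convex_halfspace_Im_gt)
    show "open ?S" by (rule open_halfspace_Im_gt)
    show "z \<in> ?S" using z by simp
    show "finite_measure M" by (rule finite_measure_axioms)
    show "integrable M (\<lambda>t. Ln (w - of_real t) - Ln (\<i> - of_real t))" if "w \<in> ?S" for w
      using that z by (intro integrable_log_pot[OF M]) simp
    show "(\<lambda>t. 1 / (z - of_real t)) \<in> borel_measurable M" by simp
    show "AE t in M. \<forall>w\<in>?S. ((\<lambda>w. Ln (w - of_real t) - Ln (\<i> - of_real t)) has_field_derivative 1 / (w - of_real t)) (at w) \<and>
       norm (1 / (w - of_real t)) \<le> 2 / Im z"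
    proof (intro AE_I2 ballI conjI)
      fix t w assume w: "w \<in> ?S"
      then have "Im w > 0" using z by simp
      then show "((\<lambda>w. Ln (w - of_real t) - Ln (\<i> - of_real t)) has_field_derivative 1 / (w - of_real t)) (at w)"
        using notin_nonpos_Reals_upper[of w t]
        by (auto intro!: derivative_eq_intros simp: inverse_eq_divide)
      have "Im z / 2 \<le> cmod (w - of_real t)" using w far_upper[of w t] z by simp
      then show "norm (1 / (w - of_real t)) \<le> 2 / Im z"
        using z by (simp add: norm_divide divide_simps mult_ac)
    qed
  qed
qed

lemma integrable_arg_pot:
  assumes "real_distribution M" "Im z > 0"
  shows "integrable M (\<lambda>t. Im (Ln (z - of_real t)))"
proof -
  interpret real_distribution M by fact
  show ?thesis
  proof (rule integrable_const_bound[where B = pi])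
    show "AE t in M. norm (Im (Ln (z - of_real t))) \<le> pi"
    proof (rule AE_I2)
      fix t
      have "z - of_real t \<noteq> 0" using assms(2) by auto
      then show "norm (Im (Ln (z - of_real t))) \<le> pi"
        using mpi_less_Im_Ln[of "z - of_real t"] Im_Ln_le_pi[of "z - of_real t"] by simp
    qed
    show "(\<lambda>t. Im (Ln (z - of_real t))) \<in> borel_measurable M"
      using Ln_measurable[OF assms(2)] by simp
  qed
qed

text \<open>Arguments are bounded by \<open>pi\<close>, so the imaginary parts may be integrated
  separately and the normalisation at \<open>\<i>\<close> becomes an additive constant.\<close>

lemma Im_log_pot:
  assumes "real_distribution M" "Im z > 0"
  shows "Im (log_pot M z) = arg_pot M z - arg_pot M \<i>"
proof -
  have "Im (log_pot M z) = (\<integral>t. Im (Ln (z - of_real t) - Ln (\<i> - of_real t)) \<partial>M)"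
    unfolding log_pot_def using integrable_log_pot[OF assms] by (rule integral_Im[symmetric])
  also have "\<dots> = arg_pot M z - arg_pot M \<i>"
    using integrable_arg_pot[OF assms] integrable_arg_pot[OF assms(1), of \<i>]
    by (simp add: arg_pot_def)
  finally show ?thesis .
qed

lemma tendsto_Im_Ln_pos:
  assumes "X \<longlonglongrightarrow> complex_of_real r" "r > 0"
  shows "(\<lambda>n. Im (Ln (X n))) \<longlonglongrightarrow> 0"
proof -
  have "(\<lambda>n. Ln (X n)) \<longlonglongrightarrow> Ln (complex_of_real r)"
    using assms by (intro tendsto_Ln) (auto simp: complex_nonpos_Reals_iff)
  from tendsto_Im[OF this] show ?thesis using assms(2) by (simp add: Ln_of_real)
qed

text \<open>The limit lies on the branch cut; above it \<open>Ln X = Ln (- X) + pi * \<i>\<close>,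
  and \<open>- X\<close> stays away from the cut.\<close>

lemma tendsto_Im_Ln_neg:
  assumes "X \<longlonglongrightarrow> complex_of_real r" "r < 0" "\<And>n. Im (X n) > 0"
  shows "(\<lambda>n. Im (Ln (X n))) \<longlonglongrightarrow> pi"
proof -
  have "(\<lambda>n. Im (Ln (- X n))) \<longlonglongrightarrow> 0"
    by (rule tendsto_Im_Ln_pos[of _ "- r"]) (use assms tendsto_minus[OF assms(1)] in auto)
  then have "(\<lambda>n. pi + Im (Ln (- X n))) \<longlonglongrightarrow> pi + 0" by (intro tendsto_add tendsto_const)
  moreover have "pi + Im (Ln (- X n)) = Im (Ln (X n))" for n
  proof -
    have "X n \<noteq> 0" using assms(3)[of n] by auto
    then show ?thesis using Ln_minus[of "X n"] assms(3)[of n] by simp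
  qed
  ultimately show ?thesis by simp
qed

text \<open>Dominated convergence with bound \<open>pi\<close>. As \<open>x\<close> is off the
  support, almost no \<open>t\<close> equals \<open>x\<close>, the one place where the argument has
  no limit of its own.\<close>

lemma tendsto_arg_pot:
  assumes M: "real_distribution M" and X: "X \<longlonglongrightarrow> complex_of_real x" "\<And>n. Im (X n) > 0"
    and x: "x \<notin> measure_support M"
  shows "(\<lambda>n. arg_pot M (X n)) \<longlonglongrightarrow> pi * measure M {x<..}"
proof -
  interpret real_distribution M by fact
  have "(\<lambda>n. arg_pot M (X n)) \<longlonglongrightarrow> (\<integral>t. pi * indicator {x<..} t \<partial>M)"
    unfolding arg_pot_def
  proof (rule integral_dominated_convergence[where w = "\<lambda>_. pi"])
    show "(\<lambda>t. Im (Ln (X n - of_real t))) \<in> borel_measurable M" for n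
      using integrable_arg_pot[OF M X(2)] by (rule borel_measurable_integrable)
    have "AE t in M. t \<in> measure_support M" by (rule AE_measure_support) simp
    then show "AE t in M. (\<lambda>n. Im (Ln (X n - of_real t))) \<longlonglongrightarrow> pi * indicator {x<..} t"
    proof eventually_elim
      case (elim t)
      have lim: "(\<lambda>n. X n - of_real t) \<longlonglongrightarrow> complex_of_real (x - t)"
        using tendsto_diff[OF X(1) tendsto_const] by simp
      consider "t < x" | "t > x" using elim x by (metis linorder_neqE)
      then show ?case
      proof cases
        case 1
        then show ?thesis using tendsto_Im_Ln_pos[OF lim] by simp
      next
        case 2
        then show ?thesis using tendsto_Im_Ln_neg[OF lim] X(2) by simp
      qed
    qed
    show "AE t in M. norm (Im (Ln (X n - of_real t))) \<le> pi" for n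
    proof (rule AE_I2)
      fix t
      have "X n - of_real t \<noteq> 0" using X(2)[of n] by auto
      then show "norm (Im (Ln (X n - of_real t))) \<le> pi"
        using mpi_less_Im_Ln[of "X n - of_real t"] Im_Ln_le_pi[of "X n - of_real t"] by simp
    qed
  qed simp_all
  then show ?thesis by simp
qed

section \<open>Atoms and bounded supports\<close>

lemma compact_measure_support_AE:
  assumes "sets M = sets borel" "compact (measure_support M)"
  obtains K where "K \<ge> 0" "AE t in M. t \<le> K"
proof -
  obtain K where K: "\<forall>t\<in>measure_support M. norm t \<le> K" using compact_imp_bounded[OF assms(2)] by (auto simp: bounded_iff)
  show thesis
  proof (rule that[of "max 0 K"])
    show "AE t in M. t \<le> max 0 K" using AE_measure_support[OF assms(1)]
      by eventually_elim (use K in \<open>fastforce\<close>)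
  qed simp
qed

text \<open>The parameter \<open>s = \<plusminus>1\<close> is the side from which the atom \<open>x\<close> is approached.\<close>

lemma stieltjes_near_atom:
  fixes x :: real
  assumes M: "real_distribution M" and s: "s = 1 \<or> s = -1" and e: "e > 0" and h: "0 < h" "h < e / 2"
    and AE: "AE t in M. s * (t - x) \<le> 0 \<or> e \<le> s * (t - x)"
  shows "s * stieltjes M (x + s * h) \<ge> measure M {x} / h - 2 / e"
proof -
  interpret real_distribution M by fact
  have s2: "s * s = 1" using s by auto
  have eq: "s * (1 / (x + s * h - t)) = 1 / (h - s * (t - x))" for t
  proof -
    have "s * (x + s * h - t) = h - s * (t - x)" using s2 by (simp add: algebra_simps flip: mult.assoc)
    then show ?thesis using s by (auto simp: divide_simps)
  qed
  have far: "far M (x + s * h)" unfolding far_def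
  proof (intro exI conjI)
    show "min h (e / 2) > 0" using h e by simp
    show "AE t in M. min h (e / 2) \<le> norm (x + s * h - of_real t)"
      using AE
    proof eventually_elim
      case (elim t)
      have "norm (x + s * h - of_real t) = \<bar>s * (x + s * h - t)\<bar>" using s by (auto simp: abs_mult)
      also have "s * (x + s * h - t) = h - s * (t - x)" using s2 by (simp add: algebra_simps flip: mult.assoc)
      finally show ?case using elim h e by auto
    qed
  qed
  have ind: "integrable M (\<lambda>t. indicator {x} t :: real)"
    by (intro integrable_real_indicator) (auto simp: less_top[symmetric])
  then have "measure M {x} / h - 2 / e = (\<integral>t. indicator {x} t / h - 2 / e \<partial>M)"
    by (simp add: prob_space[unfolded space_eq_univ])
  also have "\<dots> \<le> (\<integral>t. s * (1 / (x + s * h - t)) \<partial>M)"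
  proof (rule integral_mono_AE)
    show "integrable M (\<lambda>t. s * (1 / (x + s * h - t)))"
      using integrable_far[OF M far] by (intro integrable_mult_right) simp
    \<comment> \<open>Three kinds of mass: the atom contributes \<open>1 / h\<close>, mass on the
      other side of \<open>x\<close> a nonnegative amount, and mass at distance at least
      \<open>e\<close> on the side of approach no less than \<open>- 2 / e\<close>, because
      \<open>h < e / 2\<close>.\<close>
    show "AE t in M. indicator {x} t / h - 2 / e \<le> s * (1 / (x + s * h - t))"
      using AE
    proof eventually_elim
      case (elim t)
      consider "t = x" | "t \<noteq> x" "s * (t - x) \<le> 0" | "t \<noteq> x" "e \<le> s * (t - x)" using elim by blast
      then show ?case
      proof cases
        case 1
        then show ?thesis unfolding eq using h e by simp
      next
        case 2
        have "0 \<le> 1 / (h - s * (t - x))" using 2 h by simp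
        moreover have "0 \<le> 2 / e" using e by simp
        ultimately have "- (2 / e) \<le> 1 / (h - s * (t - x))" by linarith
        then show ?thesis unfolding eq using 2 by simp
      next
        case 3
        have "e / 2 \<le> s * (t - x) - h" using 3 h by linarith
        then have "1 / (s * (t - x) - h) \<le> 1 / (e / 2)" using e by (intro divide_left_mono) auto
        moreover have "1 / (h - s * (t - x)) = - (1 / (s * (t - x) - h))" by (metis minus_diff_eq minus_divide_right)
        ultimately show ?thesis unfolding eq using 3 by simp
      qed
    qed
    show "integrable M (\<lambda>t. indicator {x} t / h - 2 / e)" using ind by simp
  qed
  also have "\<dots> = s * stieltjes M (x + s * h)" unfolding stieltjes_def integral_mult_right_zero by simp
  finally show ?thesis .
qed

lemma stieltjes_near_atom_unbounded:
  fixes x :: real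
  assumes "real_distribution M" "s = 1 \<or> s = -1" "e > 0" "measure M {x} > 0"
    "AE t in M. s * (t - x) \<le> 0 \<or> e \<le> s * (t - x)"
  shows "\<exists>h. 0 < h \<and> h < e / 2 \<and> s * stieltjes M (x + s * h) > B"
proof -
  define a where "a = measure M {x}"
  \<comment> \<open>The second bound makes the contribution \<open>a / h\<close> of the atom exceed
    \<open>\<bar>B\<bar> + 2 / e\<close>, which pays for the loss \<open>2 / e\<close>; the first
    keeps \<open>h\<close> below \<open>e / 2\<close>.\<close>
  define h where "h = min (e / 4) (a / (2 * (\<bar>B\<bar> + 2 / e + 1)))"
  have a: "a > 0" using assms by (simp add: a_def)
  have den: "\<bar>B\<bar> + 2 / e + 1 > 0" using assms(3) by (simp add: add_nonneg_pos)
  have "h \<le> e / 4" unfolding h_def by (rule min.cobounded1)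
  then have h: "0 < h" "h < e / 2" using a den assms(3) by (simp_all add: h_def)
  have "h \<le> a / (2 * (\<bar>B\<bar> + 2 / e + 1))" by (simp add: h_def)
  then have "\<bar>B\<bar> + 2 / e + 1 \<le> a / (2 * h)" using h den by (simp add: divide_simps mult_ac)
  also have "a / (2 * h) \<le> a / h" using a h by (simp add: divide_simps)
  finally have "B < a / h - 2 / e" by linarith
  then show ?thesis using stieltjes_near_atom[OF assms(1-3) h assms(5)] h unfolding a_def by force
qed

lemma measure_isolated_support_point:
  assumes M: "real_distribution M" and x: "x \<in> measure_support M" and e: "e > 0"
    and "{x - e<..<x} \<inter> measure_support M = {}" "{x<..<x + e} \<inter> measure_support M = {}"
  shows "measure M {x} > 0"
proof -
  interpret real_distribution M by fact
  have "emeasure M {x - e<..<x + e} > 0" using x e by (auto simp: measure_support_def)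
  moreover have "{x - e<..<x + e} = {x} \<union> ({x - e<..<x} \<union> {x<..<x + e})" using e by auto
  moreover have "emeasure M ({x - e<..<x} \<union> {x<..<x + e}) = 0"
    using assms(4,5) by (intro emeasure_support_disjoint) auto
  ultimately have "emeasure M {x} > 0"
    using emeasure_subadditive[of "{x}" M "{x - e<..<x} \<union> {x<..<x + e}"] by auto
  then show ?thesis by (simp add: emeasure_eq_measure)
qed

lemma AE_isolated:
  assumes "real_distribution M" "{x - e<..<x} \<inter> measure_support M = {}" "{x<..<x + e} \<inter> measure_support M = {}"
    and "s = 1 \<or> s = -1"
  shows "AE t in M. s * (t - x) \<le> 0 \<or> e \<le> s * (t - x)"
proof -
  interpret real_distribution M by fact
  have "AE t in M. t \<in> measure_support M" by (rule AE_measure_support) simp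
  then show ?thesis
  proof eventually_elim
    case (elim t)
    then have "t \<notin> {x - e<..<x}" "t \<notin> {x<..<x + e}" using assms by auto
    then show ?case using assms(4) by auto
  qed
qed

section \<open>Finite unions of intervals\<close>

text \<open>A component that misses \<open>S\<close> has a positive distance \<open>\<delta>\<close>
  from it. By maximality \<open>E\<close> has points within \<open>\<delta>\<close> beyond both ends
  of the component; the interval between them still misses \<open>S\<close>, so the gap property
  puts the component into \<open>E\<close>.\<close>

lemma component_meets:
  fixes E S :: "real set"
  assumes E: "open E" and S: "closed S" "S \<inter> E = {}"
    and gap: "\<And>a b. a \<in> E \<Longrightarrow> b \<in> E \<Longrightarrow> a < b \<Longrightarrow> {a..b} \<inter> S = {} \<Longrightarrow> {a..b} \<subseteq> E"
    and K: "{a..b} \<in> components (- E)" "a \<le> b"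
  shows "{a..b} \<inter> S \<noteq> {}"
proof
  assume disj: "{a..b} \<inter> S = {}"
  obtain \<delta> where \<delta>: "\<delta> > 0" "\<And>x y. x \<in> {a..b} \<Longrightarrow> y \<in> S \<Longrightarrow> \<delta> \<le> dist x y"
    using separate_compact_closed[OF compact_Icc S(1) disj] by auto
  have sub: "{a..b} \<subseteq> - E" using K(1) by (rule in_components_subset)
  have near: "\<exists>y\<in>E. y \<in> I" if I: "connected I" "I \<inter> {a..b} \<noteq> {}" "\<not> I \<subseteq> {a..b}" for I
    using components_maximal[OF K(1) I(1) _] I by blast
  have "a \<in> {a - \<delta><..b} \<inter> {a..b}" "b \<in> {a..<b + \<delta>} \<inter> {a..b}" using \<delta> K(2) by auto
  then have "{a - \<delta><..b} \<inter> {a..b} \<noteq> {}" "{a..<b + \<delta>} \<inter> {a..b} \<noteq> {}" by blast+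
  moreover have "a - \<delta> / 2 \<in> {a - \<delta><..b}" "b + \<delta> / 2 \<in> {a..<b + \<delta>}" using \<delta> K(2) by auto
  then have "\<not> {a - \<delta><..b} \<subseteq> {a..b}" "\<not> {a..<b + \<delta>} \<subseteq> {a..b}" using \<delta> by fastforce+
  ultimately obtain x y where x: "x \<in> E" "x \<in> {a - \<delta><..b}" and y: "y \<in> E" "y \<in> {a..<b + \<delta>}"
    using near[of "{a - \<delta><..b}"] near[of "{a..<b + \<delta>}"] by auto
  have xy: "a - \<delta> < x" "x < a" "b < y" "y < b + \<delta>" using x y sub K(2) by (auto simp: not_le[symmetric])
  have "{x..y} \<inter> S = {}"
  proof (rule ccontr)
    assume "{x..y} \<inter> S \<noteq> {}"
    then obtain s where s: "s \<in> S" "x \<le> s" "s \<le> y" by auto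
    \<comment> \<open>The point \<open>max a (min b s)\<close> is the projection of \<open>s\<close>
      to \<open>{a..b}\<close>.\<close>
    have "\<delta> \<le> dist (max a (min b s)) s" using \<delta>(2)[of "max a (min b s)" s] s K(2) by auto
    then show False using s xy \<delta>(1) disj K(2) by (auto simp: dist_real_def max_def min_def split: if_splits)
  qed
  then have "{x..y} \<subseteq> E" using gap x y xy K(2) by simp
  then show False using sub xy K(2) by (auto simp: subset_iff)
qed

text \<open>A connected piece lies in a single component and every component meets a piece, so there
  are no more components than pieces.\<close>

lemma finite_components_meeting:
  fixes C :: "real set"
  assumes "finite \<I>" "\<And>J. J \<in> \<I> \<Longrightarrow> connected J" "\<Union>\<I> \<subseteq> C"
    and "\<And>K. K \<in> components C \<Longrightarrow> K \<inter> \<Union>\<I> \<noteq> {}"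
  shows "finite (components C)"
proof (rule finite_subset)
  show "components C \<subseteq> (\<lambda>J. connected_component_set C (SOME x. x \<in> J)) ` \<I>"
  proof
    fix K assume K: "K \<in> components C"
    then obtain s J where s: "s \<in> K" "s \<in> J" "J \<in> \<I>" using assms(4) by blast
    obtain y where "K = connected_component_set C y" using K by (auto simp: components_def)
    then have "K = connected_component_set C s" using s(1) connected_component_eq by blast
    moreover have "connected_component C s (SOME x. x \<in> J)"
      unfolding connected_component_def using s assms(2,3) by (intro exI[of _ J]) (auto intro: someI)
    then have "connected_component_set C s = connected_component_set C (SOME x. x \<in> J)"
      by (intro connected_component_eq) (simp add: connected_component_sym)
    ultimately show "K \<in> (\<lambda>J. connected_component_set C (SOME x. x \<in> J)) ` \<I>"
      using s(3) by blast
  qed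
qed (use assms in simp)

lemma sort_disjoint_intervals:
  fixes \<K> :: "real set set"
  assumes "finite \<K>" "disjoint \<K>" "\<And>K. K \<in> \<K> \<Longrightarrow> \<exists>a b. a \<le> b \<and> K = {a..b}"
  obtains p :: nat and u v :: "nat \<Rightarrow> real" where
    "\<K> = (\<lambda>l. {u l..v l}) ` {1..p}" "\<And>l. l \<in> {1..p} \<Longrightarrow> u l \<le> v l"
    "\<And>l. l \<in> {1..<p} \<Longrightarrow> v l < u (l + 1)"
proof -
  have "\<exists>(p::nat) u v. \<K> = (\<lambda>l. {u l..v l}) ` {1..p} \<and> (\<forall>l\<in>{1..p}. u l \<le> v l) \<and> (\<forall>l\<in>{1..<p}. v l < u (l + 1))"
    using assms
  proof (induction "card \<K>" arbitrary: \<K>)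
    case 0
    then have "\<K> = {}" by simp
    then show ?case by (intro exI[of _ 0]) auto
  next
    case (Suc n)
    have ne: "Inf ` \<K> \<noteq> {}" and fin: "finite (Inf ` \<K>)" using Suc by auto
    \<comment> \<open>The interval with the largest left endpoint is split off and receives the last
      index; disjointness puts all the others strictly to its left.\<close>
    obtain M where M: "M \<in> \<K>" "Inf M = Max (Inf ` \<K>)" using Max_in[OF fin ne] by (auto simp: image_iff)
    obtain a b where ab: "a \<le> b" "M = {a..b}" using Suc.prems(3) M(1) by blast
    have "n = card (\<K> - {M})" "finite (\<K> - {M})" "disjoint (\<K> - {M})"
      using Suc M by (auto simp: pairwise_def)
    from Suc.hyps(1)[OF this Suc.prems(3)] obtain p u v where IH: "\<K> - {M} = (\<lambda>l. {u l..v l}) ` {1..p::nat}"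
      "\<forall>l\<in>{1..p}. u l \<le> v l" "\<forall>l\<in>{1..<p}. v l < u (l + 1)"
      by auto
    have last: "v l < a" if "l \<in> {1..p}" for l
    proof -
      have l: "{u l..v l} \<in> \<K>" "{u l..v l} \<noteq> M" "u l \<le> v l" using IH that by blast+
      have "Inf {u l..v l} \<le> Inf M" unfolding M(2) using fin l(1) by (intro Max_ge) auto
      then have "u l \<le> a" using ab l by simp
      moreover have "{u l..v l} \<inter> M = {}" using Suc.prems(2) l M(1) by (auto simp: pairwise_def disjnt_def)
      then have "a \<notin> {u l..v l}" using ab by auto
      ultimately show ?thesis by auto
    qed
    define u' v' where "u' = u(Suc p := a)" and "v' = v(Suc p := b)"
    have "(\<lambda>l. {u' l..v' l}) ` {1..Suc p} = insert {a..b} ((\<lambda>l. {u l..v l}) ` {1..p})"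
      by (auto simp: u'_def v'_def image_iff atLeastAtMostSuc_conv)
    then have "\<K> = (\<lambda>l. {u' l..v' l}) ` {1..Suc p}" using IH(1) M ab(2) by auto
    moreover have "\<forall>l\<in>{1..Suc p}. u' l \<le> v' l" using IH(2) ab by (auto simp: u'_def v'_def)
    moreover have "\<forall>l\<in>{1..<Suc p}. v' l < u' (l + 1)"
      using IH(3) last by (auto simp: u'_def v'_def less_Suc_eq)
    ultimately show ?case by blast
  qed
  then show thesis using that by blast
qed

lemma sorted_intervals_less:
  fixes u v :: "nat \<Rightarrow> real"
  assumes "\<And>l. l \<in> {1..p} \<Longrightarrow> u l \<le> v l" "\<And>l. l \<in> {1..<p} \<Longrightarrow> v l < u (l + 1)"
    and "1 \<le> l" "l < m" "m \<le> p"
  shows "v l < u m"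
  using assms(4,5)
proof (induction m)
  case (Suc m)
  show ?case
  proof (cases "l = m")
    case True
    then show ?thesis using assms(2)[of l] assms(3) Suc by auto
  next
    case False
    then have "v l < u m" using Suc by auto
    also have "u m \<le> v m" using assms(1)[of m] assms(3) Suc False by auto
    also have "v m < u (Suc m)" using assms(2)[of m] assms(3) Suc False by auto
    finally show ?thesis .
  qed
qed simp

lemma Compl_sorted_intervals:
  fixes u v :: "nat \<Rightarrow> real"
  assumes p: "1 \<le> p" and le: "\<And>l. l \<in> {1..p} \<Longrightarrow> u l \<le> v l" and less: "\<And>l. l \<in> {1..<p} \<Longrightarrow> v l < u (l + 1)"
  shows "- (\<Union>l\<in>{1..p}. {u l..v l}) = {..<u 1} \<union> (\<Union>l\<in>{1..<p}. {v l<..<u (l + 1)}) \<union> {v p<..}"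
    (is "?A = ?B")
proof (intro equalityI subsetI)
  fix x assume x: "x \<in> ?A"
  show "x \<in> ?B"
  proof (cases "x < u 1")
    case False
    \<comment> \<open>The last interval that starts at or before \<open>x\<close>.\<close>
    define l where "l = Max {l \<in> {1..p}. u l \<le> x}"
    have "l \<in> {l \<in> {1..p}. u l \<le> x}"
      unfolding l_def using False p by (intro Max_in) (auto intro!: exI[of _ 1])
    then have l: "1 \<le> l" "l \<le> p" "u l \<le> x" by auto
    then have "x \<notin> {u l..v l}" using x by auto
    then have vl: "v l < x" using l by simp
    show ?thesis
    proof (cases "l = p")
      case False
      have "x < u (l + 1)"
      proof (rule ccontr)
        assume "\<not> x < u (l + 1)"
        then have "l + 1 \<in> {l \<in> {1..p}. u l \<le> x}" using False l by auto
        then have "l + 1 \<le> Max {l \<in> {1..p}. u l \<le> x}" by (intro Max_ge) auto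
        then show False unfolding l_def[symmetric] by simp
      qed
      then show ?thesis using vl l False by (intro UnI1 UnI2 UN_I[of l]) auto
    qed (use vl in simp)
  qed simp
next
  note lt = sorted_intervals_less[where p = p and u = u and v = v, OF le less]
  fix x assume "x \<in> ?B"
  then consider "x < u 1" | l where "l \<in> {1..<p}" "v l < x" "x < u (l + 1)" | "v p < x" by auto
  then show "x \<in> ?A"
  proof cases
    case 1
    have "x < u m" if "m \<in> {1..p}" for m
      using 1 lt[of 1 m] le[of 1] le[of m] that by (cases "m = 1") fastforce+
    then show ?thesis by (auto simp: not_le)
  next
    case 2
    have *: "v m < x \<or> x < u m" if "m \<in> {1..p}" for m
    proof (cases "m \<le> l")
      case True
      then show ?thesis using 2 lt[of m l] le[of l] that by (cases "m = l") fastforce+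
    next
      case False
      then show ?thesis using 2 lt[of "l + 1" m] le[of "l + 1"] that by (cases "m = l + 1") fastforce+
    qed
    show ?thesis
    proof
      assume "x \<in> (\<Union>l\<in>{1..p}. {u l..v l})"
      then obtain m where "m \<in> {1..p}" "u m \<le> x" "x \<le> v m" by auto
      then show False using *[of m] by simp
    qed
  next
    case 3
    have "v m < x" if "m \<in> {1..p}" for m
      using 3 lt[of m p] le[of p] that by (cases "m = p") fastforce+
    then show ?thesis by (auto simp: not_le)
  qed
qed

lemma sorted_intervals_isolated:
  fixes u v :: "nat \<Rightarrow> real"
  assumes p: "1 \<le> p" and le: "\<And>l. l \<in> {1..p} \<Longrightarrow> u l \<le> v l" and less: "\<And>l. l \<in> {1..<p} \<Longrightarrow> v l < u (l + 1)"
    and C: "C = (\<Union>l\<in>{1..p}. {u l..v l})" and l: "l \<in> {1..p}"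
  obtains e where "e > 0" "{u l - e<..<u l} \<inter> C = {}" "{v l<..<v l + e} \<inter> C = {}"
proof -
  have Compl: "- C = {..<u 1} \<union> (\<Union>l\<in>{1..<p}. {v l<..<u (l + 1)}) \<union> {v p<..}"
    unfolding C by (rule Compl_sorted_intervals[where p = p and u = u and v = v, OF p le less])
  have "\<exists>e>0. {u l - e<..<u l} \<subseteq> - C"
  proof (cases "l = 1")
    case True
    have "{..<u 1} \<subseteq> - C" unfolding Compl by blast
    then show ?thesis using True by (intro exI[of _ 1]) auto
  next
    case False
    define k where "k = l - 1"
    have k: "k \<in> {1..<p}" "k + 1 = l" using False l by (auto simp: k_def)
    then have "{v k<..<u l} \<subseteq> - C" unfolding Compl by blast
    then show ?thesis using less[OF k(1)] k(2) by (intro exI[of _ "u l - v k"]) auto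
  qed
  then obtain e1 where e1: "e1 > 0" "{u l - e1<..<u l} \<subseteq> - C" by blast
  have "\<exists>e>0. {v l<..<v l + e} \<subseteq> - C"
  proof (cases "l = p")
    case True
    have "{v p<..} \<subseteq> - C" unfolding Compl by blast
    then show ?thesis using True by (intro exI[of _ 1]) auto
  next
    case False
    then have l': "l \<in> {1..<p}" using l by auto
    then have "{v l<..<u (l + 1)} \<subseteq> - C" unfolding Compl by blast
    then show ?thesis using less[OF l'] by (intro exI[of _ "u (l + 1) - v l"]) auto
  qed
  then obtain e2 where e2: "e2 > 0" "{v l<..<v l + e2} \<subseteq> - C" by blast
  show thesis by (rule that[of "min e1 e2"]) (use e1 e2 in \<open>auto simp: subset_iff\<close>)
qed

text \<open>The intervals are the components of \<open>- E\<close>: compact because of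
  \<open>bd\<close>, and finite in number because each meets one of the finitely many pieces of
  \<open>S\<close>. At this stage they may be single points.\<close>

lemma Compl_sorted_intervals_exist:
  fixes E S :: "real set"
  assumes E: "open E" and S: "closed S" "S \<noteq> {}" "S \<inter> E = {}" "finite_union_of_disjoint_intervals S"
    and gap: "\<And>a b. a \<in> E \<Longrightarrow> b \<in> E \<Longrightarrow> a < b \<Longrightarrow> {a..b} \<inter> S = {} \<Longrightarrow> {a..b} \<subseteq> E"
    and bd: "{..lo} \<subseteq> E" "{hi..} \<subseteq> E"
  obtains p :: nat and u v :: "nat \<Rightarrow> real" where
    "1 \<le> p" "\<And>l. l \<in> {1..p} \<Longrightarrow> u l \<le> v l" "\<And>l. l \<in> {1..<p} \<Longrightarrow> v l < u (l + 1)"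
    "- E = (\<Union>l\<in>{1..p}. {u l..v l})" "\<And>l. l \<in> {1..p} \<Longrightarrow> {u l..v l} \<inter> S \<noteq> {}"
proof -
  have "- E \<subseteq> {lo..hi}"
  proof
    fix x assume x: "x \<in> - E"
    have "\<not> x \<le> lo" "\<not> hi \<le> x" using x bd by auto
    then show "x \<in> {lo..hi}" by simp
  qed
  then have comp: "compact (- E)" using E by (metis bounded_closed_interval bounded_subset closed_Compl compact_eq_bounded_closed)
  have K: "\<exists>a b. a \<le> b \<and> K = {a..b}" if "K \<in> components (- E)" for K
  proof -
    have "connected K" "compact K" "K \<noteq> {}"
      using that comp by (auto dest: in_components_connected in_components_nonempty compact_components)
    then show ?thesis using connected_compact_interval_1 by (metis atLeastatMost_empty_iff2 not_le)
  qed
  have meets: "K \<inter> S \<noteq> {}" if "K \<in> components (- E)" for K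
    using K[OF that] component_meets[OF E S(1,3) gap] that by blast
  obtain \<I> where \<I>: "finite \<I>" "\<forall>J\<in>\<I>. \<exists>a b. a \<le> b \<and> J = {a..b}" "S = \<Union>\<I>"
    using S(4) by (auto simp: finite_union_of_disjoint_intervals_def)
  have fin: "finite (components (- E))"
  proof (rule finite_components_meeting[OF \<I>(1)])
    show "connected J" if "J \<in> \<I>" for J using \<I>(2) that by auto
    show "\<Union>\<I> \<subseteq> - E" using S(3) \<I>(3) by auto
  qed (use meets \<I>(3) in auto)
  have disj: "disjoint (components (- E))"
    unfolding pairwise_def disjnt_def using components_nonoverlap by blast
  obtain p u v where puv: "components (- E) = (\<lambda>l. {u l..v l}) ` {1..p::nat}"
    "\<And>l. l \<in> {1..p} \<Longrightarrow> u l \<le> v l" "\<And>l. l \<in> {1..<p} \<Longrightarrow> v l < u (l + 1)"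
    using sort_disjoint_intervals[OF fin disj K] by metis
  have U: "- E = (\<Union>l\<in>{1..p}. {u l..v l})" using Union_components[of "- E"] puv(1) by simp
  have "p \<noteq> 0"
  proof
    assume "p = 0"
    then have "- E = {}" using U by simp
    then show False using S(2,3) by auto
  qed
  then show thesis using that[of p u v] puv U meets by auto
qed

section \<open>The fixed-point equation\<close>

text \<open>For \<open>p = sqrt (x * y)\<close> the arithmetic-geometric mean inequality gives
  \<open>(1 - x) * (1 - y) \<le> (1 - p)^2\<close>, and \<open>s \<le> p \<le> 1\<close>.\<close>

lemma one_minus_mult_le:
  fixes x y s :: real
  assumes "0 \<le> x" "x \<le> 1" "0 \<le> y" "y \<le> 1" "s\<^sup>2 \<le> x * y"
  shows "(1 - x) * (1 - y) \<le> (1 - s)\<^sup>2"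
proof -
  define p where "p = sqrt (x * y)"
  have "p\<^sup>2 = x * y" "2 * p \<le> x + y" "s \<le> p" "p \<le> 1"
    using assms arith_geo_mean_sqrt[of x y] by (auto simp: p_def real_le_rsqrt mult_le_one)
  then have "(1 - x) * (1 - y) \<le> (1 - p)\<^sup>2" by (simp add: power2_eq_square algebra_simps)
  also have "\<dots> \<le> (1 - s)\<^sup>2" using \<open>s \<le> p\<close> \<open>p \<le> 1\<close> by (intro power_mono) auto
  finally show ?thesis .
qed

text \<open>The difference of the two sides of the last hypothesis factors as
  \<open>(g1 * l1 - g2 * l2) * (g1 * l2 - g2 * l1)\<close>, and the second factor is
  positive.\<close>

lemma mult_less_of_ratio:
  fixes g1 g2 l1 l2 :: real
  assumes "0 < g2" "g2 < g1" "0 < l1" "l1 < l2"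
    and "(g1 - g2)\<^sup>2 * (l1 * l2) < (l2 - l1)\<^sup>2 * (g1 * g2)"
  shows "g1 * l1 < g2 * l2"
proof -
  have "(g1 - g2)\<^sup>2 * (l1 * l2) - (l2 - l1)\<^sup>2 * (g1 * g2) = (g1 * l1 - g2 * l2) * (g1 * l2 - g2 * l1)"
    by (simp add: power2_eq_square algebra_simps)
  then have "(g1 * l1 - g2 * l2) * (g1 * l2 - g2 * l1) < 0" using assms(5) by linarith
  moreover have "g1 * l2 - g2 * l1 > 0" using assms(1-4) by (simp add: mult_strict_mono)
  ultimately show ?thesis by (simp add: mult_less_0_iff)
qed

text \<open>The two original parameters enter only through \<open>c\<close> and \<open>d\<close>;
  the case \<open>\<gamma> = 1\<close> is \<open>d = 0\<close>.\<close>

locale info_noise_pair =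
  fixes c d :: real and \<tau> \<mu> :: "real measure"
  assumes c: "c > 0" and d: "d \<ge> 0"
    and tau: "prob_on_halfline \<tau>" and mu: "prob_on_halfline \<mu>"
    and fixed_point: "Im z > 0 \<Longrightarrow> stieltjes \<mu> z =
          (\<integral>t. 1 / ((1 - of_real c * stieltjes \<mu> z) * z
                   - of_real t / (1 - of_real c * stieltjes \<mu> z) - of_real d) \<partial>\<tau>)"
begin

abbreviation "G \<equiv> gfac c \<tau>"
abbreviation "L \<equiv> lfac c d \<tau>"
abbreviation "F \<equiv> pmap c d \<tau>"
abbreviation "b \<equiv> gfac (- c) \<mu>"
abbreviation "q \<equiv> lfac (- c) (- d) \<mu>"
abbreviation "w \<equiv> pmap (- c) (- d) \<mu>"

lemma dist_tau: "real_distribution \<tau>" and dist_mu: "real_distribution \<mu>"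
  using tau mu by (simp_all add: prob_on_halfline_def)

lemma Im_b_pos: "Im z > 0 \<Longrightarrow> Im (b z) > 0"
  using Im_stieltjes_neg[OF dist_mu, of z] c by (simp add: gfac_def mult_pos_neg)

text \<open>With \<open>- c\<close> in place of \<open>c\<close> the factor in
  \<open>Im_lfac\<close> is \<open>1 + c * tsqres \<mu> z\<close>, which is at least
  \<open>1\<close>.\<close>

lemma Im_q_ge: "Im z > 0 \<Longrightarrow> Im (q z) \<ge> Im z"
  using Im_lfac[OF dist_mu, of z "- c" "- d"] tsqres_nonneg[OF mu, of z] c
  by (simp add: mult_le_cancel_left1)

text \<open>The denominator in the fixed-point equation is \<open>(w z - t) / b z\<close>; this is
  where the formula for \<open>\<omega>\<close> comes from.\<close>

lemma stieltjes_mu_eq: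
  assumes "Im z > 0" shows "stieltjes \<mu> z = b z * stieltjes \<tau> (w z)"
proof -
  have b0: "b z \<noteq> 0" using Im_b_pos[OF assms] by auto
  have "stieltjes \<mu> z = (\<integral>t. b z * (1 / (w z - of_real t)) \<partial>\<tau>)"
  proof (subst fixed_point[OF assms], rule Bochner_Integration.integral_cong[OF refl])
    fix t :: real
    have e: "1 - of_real c * stieltjes \<mu> z = b z" by (simp add: gfac_def)
    have "w z - of_real t = b z * (b z * z - of_real t / b z - of_real d)"
      using b0 by (simp add: pmap_def lfac_def algebra_simps)
    then show "1 / ((1 - of_real c * stieltjes \<mu> z) * z - of_real t / (1 - of_real c * stieltjes \<mu> z) - of_real d)
        = b z * (1 / (w z - of_real t))"
      unfolding e using b0 by simp
  qed
  then show ?thesis unfolding integral_mult_right_zero stieltjes_def .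
qed

lemma b_mult_G:
  assumes "Im z > 0" shows "b z * G (w z) = 1"
proof -
  have "b z * G (w z) = b z + of_real c * (b z * stieltjes \<tau> (w z))"
    by (simp add: gfac_def[of c] algebra_simps)
  also have "\<dots> = 1" unfolding stieltjes_mu_eq[OF assms, symmetric] by (simp add: gfac_def)
  finally show ?thesis .
qed

text \<open>\<open>m / b = m / (1 - c m)\<close> has the same sign of the imaginary part as \<open>m\<close>, because
  its inverse is \<open>1 / m - c\<close>.\<close>

lemma Im_w_pos:
  assumes "Im z > 0" shows "Im (w z) > 0"
proof (rule ccontr)
  assume "\<not> Im (w z) > 0"
  then have "Im (stieltjes \<tau> (w z)) \<ge> 0" by (intro Im_stieltjes_nonneg) simp
  then have "Im (G (w z)) \<ge> 0" using c by (simp add: gfac_def)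
  moreover have "G (w z) = 1 / b z" using b_mult_G[OF assms] by (auto simp: divide_simps mult_ac)
  then have "Im (G (w z)) = - Im (b z) / (cmod (b z))\<^sup>2" by (simp add: Im_divide cmod_def)
  moreover have "(cmod (b z))\<^sup>2 > 0" using Im_b_pos[OF assms] by auto
  ultimately show False using Im_b_pos[OF assms] by (simp add: divide_simps)
qed

text \<open>From \<open>w z = b z * q z\<close> and \<open>b z * G (w z) = 1\<close> one gets
  \<open>w z * G (w z) = q z\<close>, and the shifts by \<open>d\<close> in \<open>q\<close> and
  \<open>L\<close> cancel. The type is general because the relation is used in the upper half-plane
  and on the real line.\<close>

lemma L_eqI: "b z * G (w z) = 1 \<Longrightarrow> L (w z) = z * b z"
  and F_eqI: "b z * G (w z) = 1 \<Longrightarrow> F (w z) = z"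
  for z :: "'a::{real_normed_field, banach, second_countable_topology}"
proof -
  assume 1: "b z * G (w z) = 1"
  have "L (w z) = (b z * G (w z)) * q z + of_real d" by (simp add: lfac_def[of c] pmap_def[of "-c"] mult_ac)
  then show L: "L (w z) = z * b z" unfolding 1 by (simp add: lfac_def)
  have "F (w z) = z * (b z * G (w z))" unfolding pmap_def[of c] L by (simp add: mult_ac)
  then show "F (w z) = z" unfolding 1 by simp
qed

text \<open>\<open>L (w z)\<close> and \<open>q z\<close> differ by the real number
  \<open>d\<close>, so \<open>Im (L (w z)) > 0\<close>, while \<open>Im_lfac\<close> expresses this
  imaginary part as \<open>Im (w z)\<close> times
  \<open>1 - c * tsqres \<tau> (w z)\<close>.\<close>

lemma tsqres_w_less_1:
  assumes "Im z > 0" shows "c * tsqres \<tau> (w z) < 1"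
proof -
  have "Im (L (w z)) > 0"
    using L_eqI[OF b_mult_G[OF assms]] Im_q_ge[OF assms] assms by (simp add: lfac_def)
  then have "Im (w z) * (1 - c * tsqres \<tau> (w z)) > 0"
    using Im_lfac[OF dist_tau, of "w z" c d] Im_w_pos[OF assms] by simp
  then show ?thesis using Im_w_pos[OF assms] by (simp add: zero_less_mult_iff)
qed

text \<open>\<open>Im z \<le> Im (q z) = Im (L (w z))\<close>, and the factor
  \<open>1 - c * tsqres\<close> by which \<open>L\<close> changes the imaginary part of
  \<open>w z\<close> is at most \<open>1\<close>.\<close>

lemma Im_w_ge:
  assumes "Im z > 0" shows "Im (w z) \<ge> Im z"
proof -
  have "Im z \<le> Im (L (w z))"
    using L_eqI[OF b_mult_G[OF assms]] Im_q_ge[OF assms] by (simp add: lfac_def)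
  also have "\<dots> = Im (w z) * (1 - c * tsqres \<tau> (w z))"
    using Im_lfac[OF dist_tau, of "w z" c d] Im_w_pos[OF assms] by simp
  also have "\<dots> \<le> Im (w z) * 1"
    using Im_w_pos[OF assms] tsqres_nonneg[OF tau, of "w z"] c by (intro mult_left_mono) auto
  finally show ?thesis by simp
qed

section \<open>The map \<open>w\<close> on the real line\<close>

definition w' :: "real \<Rightarrow> real" where
  "w' x = c * sqres \<mu> x * q x + b x * (1 + c * tsqres \<mu> x)"

lemma w_deriv:
  assumes "x \<notin> measure_support \<mu>"
  shows "(w has_field_derivative w' x) (at x)"
    and "(w has_field_derivative of_real (w' x)) (at (complex_of_real x))"
proof -
  have far: "far \<mu> x" using far_real[OF dist_mu assms] .
  show "(w has_field_derivative w' x) (at x)"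
    using pmap_deriv[OF dist_mu far, of "- c" "- d"] by (simp add: w'_def res2_real tres2_real)
  show "(w has_field_derivative of_real (w' x)) (at (complex_of_real x))"
    using pmap_deriv[OF dist_mu far_of_real[OF far], of "- c" "- d"]
    by (simp add: w'_def res2_of_real tres2_of_real res2_real tres2_real gfac_of_real lfac_of_real)
qed

lemma w'_ge_1:
  assumes "x \<notin> measure_support \<mu>" shows "w' x \<ge> 1"
proof (rule derivative_ge_of_Im_ge[OF w_deriv(2)[OF assms]])
  show "Im (w (complex_of_real x)) = 0" by (simp add: pmap_of_real)
  show "1 * e \<le> Im (w (Complex x e))" if "e > 0" for e
    using Im_w_ge[of "Complex x e"] that by simp
qed

text \<open>If \<open>b x \<le> 0\<close> then \<open>m x > 0\<close>, so \<open>x > 0\<close> and \<open>q x \<le> 0\<close>, and both terms of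
  \<open>\<omega>' = b' q + b q'\<close> are nonpositive.\<close>

lemma b_pos:
  assumes "x \<notin> measure_support \<mu>" shows "b x > 0"
proof (rule ccontr)
  assume "\<not> b x > 0"
  then have b: "b x \<le> 0" by simp
  then have "stieltjes \<mu> x > 0" using c by (simp add: gfac_def) (metis mult_nonneg_nonpos not_one_le_zero not_less order_trans less_imp_le)
  then have "x > 0" using stieltjes_nonpos[OF mu, of x] by linarith
  then have "x * b x \<le> 0" using b by (simp add: mult_nonneg_nonpos)
  then have "q x \<le> 0" using d by (simp add: lfac_def)
  then have "c * sqres \<mu> x * q x \<le> 0"
    using c sqres_nonneg[of \<mu> x] by (simp add: mult_nonneg_nonpos)
  moreover have "b x * (1 + c * tsqres \<mu> x) \<le> 0"
    using b c tsqres_nonneg[OF mu, of x] by (intro mult_nonpos_nonneg) auto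
  ultimately show False using w'_ge_1[OF assms] by (simp add: w'_def)
qed

lemma w_notin_support:
  assumes "x \<notin> measure_support \<mu>" shows "w x \<notin> measure_support \<tau>"
proof -
  obtain s where s: "s > 0" "\<And>z::complex. z \<in> ball (of_real x) s \<Longrightarrow> far \<mu> z"
    using far_near_real[OF dist_mu assms] by auto
  let ?B = "ball (complex_of_real x) s"
  note hol = holomorphic_far[OF dist_mu, of ?B, simplified, OF s(2), simplified]
  \<comment> \<open>Off the zeros of \<open>b\<close> the relation \<open>m = b g_\<tau>(w)\<close>
    can be solved for \<open>g_\<tau>\<close>; the point \<open>x\<close> qualifies since
    \<open>b x > 0\<close>.\<close>
  define S where "S = ?B \<inter> b -` (- {0})"
  have S: "open S" "of_real x \<in> S" "S \<subseteq> ?B"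
  proof -
    show "open S" unfolding S_def
      by (rule continuous_open_preimage[OF holomorphic_on_imp_continuous_on[OF hol(2)]]) auto
    show "of_real x \<in> S" using s(1) b_pos[OF assms] by (simp add: S_def gfac_of_real)
  qed (auto simp: S_def)
  obtain r h where r: "r > 0" "ball (complex_of_real x) r \<subseteq> S" "open (w ` ball (complex_of_real x) r)"
    "continuous_on (w ` ball (complex_of_real x) r) h"
    and h: "\<And>z. z \<in> ball (of_real x) r \<Longrightarrow> h (w z) = z"
    and pos: "\<And>z. z \<in> ball (of_real x) r \<Longrightarrow> Im (w z) > 0 \<longleftrightarrow> Im z > 0"
    and zero: "\<And>z. z \<in> ball (of_real x) r \<Longrightarrow> Im (w z) = 0 \<longleftrightarrow> Im z = 0"
  proof (rule real_local_inverse[OF _ S(1,2) _ w_deriv(2)[OF assms]])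
    show "w holomorphic_on S" using hol(4) S(3) by (rule holomorphic_on_subset)
  qed (use w'_ge_1[OF assms] in \<open>auto simp: pmap_of_real\<close>)
  let ?V = "w ` ball (complex_of_real x) r"
  have hV: "h ` ?V \<subseteq> S" using r(2) h by auto
  show ?thesis
  proof (rule not_in_support_of_continuation[OF dist_tau r(3)])
    show "of_real (w x) \<in> ?V" using r(1) by (intro image_eqI[of _ _ "of_real x"]) (auto simp: pmap_of_real)
    show "continuous_on ?V (\<lambda>v. stieltjes \<mu> (h v) / b (h v))"
    proof (rule continuous_on_divide)
      show "continuous_on ?V (\<lambda>v. stieltjes \<mu> (h v))"
        using hV S(3) by (intro continuous_on_compose2[OF holomorphic_on_imp_continuous_on[OF hol(1)] r(4)]) auto
      show "continuous_on ?V (\<lambda>v. b (h v))"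
        using hV S(3) by (intro continuous_on_compose2[OF holomorphic_on_imp_continuous_on[OF hol(2)] r(4)]) auto
      show "\<forall>v\<in>?V. b (h v) \<noteq> 0" using hV by (auto simp: S_def)
    qed
    fix v assume "v \<in> ?V"
    then obtain z where z: "z \<in> ball (complex_of_real x) r" "v = w z" by auto
    { assume "Im v > 0"
      then have "Im z > 0" using pos[OF z(1)] z(2) by simp
      then show "stieltjes \<tau> v = stieltjes \<mu> (h v) / b (h v)"
        using stieltjes_mu_eq[of z] Im_b_pos[of z] h[OF z(1)] z(2) by auto }
  next
    fix y assume "of_real y \<in> ?V"
    then obtain z where z: "z \<in> ball (complex_of_real x) r" "of_real y = w z" by auto
    then have "Im z = 0" using zero[OF z(1)] by (metis Im_complex_of_real)
    then obtain a where a: "z = of_real a" by (metis complex_is_Real_iff Reals_cases)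
    have "h (of_real y) = of_real a" using h[OF z(1)] z(2) a by simp
    then have "stieltjes \<mu> (h (of_real y)) / b (h (of_real y)) = of_real (stieltjes \<mu> a / b a)"
      by (simp add: stieltjes_complex_of_real gfac_of_real)
    then show "Im (stieltjes \<mu> (h (of_real y)) / b (h (of_real y))) = 0" by (metis Im_complex_of_real)
  qed
qed

text \<open>The boundary limit of \<open>b_mult_G\<close> from above; \<open>G\<close> is continuous
  at \<open>w x\<close> because this point is already known to be off the support.\<close>

lemma b_mult_G_real:
  assumes "x \<notin> measure_support \<mu>" shows "b x * G (w x) = 1"
proof -
  have far: "far \<mu> (complex_of_real x)" "far \<tau> (complex_of_real (w x))"
    using far_of_real far_real dist_mu dist_tau assms w_notin_support[OF assms] by auto
  have 1: "((\<lambda>e. b (Complex x e)) \<longlongrightarrow> b (complex_of_real x)) (at_right 0)"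
    and 2: "((\<lambda>e. w (Complex x e)) \<longlongrightarrow> w (complex_of_real x)) (at_right 0)"
    using isCont_tendsto_compose[OF isCont_far(1)[OF dist_mu far(1)] tendsto_upper]
      isCont_tendsto_compose[OF isCont_far(2)[OF dist_mu far(1)] tendsto_upper] .
  have "((\<lambda>e. G (w (Complex x e))) \<longlongrightarrow> G (complex_of_real (w x))) (at_right 0)"
    using isCont_tendsto_compose[OF isCont_far(1)[OF dist_tau far(2)] 2[unfolded pmap_of_real]] .
  then have "((\<lambda>e. b (Complex x e) * G (w (Complex x e))) \<longlongrightarrow> b (complex_of_real x) * G (complex_of_real (w x))) (at_right 0)"
    by (intro tendsto_mult 1)
  moreover have "((\<lambda>e. b (Complex x e) * G (w (Complex x e))) \<longlongrightarrow> 1) (at_right 0)"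
  proof (rule tendsto_eventually)
    show "\<forall>\<^sub>F e in at_right 0. b (Complex x e) * G (w (Complex x e)) = 1"
      using eventually_at_right_less[of "0::real"]
      by eventually_elim (simp add: b_mult_G)
  qed
  ultimately have "b (complex_of_real x) * G (complex_of_real (w x)) = 1"
    by (rule tendsto_unique[OF trivial_limit_at_right_real])
  then have "complex_of_real (b x * G (w x)) = of_real 1" by (simp add: gfac_of_real)
  then show ?thesis by (simp only: of_real_eq_iff)
qed

lemma F_w: "x \<notin> measure_support \<mu> \<Longrightarrow> F (w x) = x"
  by (rule F_eqI[OF b_mult_G_real])

section \<open>The set \<open>E\<close>, and monotonicity and injectivity of
  \<open>F\<close>\<close>

definition F' :: "real \<Rightarrow> real" where
  "F' u = - (c * sqres \<tau> u) * L u + G u * (1 - c * tsqres \<tau> u)"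

lemma F_deriv:
  assumes "u \<notin> measure_support \<tau>"
  shows "(F has_field_derivative F' u) (at u)"
    and "(F has_field_derivative of_real (F' u)) (at (complex_of_real u))"
proof -
  have far: "far \<tau> u" using far_real[OF dist_tau assms] .
  show "(F has_field_derivative F' u) (at u)"
    using pmap_deriv[OF dist_tau far, of c d] by (simp add: F'_def res2_real tres2_real)
  show "(F has_field_derivative of_real (F' u)) (at (complex_of_real u))"
    using pmap_deriv[OF dist_tau far_of_real[OF far], of c d]
    by (simp add: F'_def res2_of_real tres2_of_real res2_real tres2_real gfac_of_real lfac_of_real)
qed

definition E :: "real set" where
  "E = {u. u \<notin> measure_support \<tau> \<and> F' u > 0 \<and> G u > 0}"

text \<open>Differentiating \<open>F (w y) = y\<close> gives \<open>F' (w x) * w' x = 1\<close> with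
  \<open>w' x \<ge> 1\<close>, and \<open>G (w x)\<close> is the reciprocal of
  \<open>b x > 0\<close>.\<close>

lemma w_in_E:
  assumes "x \<notin> measure_support \<mu>" shows "w x \<in> E"
proof -
  have G: "G (w x) > 0" using b_mult_G_real[OF assms] b_pos[OF assms] by (intro zero_less_mult_pos[of "b x" "G (w x)"]) simp_all
  have "((\<lambda>y. F (w y)) has_field_derivative F' (w x) * w' x) (at x)"
    using DERIV_chain2[OF F_deriv(1)[OF w_notin_support[OF assms]] w_deriv(1)[OF assms]] .
  moreover have "((\<lambda>y. F (w y)) has_field_derivative 1) (at x)"
  proof (rule has_field_derivative_transform_within_open[of "\<lambda>y. y"])
    show "open (- measure_support \<mu>)" using closed_measure_support by (simp add: closed_def)
  qed (use assms F_w in auto)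
  ultimately have "F' (w x) * w' x = 1" by (rule DERIV_unique)
  then have "F' (w x) > 0" using w'_ge_1[OF assms] by (intro zero_less_mult_pos2[of "F' (w x)" "w' x"]) simp_all
  then show ?thesis using G w_notin_support[OF assms] by (simp add: E_def)
qed

text \<open>For \<open>u \<le> 0 \<le> t\<close> one has
  \<open>t / (u - t)^2 \<le> 1 / (t - u)\<close>; integrated,
  \<open>c * tsqres \<tau> u \<le> - c * stieltjes \<tau> u = 1 - G u\<close>.\<close>

lemma tsqres_less_1_nonpos:
  assumes u: "u \<notin> measure_support \<tau>" "u \<le> 0" "G u > 0" shows "c * tsqres \<tau> u < 1"
proof -
  have far: "far \<tau> u" using u far_real dist_tau by simp
  have "tsqres \<tau> u \<le> (\<integral>t. - (1 / (u - t)) \<partial>\<tau>)"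
    unfolding tsqres_def
  proof (rule integral_mono_AE)
    show "AE t in \<tau>. t / (norm (u - of_real t))\<^sup>2 \<le> - (1 / (u - t))"
      using prob_on_halfline_AE[OF tau]
    proof eventually_elim
      case (elim t)
      then have "t * (t - u) \<le> (t - u)\<^sup>2" using u by (simp add: power2_eq_square mult_right_mono)
      then have "t / (t - u)\<^sup>2 \<le> 1 / (t - u)" using elim u by (simp add: divide_simps power2_eq_square)
      moreover have "- (1 / (u - t)) = 1 / (t - u)" by (metis minus_diff_eq minus_divide_right)
      ultimately show ?case by (simp add: power2_commute)
    qed
    show "integrable \<tau> (\<lambda>t. - (1 / (u - t)))" using integrable_far[OF dist_tau far] by simp
  qed (rule integrable_tsqres[OF tau far])
  also have "\<dots> = - stieltjes \<tau> u" by (simp add: stieltjes_def)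
  finally have "c * tsqres \<tau> u \<le> c * (- stieltjes \<tau> u)" using c by (intro mult_left_mono) auto
  also have "\<dots> < 1" using u by (simp add: gfac_def)
  finally show ?thesis .
qed

text \<open>If \<open>L u \<ge> 0\<close>, the first term of \<open>F' u\<close> is nonpositive and
  the second must be positive. If \<open>L u < 0\<close>, then \<open>u < 0\<close> because
  \<open>d \<ge> 0\<close>.\<close>

lemma tsqres_E_less_1:
  assumes "u \<in> E" shows "c * tsqres \<tau> u < 1"
proof (cases "L u \<ge> 0")
  case True
  have "0 \<le> c * sqres \<tau> u * L u" using True c sqres_nonneg[of \<tau> u] by simp
  then have "0 < G u * (1 - c * tsqres \<tau> u)" using assms by (simp add: E_def F'_def)
  then show ?thesis using assms by (simp add: E_def zero_less_mult_iff)
next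
  case False
  then have "u * G u < 0" using d by (simp add: lfac_def)
  then have "u < 0" using assms by (simp add: E_def mult_less_0_iff)
  then show ?thesis using assms by (intro tsqres_less_1_nonpos) (auto simp: E_def)
qed

text \<open>The divided difference of \<open>L\<close> is \<open>1 - c * tres2\<close>;
  Cauchy-Schwarz bounds \<open>(c * tres2)^2\<close> by the product of two numbers below
  \<open>1\<close>.\<close>

lemma L_strict_mono_E:
  assumes "u \<in> E" "v \<in> E" "u < v" shows "L u < L v"
proof -
  have far: "far \<tau> u" "far \<tau> v" using assms far_real dist_tau by (auto simp: E_def)
  have "(c * tres2 \<tau> v u)\<^sup>2 \<le> (c * tsqres \<tau> v) * (c * tsqres \<tau> u)"
    using norm_tres2_le[OF tau far(2,1)] c by (simp add: power_mult_distrib power2_eq_square mult_ac mult_left_mono)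
  also have "\<dots> < 1 * 1"
    using tsqres_E_less_1[OF assms(1)] tsqres_E_less_1[OF assms(2)] c tsqres_nonneg[OF tau, of u] tsqres_nonneg[OF tau, of v]
    by (intro mult_strict_mono) auto
  finally have "c * tres2 \<tau> v u < 1" by (simp add: abs_square_less_1)
  then have "(v - u) * (1 - c * tres2 \<tau> v u) > 0" using assms(3) by simp
  then show ?thesis using lfac_diff[OF dist_tau far(2,1), of c d] by simp
qed

text \<open>In the main case put \<open>P = c * sqres \<tau>\<close>, \<open>T = c * tsqres \<tau>\<close>. Since \<open>P L < G (1 - T)\<close> on
  \<open>E\<close>, Cauchy-Schwarz and \<open>(1 - a\<^sup>2)(1 - b\<^sup>2) \<le> (1 - a b)\<^sup>2\<close> give
  \<open>(G u - G v)\<^sup>2 / (G u G v) < (L v - L u)\<^sup>2 / (L u L v)\<close>, which forces \<open>G u / G v < L v / L u\<close>.\<close>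

lemma F_strict_mono_E:
  assumes "u \<in> E" "v \<in> E" "u < v" shows "F u < F v"
proof -
  have far: "far \<tau> u" "far \<tau> v" using assms far_real dist_tau by (auto simp: E_def)
  have G: "G u > 0" "G v > 0" using assms by (auto simp: E_def)
  have L: "L u < L v" using L_strict_mono_E[OF assms] .
  \<comment> \<open>\<open>L\<close> increases and \<open>G\<close> is positive, so the delicate
    case is the last one, where \<open>L\<close> is positive and \<open>G\<close> decreases against
    the growth of \<open>L\<close>.\<close>
  consider "L u \<le> 0" "0 < L v" | "L v \<le> 0" | "0 < L u" "G u \<le> G v" | "0 < L u" "G v < G u"
    by linarith
  then show ?thesis
  proof cases
    case 1
    then have "F u \<le> 0" "0 < F v" using G by (simp_all add: pmap_def mult_nonneg_nonpos)
    then show ?thesis by simp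
  next
    case 2
    then have "v * G v \<le> 0" using d by (simp add: lfac_def)
    then have v: "v \<le> 0" using G by (simp add: mult_le_0_iff)
    \<comment> \<open>For \<open>u < v \<le> 0 \<le> t\<close> both resolvents are nonpositive, so
      \<open>G\<close> does not increase; as a factor of the negative number \<open>L u\<close> this
      helps.\<close>
    have "res2 \<tau> u v \<ge> 0"
      unfolding res2_def
      using prob_on_halfline_AE[OF tau] v assms(3)
      by (intro integral_nonneg_AE) (auto elim!: eventually_mono intro!: mult_nonpos_nonpos)
    then have "G u \<ge> G v"
      using gfac_diff[OF dist_tau far, of c] c assms(3)
      by (smt (verit) mult_nonneg_nonneg of_real_eq_id id_apply)
    then have "G u * (- L u) \<ge> G v * (- L u)" using 2 L by (intro mult_right_mono) auto
    moreover have "G v * (- L u) > G v * (- L v)" using L G by simp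
    ultimately show ?thesis by (simp add: pmap_def)
  next
    case 3
    then have "G u * L u \<le> G v * L u" by (intro mult_right_mono) auto
    also have "\<dots> < G v * L v" using L G by simp
    finally show ?thesis by (simp add: pmap_def)
  next
    case 4
    define P T R S where "P x = c * sqres \<tau> x" and "T x = c * tsqres \<tau> x"
      and "R = c * res2 \<tau> u v" and "S = c * tres2 \<tau> u v" for x :: real
    have RS: "G u - G v = (v - u) * R" "L v - L u = (v - u) * (1 - S)"
      using gfac_diff[OF dist_tau far, of c] lfac_diff[OF dist_tau far, of c d]
      by (simp_all add: R_def S_def algebra_simps)
    have R2: "R\<^sup>2 \<le> P u * P v" and S2: "S\<^sup>2 \<le> T u * T v"
      using norm_res2_le[OF dist_tau far] norm_tres2_le[OF tau far] c
      by (simp_all add: R_def S_def P_def T_def power_mult_distrib power2_eq_square mult_ac mult_left_mono)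
    have T: "T u < 1" "T v < 1" "T u \<ge> 0" "T v \<ge> 0"
      using tsqres_E_less_1 assms tsqres_nonneg[OF tau, of u] tsqres_nonneg[OF tau, of v] c by (auto simp: T_def)
    have P: "P u \<ge> 0" "P v \<ge> 0" using c sqres_nonneg[of \<tau> u] sqres_nonneg[of \<tau> v] by (auto simp: P_def)
    have F': "P u * L u < G u * (1 - T u)" "P v * L v < G v * (1 - T v)"
      using assms by (auto simp: E_def F'_def P_def T_def)
    have "R\<^sup>2 * (L u * L v) \<le> (P u * L u) * (P v * L v)"
      using mult_right_mono[OF R2, of "L u * L v"] 4 L by (simp add: mult_ac)
    also have "\<dots> < (G u * (1 - T u)) * (G v * (1 - T v))"
      using P 4 L by (intro mult_strict_mono'[OF F']) auto
    also have "\<dots> = ((1 - T u) * (1 - T v)) * (G u * G v)" by (simp add: mult_ac)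
    also have "\<dots> \<le> (1 - S)\<^sup>2 * (G u * G v)"
      using T S2 G by (intro mult_right_mono one_minus_mult_le) auto
    finally have "R\<^sup>2 * (L u * L v) < (1 - S)\<^sup>2 * (G u * G v)" .
    then have "(v - u)\<^sup>2 * (R\<^sup>2 * (L u * L v)) < (v - u)\<^sup>2 * ((1 - S)\<^sup>2 * (G u * G v))"
      using assms(3) by (intro mult_strict_left_mono) auto
    then have "(G u - G v)\<^sup>2 * (L u * L v) < (L v - L u)\<^sup>2 * (G u * G v)"
      unfolding RS by (simp add: power_mult_distrib mult_ac)
    then show ?thesis
      unfolding pmap_def by (rule mult_less_of_ratio[rotated 4]) (use 4 L G in auto)
  qed
qed

text \<open>With \<open>\<zeta> = csqrt z\<close> and \<open>\<beta> = \<zeta> / G u\<close> one has \<open>G u = \<zeta> / \<beta>\<close>, \<open>L u = \<zeta> \<beta>\<close> and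
  \<open>u = \<beta>\<^sup>2 - d \<beta> / \<zeta>\<close>. The third relation gives \<open>Re \<beta> > 0\<close>, and adding the imaginary parts of
  \<open>\<zeta> \<beta>\<close> and \<open>\<zeta> (cnj \<beta>)\<close> gives the bound.\<close>

lemma sqres_bound:
  fixes u :: complex
  assumes u: "Im u > 0" and z: "Im (F u) > 0" and T: "c * tsqres \<tau> u < 1"
  shows "c * sqres \<tau> u * cmod (L u) < cmod (G u) * (1 - c * tsqres \<tau> u)"
proof -
  define P where "P = c * sqres \<tau> u"
  define T where "T = c * tsqres \<tau> u"
  define \<zeta> where "\<zeta> = csqrt (F u)"
  define \<beta> where "\<beta> = \<zeta> / G u"
  have P: "P \<ge> 0" using c sqres_nonneg[of \<tau> u] by (simp add: P_def)
  have F0: "F u \<noteq> 0" using z by auto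
  have z2: "\<zeta>\<^sup>2 = F u" by (simp add: \<zeta>_def)
  have nz: "\<zeta> \<noteq> 0" "G u \<noteq> 0" using F0 by (auto simp: \<zeta>_def pmap_def)
  have bnz: "\<beta> \<noteq> 0" using nz by (simp add: \<beta>_def)
  have G: "G u = \<zeta> / \<beta>" using nz by (simp add: \<beta>_def)
  have L: "L u = \<zeta> * \<beta>" using z2 nz by (simp add: \<beta>_def pmap_def power2_eq_square)
  have "Re \<zeta> \<ge> 0" unfolding \<zeta>_def by (rule csqrt_principal[THEN disjE]) (auto intro: less_imp_le)
  moreover have "2 * Re \<zeta> * Im \<zeta> > 0" using z z2 by (metis Im_power2)
  ultimately have \<zeta>: "Re \<zeta> > 0" "Im \<zeta> > 0" by (auto simp: zero_less_mult_iff)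
  have nb: "(cmod \<beta>)\<^sup>2 > 0" "(cmod \<zeta>)\<^sup>2 > 0" using bnz nz by auto
  have "Im (G u) = - Im u * P" using Im_gfac[OF dist_tau, of u c] u by (simp add: P_def)
  then have 1: "Im (\<zeta> * cnj \<beta>) = - Im u * P * (cmod \<beta>)\<^sup>2"
    unfolding G using nb by (simp add: complex_div_cnj[of \<zeta> \<beta>] Im_divide_of_real field_simps del: times_complex.sel)
  have "Im (L u) = Im u * (1 - T)" using Im_lfac[OF dist_tau, of u c d] u by (simp add: T_def)
  then have 2: "Im (\<zeta> * \<beta>) = Im u * (1 - T)" unfolding L .
  have sum: "2 * Re \<beta> * Im \<zeta> = Im u * (1 - T - P * (cmod \<beta>)\<^sup>2)"
    using 1 2 by (simp add: algebra_simps)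
  have 3: "Im (\<zeta> * cnj \<beta>) \<le> 0" unfolding 1 using u P by simp
  have "Im (\<zeta> * \<beta>) > 0" unfolding 2 using u T by (simp add: T_def)
  then have "2 * (Re \<zeta> * Im \<beta>) > 0" using 3 by (simp add: algebra_simps)
  then have \<beta>: "Im \<beta> > 0" using \<zeta> by (simp add: zero_less_mult_iff)
  have "u * G u = \<zeta> * \<beta> - of_real d" using L by (simp add: lfac_def algebra_simps)
  then have "u * \<zeta> = (\<zeta> * \<beta> - of_real d) * \<beta>" unfolding G using bnz by (simp add: field_simps)
  \<comment> \<open>Multiplying by \<open>cnj \<zeta>\<close> clears the division by
    \<open>\<zeta>\<close> in the third relation; the term with \<open>d\<close> then has an
    imaginary part of known sign, and \<open>Im u \<le> Im (\<beta>^2)\<close> follows.\<close>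
  then have "u * (\<zeta> * cnj \<zeta>) = (\<zeta> * \<beta> - of_real d) * \<beta> * cnj \<zeta>" by simp
  also have "\<dots> = \<beta>\<^sup>2 * (\<zeta> * cnj \<zeta>) - of_real d * cnj (\<zeta> * cnj \<beta>)"
    by (simp add: algebra_simps power2_eq_square)
  finally have "u * of_real ((cmod \<zeta>)\<^sup>2) = \<beta>\<^sup>2 * of_real ((cmod \<zeta>)\<^sup>2) - of_real d * cnj (\<zeta> * cnj \<beta>)"
    by (simp only: complex_norm_square)
  moreover have im: "Im (a * of_real k) = Im a * k" "Im (of_real k * a) = k * Im a" for a k by simp_all
  ultimately have "Im u * (cmod \<zeta>)\<^sup>2 = Im (\<beta>\<^sup>2 * of_real ((cmod \<zeta>)\<^sup>2) - of_real d * cnj (\<zeta> * cnj \<beta>))"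
    by (metis im(1))
  also have "\<dots> = Im (\<beta>\<^sup>2) * (cmod \<zeta>)\<^sup>2 + d * Im (\<zeta> * cnj \<beta>)"
    by (simp only: im minus_complex.sel cnj.simps(2) mult_minus_right diff_minus_eq_add)
  finally have "Im u * (cmod \<zeta>)\<^sup>2 \<le> Im (\<beta>\<^sup>2) * (cmod \<zeta>)\<^sup>2"
    using 3 d by (smt (verit) mult_nonneg_nonpos)
  then have "Im u \<le> Im (\<beta>\<^sup>2)" using nb by simp
  then have "Im u \<le> 2 * Re \<beta> * Im \<beta>" by (simp only: Im_power2)
  then have "2 * Re \<beta> * Im \<beta> > 0" using u by linarith
  then have "Re \<beta> > 0" using \<beta> by (simp add: zero_less_mult_iff)
  then have "2 * Re \<beta> * Im \<zeta> > 0" using \<zeta> by simp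
  then have "1 - T - P * (cmod \<beta>)\<^sup>2 > 0" unfolding sum using u by (simp add: zero_less_mult_iff)
  then have "P * (cmod \<beta>)\<^sup>2 * cmod (G u) < (1 - T) * cmod (G u)" using nz by simp
  moreover have "cmod (L u) = (cmod \<beta>)\<^sup>2 * cmod (G u)"
    unfolding L G using bnz by (simp add: norm_mult norm_divide power2_eq_square)
  ultimately show ?thesis by (simp add: P_def T_def mult_ac)
qed

text \<open>The complex counterpart of the main case of \<open>F_strict_mono_E\<close>. For distinct
  \<open>u\<close>, \<open>v\<close> with equal images, the divided differences give
  \<open>G u * (1 - S) = R * L v\<close> and \<open>G v * (1 - S) = R * L u\<close>. Multiplying the
  absolute values and inserting \<open>sqres_bound\<close> at both points makes
  \<open>(cmod (1 - S))^2 * (cmod (G u) * cmod (G v))\<close> smaller than itself.\<close>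

lemma F_inj_upper:
  fixes u v :: complex
  assumes "Im u > 0" "Im v > 0" "F u = F v" "Im (F u) > 0"
    and "c * tsqres \<tau> u < 1" "c * tsqres \<tau> v < 1"
  shows "u = v"
proof (rule ccontr)
  assume "u \<noteq> v"
  have far: "far \<tau> u" "far \<tau> v" using assms by (auto intro: far_Im)
  define P T R S where "P x = c * sqres \<tau> x" and "T x = c * tsqres \<tau> x"
      and "R = of_real c * res2 \<tau> u v" and "S = of_real c * tres2 \<tau> u v" for x :: complex
  have RS: "G u - G v = - (u - v) * R" "L u - L v = (u - v) * (1 - S)"
    using gfac_diff[OF dist_tau far, of c] lfac_diff[OF dist_tau far, of c d]
    by (simp_all add: R_def S_def)
  have R2: "(cmod R)\<^sup>2 \<le> P u * P v" and S2: "(cmod S)\<^sup>2 \<le> T u * T v"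
    using norm_res2_le[OF dist_tau far] norm_tres2_le[OF tau far] c
    by (simp_all add: R_def S_def P_def T_def norm_mult power_mult_distrib power2_eq_square mult_ac mult_left_mono)
  have T: "T u < 1" "T v < 1" "T u \<ge> 0" "T v \<ge> 0"
    using assms tsqres_nonneg[OF tau, of u] tsqres_nonneg[OF tau, of v] c by (auto simp: T_def)
  have P: "P u \<ge> 0" "P v \<ge> 0" using c sqres_nonneg[of \<tau> u] sqres_nonneg[of \<tau> v] by (auto simp: P_def)
  have bound: "P u * cmod (L u) < cmod (G u) * (1 - T u)" "P v * cmod (L v) < cmod (G v) * (1 - T v)"
    using sqres_bound[of u] sqres_bound[of v] assms by (simp_all add: P_def T_def)
  have eq: "G u * L u = G v * L v" using assms(3) by (simp add: pmap_def)
  have "(u - v) * (G u * (1 - S)) = G u * (L u - L v)" unfolding RS by (simp add: mult_ac)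
  also have "\<dots> = - (G u - G v) * L v" using eq by (simp add: algebra_simps)
  also have "\<dots> = (u - v) * (R * L v)" unfolding RS by (simp add: algebra_simps)
  finally have 1: "G u * (1 - S) = R * L v" using \<open>u \<noteq> v\<close> by simp
  have "(u - v) * (G v * (1 - S)) = G v * (L u - L v)" unfolding RS by (simp add: mult_ac)
  also have "\<dots> = - (G u - G v) * L u" using eq by (simp add: algebra_simps)
  also have "\<dots> = (u - v) * (R * L u)" unfolding RS by (simp add: algebra_simps)
  finally have 2: "G v * (1 - S) = R * L u" using \<open>u \<noteq> v\<close> by simp
  have "cmod (G u) * cmod (1 - S) * (cmod (G v) * cmod (1 - S)) = cmod R * cmod (L v) * (cmod R * cmod (L u))"
    by (simp only: norm_mult[symmetric] 1 2)
  then have "(cmod (1 - S))\<^sup>2 * (cmod (G u) * cmod (G v)) = (cmod R)\<^sup>2 * (cmod (L u) * cmod (L v))"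
    by (simp add: power2_eq_square mult_ac)
  also have "\<dots> \<le> (P u * cmod (L u)) * (P v * cmod (L v))"
    using mult_right_mono[OF R2, of "cmod (L u) * cmod (L v)"] by (simp add: mult_ac)
  also have "\<dots> < (cmod (G u) * (1 - T u)) * (cmod (G v) * (1 - T v))"
    using P by (intro mult_strict_mono'[OF bound]) auto
  also have "\<dots> = ((1 - T u) * (1 - T v)) * (cmod (G u) * cmod (G v))" by (simp add: mult_ac)
  also have "\<dots> \<le> (1 - cmod S)\<^sup>2 * (cmod (G u) * cmod (G v))"
    using T S2 by (intro mult_right_mono one_minus_mult_le) auto
  also have "\<dots> \<le> (cmod (1 - S))\<^sup>2 * (cmod (G u) * cmod (G v))"
  proof (rule mult_right_mono)
    have "\<bar>1 - cmod S\<bar> \<le> cmod (1 - S)" using norm_triangle_ineq3[of 1 S] by simp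
    then show "(1 - cmod S)\<^sup>2 \<le> (cmod (1 - S))\<^sup>2" by (simp add: abs_le_square_iff[symmetric])
  qed simp
  finally show False by simp
qed

text \<open>With \<open>h\<close> the local inverse of \<open>F\<close>, the continuation of
  \<open>m\<close> is \<open>(1 - 1 / G (h v)) / c\<close>, obtained from
  \<open>b = 1 - c m = 1 / G\<close>. Its agreement with \<open>m\<close> above the real line
  amounts to \<open>h v = w v\<close>, which is an instance of \<open>F_inj_upper\<close>.\<close>

lemma F_notin_support:
  assumes "u \<in> E" shows "F u \<notin> measure_support \<mu>"
proof -
  have u: "u \<notin> measure_support \<tau>" "F' u > 0" "G u > 0" using assms by (auto simp: E_def)
  obtain s where s: "s > 0" "\<And>z::complex. z \<in> ball (of_real u) s \<Longrightarrow> far \<tau> z"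
    using far_near_real[OF dist_tau u(1)] by auto
  let ?B = "ball (complex_of_real u) s"
  note hol = holomorphic_far[OF dist_tau, of ?B, simplified, OF s(2), simplified]
  have L': "(L has_field_derivative of_real (1 - c * tsqres \<tau> u)) (at (complex_of_real u))"
    using lfac_deriv[OF dist_tau far_of_real[OF far_real[OF dist_tau u(1)]], of c d]
    by (simp add: tres2_of_real tres2_real)
  \<comment> \<open>What matters here is the sign statement for \<open>L\<close>: near
    \<open>u\<close> the upper half-plane is mapped into itself, which means
    \<open>c * tsqres \<tau> z < 1\<close>, the side condition of \<open>F_inj_upper\<close>. The
    derivative of \<open>L\<close> at \<open>u\<close> is positive by
    \<open>tsqres_E_less_1\<close>.\<close>
  obtain r1 h1 where r1: "r1 > 0" "ball (complex_of_real u) r1 \<subseteq> ?B"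
    "open (L ` ball (complex_of_real u) r1)" "continuous_on (L ` ball (complex_of_real u) r1) h1"
    "\<And>z. z \<in> ball (complex_of_real u) r1 \<Longrightarrow> h1 (L z) = z"
    and Lpos: "\<And>z. z \<in> ball (complex_of_real u) r1 \<Longrightarrow> Im (L z) > 0 \<longleftrightarrow> Im z > 0"
    "\<And>z. z \<in> ball (complex_of_real u) r1 \<Longrightarrow> Im (L z) = 0 \<longleftrightarrow> Im z = 0"
    by (rule real_local_inverse[OF hol(3) _ _ _ L'])
      (use s(1) tsqres_E_less_1[OF assms] in \<open>auto simp: lfac_of_real\<close>)
  define S where "S = ball (complex_of_real u) r1 \<inter> G -` (- {0})"
  have S: "open S" "of_real u \<in> S" "S \<subseteq> ?B" "S \<subseteq> ball (complex_of_real u) r1"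
  proof -
    show "open S" unfolding S_def
      by (rule continuous_open_preimage[OF continuous_on_subset[OF holomorphic_on_imp_continuous_on[OF hol(2)] r1(2)]]) auto
    show "of_real u \<in> S" using r1(1) u by (simp add: S_def gfac_of_real)
  qed (use r1 in \<open>auto simp: S_def\<close>)
  obtain r h where r: "r > 0" "ball (complex_of_real u) r \<subseteq> S" "open (F ` ball (complex_of_real u) r)"
    "continuous_on (F ` ball (complex_of_real u) r) h"
    and h: "\<And>z. z \<in> ball (of_real u) r \<Longrightarrow> h (F z) = z"
    and pos: "\<And>z. z \<in> ball (of_real u) r \<Longrightarrow> Im (F z) > 0 \<longleftrightarrow> Im z > 0"
    and zero: "\<And>z. z \<in> ball (of_real u) r \<Longrightarrow> Im (F z) = 0 \<longleftrightarrow> Im z = 0"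
  proof (rule real_local_inverse[OF _ S(1,2) _ F_deriv(2)[OF u(1)]])
    show "F holomorphic_on S" using hol(4) S(3) by (rule holomorphic_on_subset)
  qed (use u in \<open>auto simp: pmap_of_real\<close>)
  let ?V = "F ` ball (complex_of_real u) r"
  have hV: "h ` ?V \<subseteq> S" using r(2) h by auto
  show ?thesis
  proof (rule not_in_support_of_continuation[OF dist_mu r(3)])
    show "of_real (F u) \<in> ?V" using r(1) by (intro image_eqI[of _ _ "of_real u"]) (auto simp: pmap_of_real)
    show "continuous_on ?V (\<lambda>v. (1 - 1 / G (h v)) / of_real c)"
    proof (intro continuous_intros)
      show "continuous_on ?V (\<lambda>v. G (h v))"
        using hV S(3) by (intro continuous_on_compose2[OF holomorphic_on_imp_continuous_on[OF hol(2)] r(4)]) auto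
    qed (use hV c in \<open>auto simp: S_def\<close>)
    fix v assume "v \<in> ?V"
    then obtain z where z: "z \<in> ball (of_real u) r" "v = F z" by auto
    { assume v: "Im v > 0"
      then have Im: "Im z > 0" using pos[OF z(1)] z(2) by simp
      have "z \<in> ball (complex_of_real u) r1" using z(1) r(2) S(4) by blast
      then have "Im (L z) > 0" using Lpos(1) Im by simp
      then have "c * tsqres \<tau> z < 1"
        using Im_lfac[OF dist_tau, of z c d] Im by (simp add: zero_less_mult_iff)
      moreover have "F (w v) = v" using F_eqI[OF b_mult_G[OF v]] .
      ultimately have "z = w v"
        using F_inj_upper[OF Im Im_w_pos[OF v]] tsqres_w_less_1[OF v] v z(2) by simp
      then have "b v = 1 / G (h v)" using b_mult_G[OF v] h[OF z(1)] z(2)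
        by (metis nonzero_mult_div_cancel_right mult_zero_right zero_neq_one)
      then show "stieltjes \<mu> v = (1 - 1 / G (h v)) / of_real c" using c by (simp add: gfac_def field_simps) }
  next
    fix y assume "of_real y \<in> ?V"
    then obtain z where z: "z \<in> ball (complex_of_real u) r" "of_real y = F z" by auto
    then have "Im z = 0" using zero[OF z(1)] by (metis Im_complex_of_real)
    then obtain a where a: "z = of_real a" by (metis complex_is_Real_iff Reals_cases)
    have "h (of_real y) = of_real a" using h[OF z(1)] z(2) a by simp
    then have "(1 - 1 / G (h (of_real y))) / of_real c = of_real ((1 - 1 / G a) / c)"
      by (simp add: gfac_of_real)
    then show "Im ((1 - 1 / G (h (of_real y))) / of_real c) = 0" by (metis Im_complex_of_real)
  qed
qed

lemma F_inj_E: "u \<in> E \<Longrightarrow> v \<in> E \<Longrightarrow> F u = F v \<Longrightarrow> u = v"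
  using F_strict_mono_E[of u v] F_strict_mono_E[of v u] by (cases u v rule: linorder_cases) auto

lemma w_F: "u \<in> E \<Longrightarrow> w (F u) = u"
  using F_notin_support[of u] w_in_E[of "F u"] F_w[of "F u"] by (auto intro: F_inj_E)

lemma w_strict_mono:
  assumes "x \<notin> measure_support \<mu>" "y \<notin> measure_support \<mu>" "x < y"
  shows "w x < w y"
proof (rule ccontr)
  assume "\<not> w x < w y"
  then have "F (w y) \<le> F (w x)"
    using F_strict_mono_E[of "w y" "w x"] w_in_E assms by (cases "w x = w y") auto
  then show False using F_w assms by simp
qed

section \<open>Comparison of masses\<close>

text \<open>A primitive of \<open>(g / G) F' - g\<close>, where \<open>g / G\<close> is
  \<open>m\<close> in terms of \<open>u\<close>. Inserting \<open>F = u G^2 + d G\<close> and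
  \<open>G = 1 + c g\<close> leaves \<open>c (u g^2)' + (d / c) (1 - 1 / G) G'\<close>. The
  principal logarithm is harmless, as \<open>Im (G u) < 0\<close> in the upper half-plane.\<close>

definition excess :: "complex \<Rightarrow> complex" where
  "excess u = of_real c * u * (stieltjes \<tau> u)\<^sup>2 + of_real (d / c) * (G u - Ln (G u))"

lemma Im_G_neg: "Im u > 0 \<Longrightarrow> Im (G u) < 0"
  using Im_stieltjes_neg[OF dist_tau, of u] c by (simp add: gfac_def mult_pos_neg)

text \<open>In terms of \<open>u = \<omega>(z)\<close>, the differential \<open>m dz\<close> is \<open>g_\<tau> du\<close> plus an exact differential.\<close>

lemma log_pot_eq:
  obtains K where "\<And>z. Im z > 0 \<Longrightarrow> log_pot \<mu> z - (log_pot \<tau> (w z) + excess (w z)) = K"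
proof -
  let ?U = "{z. Im z > 0}"
  let ?H = "\<lambda>z. log_pot \<mu> z - (log_pot \<tau> (w z) + excess (w z))"
  have der: "(?H has_field_derivative 0) (at z)" if z: "Im z > 0" for z
  proof -
    define u where "u = w z"
    define r where "r = res2 \<tau> u u"
    define g where "g = stieltjes \<tau> u"
    define W where "W = - (of_real (- c) * res2 \<mu> z z) * q z + b z * (1 - of_real (- c) * tres2 \<mu> z z)"
    have u: "Im u > 0" using Im_w_pos[OF z] by (simp add: u_def)
    have far: "far \<mu> z" "far \<tau> u" using z u by (auto intro: far_Im)
    have W: "(w has_field_derivative W) (at z)"
      using pmap_deriv[OF dist_mu far(1), of "-c" "-d"] by (simp add: W_def)
    have g': "(stieltjes \<tau> has_field_derivative - r) (at u)"
      using stieltjes_deriv[OF dist_tau far(2)] by (simp add: r_def)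
    have G': "(G has_field_derivative - (of_real c * r)) (at u)"
      using gfac_deriv[OF dist_tau far(2), of c] by (simp add: r_def)
    have Gn: "G u \<noteq> 0" "G u \<notin> \<real>\<^sub>\<le>\<^sub>0" using Im_G_neg[OF u] by (auto simp: complex_nonpos_Reals_iff)
    have Gg: "G u = 1 + of_real c * g" by (simp add: gfac_def g_def)
    have F': "(F has_field_derivative - (of_real c * r) * (u * G u + of_real d) + G u * (G u - u * (of_real c * r))) (at u)"
      unfolding pmap_def[abs_def] lfac_def using G' by (auto intro!: derivative_eq_intros simp: algebra_simps)
    have "((\<lambda>z. F (w z)) has_field_derivative
        (- (of_real c * r) * (u * G u + of_real d) + G u * (G u - u * (of_real c * r))) * W) (at z)"
      using DERIV_chain2[OF F'[unfolded u_def] W] by (simp add: u_def)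
    \<comment> \<open>Comparing the two derivatives of \<open>F (w z) = z\<close> yields the
      relation that eliminates \<open>W\<close> at the end.\<close>
    moreover have "((\<lambda>z. F (w z)) has_field_derivative 1) (at z)"
    proof (rule has_field_derivative_transform_within_open[of "\<lambda>y. y" _ _ ?U])
      show "y = F (w y)" if "y \<in> ?U" for y using F_eqI[OF b_mult_G] that by simp
    qed (use z in \<open>auto simp: open_halfspace_Im_gt\<close>)
    ultimately have 1: "(- (of_real c * r) * (u * G u + of_real d) + G u * (G u - u * (of_real c * r))) * W = 1"
      by (rule DERIV_unique)
    define X where "X = of_real c * (g\<^sup>2 - 2 * u * g * r) + of_real (d / c) * (- (of_real c * r) + of_real c * r / G u)"
    have ex: "(excess has_field_derivative X) (at u)"
      unfolding excess_def X_def using g' G' Gn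
      by (auto intro!: derivative_eq_intros simp: g_def algebra_simps power2_eq_square divide_simps)
    have "(log_pot \<tau> has_field_derivative g) (at u)" using log_pot_deriv[OF dist_tau u] by (simp add: g_def)
    from DERIV_chain2[OF this[unfolded u_def] W] DERIV_chain2[OF ex[unfolded u_def] W]
    have "(?H has_field_derivative stieltjes \<mu> z - (g * W + X * W)) (at z)"
      by (intro DERIV_diff DERIV_add log_pot_deriv[OF dist_mu z])
    moreover have "stieltjes \<mu> z - (g * W + X * W) = 0"
    proof -
      have "b z = 1 / G u" using b_mult_G[OF z] Gn by (simp add: u_def field_simps)
      then have m: "stieltjes \<mu> z = g / G u" using stieltjes_mu_eq[OF z] by (simp add: u_def g_def)
      have "g + X = g / G u * (- (of_real c * r) * (u * G u + of_real d) + G u * (G u - u * (of_real c * r)))"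
      proof -
        have "c \<noteq> 0" using c by simp
        then have "(g + X) * G u = g * (- (of_real c * r) * (u * G u + of_real d) + G u * (G u - u * (of_real c * r)))"
          using Gn(1) unfolding X_def Gg by (simp add: field_simps power2_eq_square)
        then show ?thesis using Gn(1) by (simp add: field_simps)
      qed
      then have "(g + X) * W = g / G u" using 1 by (simp add: mult.assoc)
      then show ?thesis using m by (simp add: algebra_simps)
    qed
    ultimately show ?thesis by simp
  qed
  have "\<exists>K. \<forall>z\<in>?U. ?H z = K"
    by (rule has_field_derivative_zero_constant)
      (use der in \<open>auto simp: convex_halfspace_Im_gt has_field_derivative_at_within\<close>)
  then show thesis using that by auto
qed

text \<open>At real points with \<open>G > 0\<close> the function \<open>excess\<close> is real, so
  in the limit only the argument potentials remain and the two masses differ by a constant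
  \<open>k / pi\<close> that does not depend on \<open>x\<close>. At \<open>x = - 1\<close> both
  tails carry full mass, hence \<open>k = 0\<close>.\<close>

lemma mass_right:
  assumes "x \<notin> measure_support \<mu>"
  shows "measure \<mu> {x<..} = measure \<tau> {w x<..}"
proof -
  interpret mu: real_distribution \<mu> by (rule dist_mu)
  interpret tau: real_distribution \<tau> by (rule dist_tau)
  obtain K where K: "\<And>z. Im z > 0 \<Longrightarrow> log_pot \<mu> z - (log_pot \<tau> (w z) + excess (w z)) = K"
    using log_pot_eq by blast
  define k where "k = Im K + arg_pot \<mu> \<i> - arg_pot \<tau> \<i>"
  have lim: "pi * measure \<mu> {x<..} - pi * measure \<tau> {w x<..} = k" if x: "x \<notin> measure_support \<mu>" for x
  proof -
    define X where "X n = Complex x (inverse (real (Suc n)))" for n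
    have X: "X \<longlonglongrightarrow> complex_of_real x" "\<And>n. Im (X n) > 0"
      unfolding X_def complex_of_real_def by (intro tendsto_Complex tendsto_const LIMSEQ_inverse_real_of_nat) simp
    have far: "far \<mu> (complex_of_real x)" "far \<tau> (complex_of_real (w x))"
      using far_of_real far_real dist_mu dist_tau x w_notin_support[OF x] by auto
    have wX: "(\<lambda>n. w (X n)) \<longlonglongrightarrow> complex_of_real (w x)"
      using isCont_tendsto_compose[OF isCont_far(2)[OF dist_mu far(1)] X(1), of "-c" "-d"] by (simp add: pmap_of_real)
    have wXp: "\<And>n. Im (w (X n)) > 0" using Im_w_pos X(2) by blast
    have Gpos: "G (w x) > 0" using w_in_E[OF x] by (simp add: E_def)
    have "isCont (stieltjes \<tau>) (complex_of_real (w x))"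
      using stieltjes_deriv[OF dist_tau far(2)] by (rule DERIV_isCont)
    then have g: "(\<lambda>n. stieltjes \<tau> (w (X n))) \<longlonglongrightarrow> of_real (stieltjes \<tau> (w x))"
      using isCont_tendsto_compose[OF _ wX] by (simp flip: stieltjes_complex_of_real)
    have GX: "(\<lambda>n. G (w (X n))) \<longlonglongrightarrow> of_real (G (w x))"
      using isCont_tendsto_compose[OF isCont_far(1)[OF dist_tau far(2)] wX] by (simp add: gfac_of_real)
    have LnG: "(\<lambda>n. Ln (G (w (X n)))) \<longlonglongrightarrow> of_real (ln (G (w x)))"
      using tendsto_Ln[OF GX] Gpos by (simp add: complex_nonpos_Reals_iff Ln_of_real)
    have "(\<lambda>n. excess (w (X n))) \<longlonglongrightarrow>
        of_real c * of_real (w x) * (of_real (stieltjes \<tau> (w x)))\<^sup>2 + of_real (d / c) * (of_real (G (w x)) - of_real (ln (G (w x))))"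
      unfolding excess_def by (intro tendsto_intros wX g GX LnG)
    from tendsto_Im[OF this] have "(\<lambda>n. Im (excess (w (X n)))) \<longlonglongrightarrow> 0"
      by (simp flip: of_real_mult of_real_power of_real_diff of_real_add)
    then have "(\<lambda>n. arg_pot \<mu> (X n) - arg_pot \<tau> (w (X n)) - Im (excess (w (X n))))
        \<longlonglongrightarrow> pi * measure \<mu> {x<..} - pi * measure \<tau> {w x<..} - 0"
      by (intro tendsto_diff tendsto_arg_pot dist_mu dist_tau X wX wXp x w_notin_support)
    moreover have "arg_pot \<mu> (X n) - arg_pot \<tau> (w (X n)) - Im (excess (w (X n))) = k" for n
      using arg_cong[OF K[OF X(2)[of n]], of Im] Im_log_pot[OF dist_mu X(2)[of n]] Im_log_pot[OF dist_tau wXp[of n]]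
      by (simp add: k_def)
    ultimately show ?thesis by (simp add: LIMSEQ_const_iff)
  qed
  have full: "measure M {y<..} = 1" if "prob_on_halfline M" "y < 0" for M y
  proof -
    interpret real_distribution M using that by (simp add: prob_on_halfline_def)
    have "measure M {0..} \<le> measure M {y<..}" using that by (intro finite_measure_mono) auto
    then have "1 \<le> measure M {y<..}" using that by (simp add: prob_on_halfline_def)
    then show ?thesis using prob_le_1[of "{y<..}"] by (rule order.antisym[rotated])
  qed
  \<comment> \<open>Positivity of \<open>b\<close> makes \<open>q\<close> and then \<open>w\<close>
    negative at \<open>- 1\<close>, so the tail of \<open>\<tau>\<close> to the right of
    \<open>w (- 1)\<close> is full as well.\<close>
  have x1: "-1 \<notin> measure_support \<mu>" using prob_on_halfline_support[OF mu] by auto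
  have "q (- 1 :: real) < 0" using b_pos[OF x1] d by (simp add: lfac_def)
  then have "w (- 1 :: real) < 0" using b_pos[OF x1] by (simp add: pmap_def mult_pos_neg)
  then have "k = 0" using lim[OF x1] full[OF mu, of "-1"] full[OF tau, of "w (-1)"] by simp
  then show ?thesis using lim[OF assms] by simp
qed

section \<open>Structure of the supports\<close>

lemma stieltjes_tau_ge:
  assumes "x < (0::real)" shows "1 / x \<le> stieltjes \<tau> x"
proof -
  interpret real_distribution \<tau> by (rule dist_tau)
  have "x \<notin> measure_support \<tau>" using prob_on_halfline_support[OF tau] assms by auto
  then have far: "far \<tau> x" using far_real[OF dist_tau] by simp
  have "1 / x = (\<integral>t. 1 / x \<partial>\<tau>)" by (simp add: prob_space[unfolded space_eq_univ])
  also have "\<dots> \<le> (\<integral>t. 1 / (x - of_real t) \<partial>\<tau>)"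
  proof (rule integral_mono_AE)
    show "AE t in \<tau>. 1 / x \<le> 1 / (x - of_real t)"
      using prob_on_halfline_AE[OF tau] by eventually_elim (use assms in \<open>simp add: divide_simps\<close>)
  qed (use integrable_far[OF dist_tau far] in simp_all)
  finally show ?thesis by (simp add: stieltjes_def)
qed

text \<open>\<open>0\<close> is the image under \<open>F\<close> of a negative zero \<open>x\<close>
  of \<open>L\<close>, that is of \<open>x * G x = - d\<close>. There \<open>G x > 0\<close> is
  automatic and \<open>F' x\<close> reduces to \<open>G x * (1 - c * tsqres \<tau> x) > 0\<close>,
  so \<open>x\<close> lies in \<open>E\<close>.\<close>

lemma zero_notin_support_mu:
  assumes "d > 0" shows "0 \<notin> measure_support \<mu>"
proof -
  have G1: "G x \<le> 1" if "x < 0" for x :: real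
    using stieltjes_nonpos[OF tau, of x] that c by (simp add: gfac_def mult_nonneg_nonpos)
  have supp: "x \<notin> measure_support \<tau>" if "x < 0" for x using prob_on_halfline_support[OF tau] that by auto
  have lo: "x * G x \<le> x + c" if "x < 0" for x :: real
  proof -
    have "x * stieltjes \<tau> x \<le> x * (1 / x)" using stieltjes_tau_ge[OF that] that by (intro mult_left_mono_neg) auto
    then have "c * (x * stieltjes \<tau> x) \<le> c * 1" using c that by (intro mult_left_mono) auto
    then show ?thesis by (simp add: gfac_def algebra_simps)
  qed
  have hi: "- d / 2 \<le> (- d / 2) * G (- d / 2)"
    using G1[of "- d / 2"] assms by (simp add: mult_left_le)
  \<comment> \<open>At the left end \<open>lo\<close> gives the value at most
    \<open>- d - 1\<close>; at the right end \<open>G \<le> 1\<close> gives at least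
    \<open>- d / 2\<close>. Both ends are negative, hence off the support of
    \<open>\<tau>\<close>.\<close>
  have "\<exists>x\<ge>- d - c - 1. x \<le> - d / 2 \<and> x * G x = - d"
  proof (rule IVT')
    show "continuous_on {- d - c - 1..- d / 2} (\<lambda>x. x * G x)"
    proof (intro continuous_intros continuous_at_imp_continuous_on ballI)
      fix x assume "x \<in> {- d - c - 1..- d / 2}"
      then have "x < 0" using assms by auto
      then show "isCont G x" by (intro isCont_far(1)[OF dist_tau] far_real[OF dist_tau] supp)
    qed
  qed (use lo[of "- d - c - 1"] hi assms c in auto)
  then obtain x where x: "x \<le> - d / 2" "x * G x = - d" by blast
  have x0: "x < 0" using x assms by linarith
  have "x * G x < 0" using x assms by simp
  then have G: "G x > 0" using x0 by (simp add: mult_less_0_iff)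
  have L: "L x = 0" using x by (simp add: lfac_def)
  have "F' x > 0" using G tsqres_less_1_nonpos[OF supp[OF x0]] x0 L by (simp add: F'_def)
  then have "x \<in> E" using G supp[OF x0] by (simp add: E_def)
  then have "F x \<notin> measure_support \<mu>" by (rule F_notin_support)
  then show ?thesis using L by (simp add: pmap_def)
qed

text \<open>For \<open>d = 0\<close> both \<open>w\<close> and \<open>F\<close> fix
  \<open>0\<close>, so the claim concerns membership of \<open>0\<close> in \<open>E\<close>, where
  \<open>L 0 = 0\<close> makes \<open>F' 0 > 0\<close> a consequence of
  \<open>G 0 > 0\<close>.\<close>

lemma zero_notin_support_mu_iff:
  assumes "d = 0"
  shows "0 \<notin> measure_support \<mu> \<longleftrightarrow> 0 \<notin> measure_support \<tau> \<and> G (0::real) > 0"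
proof
  assume "0 \<notin> measure_support \<mu>"
  from w_in_E[OF this] have "w 0 \<in> E" .
  moreover have "w 0 = (0::real)" using assms by (simp add: pmap_def lfac_def)
  ultimately show "0 \<notin> measure_support \<tau> \<and> G (0::real) > 0" unfolding E_def by auto
next
  assume 0: "0 \<notin> measure_support \<tau> \<and> G (0::real) > 0"
  have L: "L 0 = (0::real)" using assms by (simp add: lfac_def)
  have "F' 0 = G 0 * (1 - c * tsqres \<tau> (0::real))" by (simp add: F'_def L)
  then have "F' 0 > 0" using tsqres_less_1_nonpos[of 0] 0 by simp
  then have "F 0 \<notin> measure_support \<mu>" using 0 by (intro F_notin_support) (simp add: E_def)
  then show "0 \<notin> measure_support \<mu>" by (simp add: pmap_def L)
qed

text \<open>All mass of \<open>\<tau>\<close> lies to the right of \<open>w a \<le> 0\<close>; by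
  \<open>mass_right\<close> all mass of \<open>\<mu>\<close> lies to the right of
  \<open>a\<close>.\<close>

lemma left_of_support_mu:
  assumes a: "a \<notin> measure_support \<mu>" "w a \<le> 0"
  shows "left_of_support a \<mu>"
proof -
  interpret mu: real_distribution \<mu> by (rule dist_mu)
  interpret tau: real_distribution \<tau> by (rule dist_tau)
  have "AE t in \<tau>. t \<in> measure_support \<tau>" by (rule AE_measure_support) simp
  then have "AE t in \<tau>. t \<in> {w a<..}"
  proof eventually_elim
    case (elim t)
    then have "0 \<le> t" "t \<noteq> w a" using prob_on_halfline_support[OF tau] w_notin_support[OF a(1)] by auto
    then show ?case using a(2) by simp
  qed
  then have "measure \<tau> {w a<..} = 1" by (subst (asm) tau.prob_Collect_eq_1[symmetric]) (auto simp: greaterThan_def)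
  then have 1: "measure \<mu> {a<..} = 1" using mass_right[OF a(1)] by simp
  have "AE t in \<mu>. t \<in> {a<..}" using 1 by (subst mu.prob_Collect_eq_1[symmetric]) (auto simp: greaterThan_def)
  then have "AE t in \<mu>. t \<notin> {..<a}" by eventually_elim auto
  then have null: "emeasure \<mu> {..<a} = 0" by (subst (asm) AE_iff_measurable[of "{..<a}"]) auto
  have gt: "a < x" if "x \<in> measure_support \<mu>" for x
  proof -
    have "\<not> x < a" using not_in_measure_supportI[of "{..<a}" x \<mu>] null that by auto
    then show ?thesis using that a(1) by (metis linorder_neqE)
  qed
  have bdd: "bdd_below (measure_support \<mu>)" using gt by (intro bdd_belowI[of _ a]) (auto intro: less_imp_le)
  have "Inf (measure_support \<mu>) \<in> measure_support \<mu>"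
    by (rule closed_contains_Inf[OF measure_support_ne[OF dist_mu] bdd closed_measure_support])
  then show ?thesis unfolding left_of_support_def
    using gt bdd by (intro bexI[of _ "Inf (measure_support \<mu>)"]) (auto intro: cInf_lower)
qed

lemma w_image_interval:
  assumes "{x..y} \<inter> measure_support \<mu> = {}" "x \<le> y"
  shows "{w x..w y} \<subseteq> E"
proof
  fix u assume u: "u \<in> {w x..w y}"
  have "\<exists>z\<ge>x. z \<le> y \<and> w z = u"
  proof (rule IVT')
    show "continuous_on {x..y} w"
    proof (intro continuous_at_imp_continuous_on ballI)
      fix z assume "z \<in> {x..y}"
      then have "z \<notin> measure_support \<mu>" using assms(1) by auto
      then show "isCont w z" using w_deriv(1) DERIV_isCont by blast
    qed
  qed (use u assms in auto)
  then obtain z where "z \<in> {x..y}" "w z = u" by auto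
  moreover from this have "z \<notin> measure_support \<mu>" using assms(1) by blast
  ultimately show "u \<in> E" using w_in_E[of z] by simp
qed

text \<open>Openness is carried over from the complement of the support of \<open>\<mu>\<close>:
  \<open>w\<close> maps a small interval around \<open>F u\<close> to an interval of
  \<open>E\<close> around \<open>u\<close>.\<close>

lemma open_E: "open E"
proof (subst open_subopen, intro ballI)
  fix u assume u: "u \<in> E"
  have "F u \<in> - measure_support \<mu>" using F_notin_support[OF u] by simp
  then obtain e where e: "e > 0" "cball (F u) e \<subseteq> - measure_support \<mu>"
    using closed_measure_support open_contains_cball by (metis open_Compl)
  then have sub: "{F u - e..F u + e} \<inter> measure_support \<mu> = {}" by (auto simp: cball_eq_atLeastAtMost)
  let ?T = "{w (F u - e)<..<w (F u + e)}"
  have "F u - e \<notin> measure_support \<mu>" "F u \<notin> measure_support \<mu>" "F u + e \<notin> measure_support \<mu>"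
    using sub e by (auto simp: disjoint_iff)
  then have "w (F u - e) < w (F u)" "w (F u) < w (F u + e)"
    using e by (auto intro: w_strict_mono)
  then have "u \<in> ?T" using w_F[OF u] by simp
  moreover have "?T \<subseteq> E" using w_image_interval[OF sub] e by auto
  ultimately show "\<exists>T. open T \<and> u \<in> T \<and> T \<subseteq> E" by (intro exI[of _ ?T]) auto
qed

lemma mass_right_F: "u \<in> E \<Longrightarrow> measure \<mu> {F u<..} = measure \<tau> {u<..}"
  using mass_right[OF F_notin_support] w_F by simp

text \<open>Without mass of \<open>\<tau>\<close> between \<open>u\<close> and \<open>v\<close>
  there is none of \<open>\<mu>\<close> between \<open>F u\<close> and \<open>F v\<close>; the image
  under \<open>w\<close> of that interval covers \<open>{u..v}\<close>.\<close>

lemma E_gap: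
  assumes "u \<in> E" "v \<in> E" "u < v" "{u..v} \<inter> measure_support \<tau> = {}"
  shows "{u..v} \<subseteq> E"
proof -
  interpret mu: real_distribution \<mu> by (rule dist_mu)
  interpret tau: real_distribution \<tau> by (rule dist_tau)
  have Fuv: "F u < F v" using F_strict_mono_E assms by simp
  have "measure \<tau> {u<..v} = 0"
    using emeasure_support_disjoint[of \<tau> "{u<..v}"] assms(4) by (simp add: measure_def disjoint_iff)
  moreover have "measure \<tau> {u<..} = measure \<tau> {u<..v} + measure \<tau> {v<..}"
    using assms(3) by (subst tau.finite_measure_Union[symmetric]) (auto intro!: arg_cong[of _ _ "measure \<tau>"])
  moreover have "measure \<mu> {F u<..} = measure \<mu> {F u<..F v} + measure \<mu> {F v<..}"
    using Fuv by (subst mu.finite_measure_Union[symmetric]) (auto intro!: arg_cong[of _ _ "measure \<mu>"])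
  ultimately have "measure \<mu> {F u<..F v} = 0" using mass_right_F assms by simp
  moreover have "measure \<mu> {F u<..<F v} \<le> measure \<mu> {F u<..F v}" by (intro mu.finite_measure_mono) auto
  ultimately have "measure \<mu> {F u<..<F v} = 0" using measure_nonneg[of \<mu> "{F u<..<F v}"] by linarith
  then have "emeasure \<mu> {F u<..<F v} = 0" by (simp add: mu.emeasure_eq_measure)
  then have "{F u<..<F v} \<inter> measure_support \<mu> = {}"
    using not_in_measure_supportI[of "{F u<..<F v}" _ \<mu>] by auto
  then have "{F u..F v} \<inter> measure_support \<mu> = {}"
    using F_notin_support assms by (force simp: less_le disjoint_iff)
  from w_image_interval[OF this] show ?thesis using Fuv w_F assms by simp
qed

text \<open>For \<open>x < 0\<close> one has \<open>b x \<ge> 1\<close> and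
  \<open>q x \<le> x\<close>, hence \<open>w x \<le> x\<close>; the image of the negative half-line
  under \<open>w\<close> reaches arbitrarily far to the left.\<close>

lemma E_unbounded_below: "\<exists>lo. {..lo} \<subseteq> E"
proof -
  have supp: "x \<notin> measure_support \<mu>" if "x < 0" for x using prob_on_halfline_support[OF mu] that by auto
  have le: "w x \<le> x" if "x < 0" for x :: real
  proof -
    have b: "b x \<ge> 1" using stieltjes_nonpos[OF mu, of x] that c by (simp add: gfac_def mult_nonneg_nonpos)
    then have "x * b x \<le> x * 1" using that by (intro mult_left_mono_neg) auto
    then have q: "q x \<le> x" using d by (simp add: lfac_def)
    then have "b x * q x \<le> 1 * q x" using b that by (intro mult_right_mono_neg) auto
    then show ?thesis using q by (simp add: pmap_def)
  qed
  have "{..w (- 1)} \<subseteq> E"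
  proof
    fix u assume u: "u \<in> {..w (- 1 :: real)}"
    define x where "x = min u (- 1)"
    have "{x..- 1} \<inter> measure_support \<mu> = {}" using supp by force
    then have "{w x..w (- 1)} \<subseteq> E" by (rule w_image_interval) (simp add: x_def)
    moreover have "w x \<le> x" using le[of x] by (simp add: x_def)
    then have "w x \<le> u" by (rule order_trans) (simp add: x_def)
    ultimately show "u \<in> E" using u by auto
  qed
  then show ?thesis by blast
qed

lemma E_unbounded_above:
  assumes "compact (measure_support \<tau>)"
  shows "\<exists>hi\<ge>0. \<forall>u\<ge>hi. u \<in> E \<and> u \<le> F u"
proof -
  interpret tau: real_distribution \<tau> by (rule dist_tau)
  obtain K where K: "K \<ge> 0" "AE t in \<tau>. t \<le> K"
    using compact_measure_support_AE[of \<tau>] assms by auto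
  \<comment> \<open>With \<open>\<delta> = u - K \<ge> A\<close>, the first two terms bound
    \<open>c * tsqres + c * sqres * u\<close> by
    \<open>c * (2 * K + 1) / \<delta> \<le> 1 / 4\<close>, and the last term bounds
    \<open>c * sqres * d\<close> by \<open>1 / 4\<close>. As \<open>G u \<ge> 1\<close>, this leaves
    \<open>F' u \<ge> 3 / 4 - 1 / 4\<close>.\<close>
  define A where "A = 1 + 4 * c * (2 * K + 1) + 4 * c * d"
  have "u \<in> E \<and> u \<le> F u" if u: "u \<ge> K + A" for u
  proof -
    define \<delta> where "\<delta> = u - K"
    have "0 \<le> 4 * c * (2 * K + 1)" "0 \<le> 4 * c * d" using c d K(1) by simp_all
    then have \<delta>: "\<delta> \<ge> 1" "4 * c * (2 * K + 1) \<le> \<delta>" "4 * c * d \<le> \<delta>"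
      using u by (simp_all add: \<delta>_def A_def)
    have far_u: "AE t in \<tau>. 0 \<le> t \<and> t \<le> K \<and> \<delta> \<le> u - t"
      using K(2) prob_on_halfline_AE[OF tau] by eventually_elim (simp add: \<delta>_def)
    have supp: "u \<notin> measure_support \<tau>"
    proof (rule not_in_measure_supportI[of "{K<..}"])
      have "AE t in \<tau>. t \<notin> {K<..}" using K(2) by eventually_elim simp
      then show "emeasure \<tau> {K<..} = 0" by (subst (asm) AE_iff_measurable[of "{K<..}"]) auto
    qed (use \<delta> in \<open>auto simp: \<delta>_def\<close>)
    have far: "far \<tau> u" using far_real[OF dist_tau supp] .
    have "AE t in \<tau>. 0 \<le> 1 / (u - of_real t)" using far_u by eventually_elim (use \<delta> in simp)
    then have "stieltjes \<tau> u \<ge> 0" unfolding stieltjes_def by (rule integral_nonneg_AE)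
    then have G1: "G u \<ge> 1" using c by (simp add: gfac_def)
    have sq: "1 / (norm (u - of_real t))\<^sup>2 \<le> 1 / \<delta>\<^sup>2" if "\<delta> \<le> u - t" for t
      using that \<delta> by (intro divide_left_mono) (auto intro!: power_mono)
    have P: "sqres \<tau> u \<le> 1 / \<delta>\<^sup>2"
    proof -
      have "sqres \<tau> u \<le> (\<integral>t. 1 / \<delta>\<^sup>2 \<partial>\<tau>)" unfolding sqres_def
      proof (intro integral_mono_AE integrable_sqres[OF dist_tau far])
        show "AE t in \<tau>. 1 / (norm (u - of_real t))\<^sup>2 \<le> 1 / \<delta>\<^sup>2"
          using far_u by eventually_elim (use sq in blast)
      qed simp
      then show ?thesis by (simp add: tau.prob_space[unfolded tau.space_eq_univ])
    qed
    have T: "tsqres \<tau> u \<le> K / \<delta>\<^sup>2"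
    proof -
      have "tsqres \<tau> u \<le> (\<integral>t. K / \<delta>\<^sup>2 \<partial>\<tau>)" unfolding tsqres_def
      proof (intro integral_mono_AE integrable_tsqres[OF tau far])
        show "AE t in \<tau>. t / (norm (u - of_real t))\<^sup>2 \<le> K / \<delta>\<^sup>2"
          using far_u
        proof eventually_elim
          case (elim t)
          have "t * (1 / (norm (u - of_real t))\<^sup>2) \<le> K * (1 / \<delta>\<^sup>2)"
            using elim sq[of t] K by (intro mult_mono) auto
          then show ?case by simp
        qed
      qed simp
      then show ?thesis by (simp add: tau.prob_space[unfolded tau.space_eq_univ])
    qed
    have u0: "u \<ge> 0" using \<delta> K by (simp add: \<delta>_def)
    have "F' u = G u * (1 - c * tsqres \<tau> u - c * sqres \<tau> u * u) - c * sqres \<tau> u * d"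
      by (simp add: F'_def lfac_def algebra_simps)
    moreover have "c * tsqres \<tau> u + c * sqres \<tau> u * u \<le> 1 / 4"
    proof -
      have "c * tsqres \<tau> u + c * sqres \<tau> u * u \<le> c * (K / \<delta>\<^sup>2) + c * (1 / \<delta>\<^sup>2) * u"
        using P T c u0 by (intro add_mono mult_left_mono mult_right_mono) auto
      also have "\<dots> = c * (2 * K + \<delta>) / \<delta>\<^sup>2" by (simp add: \<delta>_def algebra_simps add_divide_distrib)
      also have "\<dots> \<le> c * ((2 * K + 1) * \<delta>) / \<delta>\<^sup>2"
      proof (intro divide_right_mono mult_left_mono)
        have "2 * K * 1 \<le> 2 * K * \<delta>" using K \<delta> by (intro mult_left_mono) auto
        then show "2 * K + \<delta> \<le> (2 * K + 1) * \<delta>" by (simp add: algebra_simps)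
      qed (use c in auto)
      also have "\<dots> = c * (2 * K + 1) / \<delta>" using \<delta> by (simp add: power2_eq_square)
      also have "\<dots> \<le> 1 / 4" using \<delta> by (simp add: divide_simps)
      finally show ?thesis .
    qed
    then have "G u * (1 - c * tsqres \<tau> u - c * sqres \<tau> u * u) \<ge> 1 * (3 / 4)"
      using G1 by (intro mult_mono) auto
    moreover have "c * sqres \<tau> u * d \<le> 1 / 4"
    proof -
      have "c * sqres \<tau> u * d \<le> c * (1 / \<delta>\<^sup>2) * d" using P c d by (intro mult_right_mono mult_left_mono) auto
      also have "\<dots> \<le> 1 / 4"
      proof -
        have "\<delta> \<le> \<delta>\<^sup>2" using \<delta> by (simp add: power2_eq_square mult_le_cancel_left1)
        then have "4 * c * d \<le> \<delta>\<^sup>2" using \<delta> by linarith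
        moreover have "\<delta>\<^sup>2 > 0" using \<delta> by simp
        ultimately show ?thesis by (simp add: divide_simps mult_ac)
      qed
      finally show ?thesis .
    qed
    ultimately have "F' u > 0" by linarith
    then have "u \<in> E" using supp G1 by (simp add: E_def)
    moreover have "u \<le> F u"
    proof -
      have "u * 1 \<le> u * G u" using G1 u0 by (intro mult_left_mono) auto
      then have "u \<le> L u" using d by (simp add: lfac_def)
      then have "1 * u \<le> G u * L u" using G1 u0 by (intro mult_mono) auto
      then show ?thesis by (simp add: pmap_def)
    qed
    ultimately show ?thesis by simp
  qed
  moreover have "0 \<le> K + A" using K(1) c d by (simp add: A_def)
  ultimately show ?thesis by blast
qed

lemma F_continuous: "u \<in> E \<Longrightarrow> isCont F u"
  using F_deriv(1)[of u] by (auto simp: E_def dest: DERIV_isCont)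

lemma F_image_interval:
  assumes "{u..v} \<subseteq> E" "u \<le> v" "F u \<le> x" "x \<le> F v"
  shows "x \<notin> measure_support \<mu>"
proof -
  have "\<exists>y\<ge>u. y \<le> v \<and> F y = x"
    by (rule IVT') (use assms F_continuous in \<open>auto intro!: continuous_at_imp_continuous_on\<close>)
  then obtain y where "y \<in> {u..v}" "F y = x" by auto
  then show ?thesis using F_notin_support[of y] assms(1) by auto
qed

lemma F_unbounded_below: "\<exists>y\<in>E. F y < x"
proof -
  define a where "a = min x 0 - 1"
  have "a \<notin> measure_support \<mu>" using prob_on_halfline_support[OF mu] by (auto simp: a_def min_def split: if_splits)
  then show ?thesis using w_in_E F_w by (intro bexI[of _ "w a"]) (auto simp: a_def)
qed

text \<open>The atom is approached from the left, where \<open>g_\<tau>\<close> tends to minus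
  infinity and destroys \<open>G = 1 + c g_\<tau> > 0\<close>. For \<open>\<mu>\<close> the approach
  is from the right, because \<open>b = 1 - c m\<close>.\<close>

lemma E_isolated_contradiction:
  assumes s: "s \<in> measure_support \<tau>" and e: "e > 0" "{s - e<..<s} \<subseteq> E" "{s<..<s + e} \<subseteq> E"
  shows False
proof -
  have disj: "{s - e<..<s} \<inter> measure_support \<tau> = {}" "{s<..<s + e} \<inter> measure_support \<tau> = {}"
    using e by (auto simp: E_def subset_iff)
  obtain h where h: "0 < h" "h < e / 2" "- 1 * stieltjes \<tau> (s + (- 1) * h) > 1 / c"
    using stieltjes_near_atom_unbounded[OF dist_tau _ e(1) measure_isolated_support_point[OF dist_tau s e(1) disj]
        AE_isolated[OF dist_tau disj, of "-1"], of "1 / c"] by auto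
  then have "s - h \<in> E" using e by (auto simp: subset_iff)
  then have "G (s - h) > 0" by (simp add: E_def)
  moreover have "c * (- stieltjes \<tau> (s - h)) > c * (1 / c)" using h(3) c by (intro mult_strict_left_mono) auto
  ultimately show False using c by (simp add: gfac_def)
qed

lemma support_mu_no_isolated:
  assumes s: "s \<in> measure_support \<mu>" and e: "e > 0"
    "{s - e<..<s} \<inter> measure_support \<mu> = {}" "{s<..<s + e} \<inter> measure_support \<mu> = {}"
  shows False
proof -
  obtain h where h: "0 < h" "h < e / 2" "1 * stieltjes \<mu> (s + 1 * h) > 1 / c"
    using stieltjes_near_atom_unbounded[OF dist_mu _ e(1) measure_isolated_support_point[OF dist_mu s e]
        AE_isolated[OF dist_mu e(2,3), of "1"], of "1 / c"] by auto
  then have "s + h \<in> {s<..<s + e}" by auto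
  then have "s + h \<notin> measure_support \<mu>" using e(3) by blast
  then have "b (s + h) > 0" by (rule b_pos)
  moreover have "c * stieltjes \<mu> (s + h) > c * (1 / c)" using h(3) c by (intro mult_strict_left_mono) auto
  ultimately show False using c by (simp add: gfac_def)
qed

lemma support_structure:
  assumes comp: "compact (measure_support \<tau>)" and fin: "finite_union_of_disjoint_intervals (measure_support \<tau>)"
  shows "\<exists>(p::nat) (u::nat \<Rightarrow> real) (v::nat \<Rightarrow> real) (\<alpha>::nat \<Rightarrow> real) (\<beta>::nat \<Rightarrow> real).
         p \<ge> 1 \<and>
         (\<forall>l\<in>{1..p}. u l < v l) \<and> (\<forall>l\<in>{1..<p}. v l < u (l + 1)) \<and>
         E = {..<u 1} \<union> (\<Union>l\<in>{1..<p}. {v l<..<u (l + 1)}) \<union> {v p<..} \<and>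
         measure_support \<tau> \<subseteq> (\<Union>l\<in>{1..p}. {u l..v l}) \<and>
         (\<forall>l\<in>{1..p}. {u l..v l} \<inter> measure_support \<tau> \<noteq> {}) \<and>
         (\<forall>l\<in>{1..p}. (F \<longlongrightarrow> \<alpha> l) (at_left (u l))) \<and>
         (\<forall>l\<in>{1..p}. (F \<longlongrightarrow> \<beta> l) (at_right (v l))) \<and>
         measure_support \<mu> = (\<Union>l\<in>{1..p}. {\<alpha> l..\<beta> l}) \<and>
         (\<forall>l\<in>{1..p}. \<alpha> l < \<beta> l) \<and> (\<forall>l\<in>{1..<p}. \<beta> l < \<alpha> (l + 1)) \<and>
         (\<forall>l\<in>{1..p}. measure \<mu> {\<alpha> l..\<beta> l} = measure \<tau> {u l..v l})"
proof -
  interpret mu: real_distribution \<mu> by (rule dist_mu)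
  interpret tau: real_distribution \<tau> by (rule dist_tau)
  obtain lo where lo: "{..lo} \<subseteq> E" using E_unbounded_below by blast
  obtain hi where hi: "\<forall>u\<ge>hi. u \<in> E \<and> u \<le> F u" using E_unbounded_above[OF comp] by blast
  then have hi': "{hi..} \<subseteq> E" by auto
  have SE: "measure_support \<tau> \<inter> E = {}" by (auto simp: E_def)
  obtain p :: nat and u v :: "nat \<Rightarrow> real" where p: "1 \<le> p" and le: "\<And>l. l \<in> {1..p} \<Longrightarrow> u l \<le> v l"
    and less: "\<And>l. l \<in> {1..<p} \<Longrightarrow> v l < u (l + 1)"
    and CE: "- E = (\<Union>l\<in>{1..p}. {u l..v l})" and meets: "\<And>l. l \<in> {1..p} \<Longrightarrow> {u l..v l} \<inter> measure_support \<tau> \<noteq> {}"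
  proof (rule Compl_sorted_intervals_exist[OF open_E closed_measure_support measure_support_ne[OF dist_tau] SE fin E_gap lo hi'])
    fix p :: nat and u v :: "nat \<Rightarrow> real"
    assume "1 \<le> p" "\<And>l. l \<in> {1..p} \<Longrightarrow> u l \<le> v l" "\<And>l. l \<in> {1..<p} \<Longrightarrow> v l < u (l + 1)"
      "- E = (\<Union>l\<in>{1..p}. {u l..v l})" "\<And>l. l \<in> {1..p} \<Longrightarrow> {u l..v l} \<inter> measure_support \<tau> \<noteq> {}"
    then show thesis by (rule that[of p u v])
  qed
  have E_eq: "E = {..<u 1} \<union> (\<Union>l\<in>{1..<p}. {v l<..<u (l + 1)}) \<union> {v p<..}"
    using Compl_sorted_intervals[where p = p and u = u and v = v, OF p le less, folded CE] by (simp only: double_compl)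
  have iso: "\<exists>e>0. {u l - e<..<u l} \<subseteq> E \<and> {v l<..<v l + e} \<subseteq> E" if l: "l \<in> {1..p}" for l
    by (rule sorted_intervals_isolated[where p = p and u = u and v = v, OF p le less CE l]) blast+
  have split: "y < u l \<or> v l < y" if "y \<in> E" "l \<in> {1..p}" for y l
  proof (rule ccontr)
    assume "\<not> (y < u l \<or> v l < y)"
    then have "y \<in> (\<Union>l\<in>{1..p}. {u l..v l})" using that(2) by (intro UN_I[of l]) auto
    then show False using CE that(1) by blast
  qed
  \<comment> \<open>A component reduced to one point would be an isolated point of the support of
    \<open>\<tau>\<close>, since every component meets that support.\<close>
  have uv: "u l < v l" if l: "l \<in> {1..p}" for l
  proof (rule ccontr)
    assume "\<not> u l < v l"
    then have eq: "v l = u l" using le[OF l] by simp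
    then have "u l \<in> measure_support \<tau>" using meets[OF l] by auto
    then show False using iso[OF l] E_isolated_contradiction[of "u l"] eq by auto
  qed
  \<comment> \<open>\<open>F\<close> increases on all of \<open>E\<close>, also from one component
    to the next. The one-sided limits are therefore a supremum and an infimum over everything in
    \<open>E\<close> on that side, which makes the comparisons across components immediate.\<close>
  define \<alpha> where "\<alpha> l = Sup (F ` (E \<inter> {..<u l}))" for l
  define \<beta> where "\<beta> l = Inf (F ` (E \<inter> {v l<..}))" for l
  have mono: "F x < F y" if "x \<in> E" "y \<in> E" "x < y" for x y using F_strict_mono_E that .
  have mono': "F x < F y \<longleftrightarrow> x < y" if "x \<in> E" "y \<in> E" for x y
    using mono[OF that] mono[OF that(2,1)] by (metis less_asym linorder_neqE)
  have left_ne: "\<exists>y\<in>E. y < u l \<and> z < y" if "l \<in> {1..p}" "z < u l" for l z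
  proof -
    obtain e where "e > 0" "{u l - e<..<u l} \<subseteq> E" using iso \<open>l \<in> {1..p}\<close> by blast
    then have "max ((u l + z) / 2) (u l - e / 2) \<in> E" "z < max ((u l + z) / 2) (u l - e / 2)"
       "max ((u l + z) / 2) (u l - e / 2) < u l" using that(2) by (auto simp: subset_iff max_def)
    then show ?thesis by blast
  qed
  have right_ne: "\<exists>y\<in>E. v l < y \<and> y < z" if "l \<in> {1..p}" "v l < z" for l z
  proof -
    obtain e where "e > 0" "{v l<..<v l + e} \<subseteq> E" using iso \<open>l \<in> {1..p}\<close> by blast
    then have "min ((v l + z) / 2) (v l + e / 2) \<in> E" "min ((v l + z) / 2) (v l + e / 2) < z"
       "v l < min ((v l + z) / 2) (v l + e / 2)" using that(2) by (auto simp: subset_iff min_def)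
    then show ?thesis by blast
  qed
  have bdd: "bdd_above (F ` (E \<inter> {..<u l}))" "bdd_below (F ` (E \<inter> {v l<..}))"
    and ne: "F ` (E \<inter> {..<u l}) \<noteq> {}" "F ` (E \<inter> {v l<..}) \<noteq> {}" if l: "l \<in> {1..p}" for l
  proof -
    obtain y z where y: "y \<in> E" "y < u l" and z: "z \<in> E" "v l < z"
      using left_ne[OF l, of "u l - 1"] right_ne[OF l, of "v l + 1"] by auto
    show "F ` (E \<inter> {..<u l}) \<noteq> {}" "F ` (E \<inter> {v l<..}) \<noteq> {}" using y z by auto
    have "F x \<le> F z" if "x \<in> E" "x < u l" for x using mono[of x z] that z uv[OF l] by simp
    then show "bdd_above (F ` (E \<inter> {..<u l}))" by (auto intro!: bdd_aboveI[of _ "F z"])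
    have "F y \<le> F x" if "x \<in> E" "v l < x" for x using mono[of y x] that y uv[OF l] by simp
    then show "bdd_below (F ` (E \<inter> {v l<..}))" by (auto intro!: bdd_belowI[of _ "F y"])
  qed
  have less_\<alpha>: "F y < \<alpha> l" if l: "l \<in> {1..p}" and y: "y \<in> E" "y < u l" for l y
  proof -
    obtain z where z: "z \<in> E" "z < u l" "y < z" using left_ne[OF l y(2)] by blast
    have "F y < F z" using mono y z by simp
    also have "F z \<le> \<alpha> l" unfolding \<alpha>_def using z bdd[OF l] by (intro cSup_upper) auto
    finally show ?thesis .
  qed
  have greater_\<beta>: "\<beta> l < F y" if l: "l \<in> {1..p}" and y: "y \<in> E" "v l < y" for l y
  proof -
    obtain z where z: "z \<in> E" "v l < z" "z < y" using right_ne[OF l y(2)] by blast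
    have "\<beta> l \<le> F z" unfolding \<beta>_def using z bdd[OF l] by (intro cInf_lower) auto
    also have "F z < F y" using mono y z by simp
    finally show ?thesis .
  qed
  have below_\<alpha>: "\<exists>y\<in>E. y < u l \<and> x < F y" if "l \<in> {1..p}" "x < \<alpha> l" for l x
    using that less_cSup_iff[OF ne(1) bdd(1), of l x] unfolding \<alpha>_def by auto
  have above_\<beta>: "\<exists>y\<in>E. v l < y \<and> F y < x" if "l \<in> {1..p}" "\<beta> l < x" for l x
    using that cInf_less_iff[OF ne(2) bdd(2), of l x] unfolding \<beta>_def by auto
  have ev_left: "\<forall>\<^sub>F y in at_left (u l). y \<in> E \<and> y < u l \<and> {y<..<u l} \<subseteq> E \<and> z < y" if l: "l \<in> {1..p}" and z: "z < u l" for l z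
  proof -
    obtain e where e: "e > 0" "{u l - e<..<u l} \<subseteq> E" using iso l by blast
    have "\<forall>\<^sub>F y in at_left (u l). y \<in> {max z (u l - e)<..<u l}"
      using e(1) z by (intro eventually_at_left_real) simp
    then show ?thesis by eventually_elim (use e in auto)
  qed
  have ev_right: "\<forall>\<^sub>F y in at_right (v l). y \<in> E \<and> v l < y \<and> {v l<..<y} \<subseteq> E \<and> y < z" if l: "l \<in> {1..p}" and z: "v l < z" for l z
  proof -
    obtain e where e: "e > 0" "{v l<..<v l + e} \<subseteq> E" using iso l by blast
    have "\<forall>\<^sub>F y in at_right (v l). y \<in> {v l<..<min z (v l + e)}"
      using e(1) z by (intro eventually_at_right_real) simp
    then show ?thesis by eventually_elim (use e in auto)
  qed
  have lim_\<alpha>: "(F \<longlongrightarrow> \<alpha> l) (at_left (u l))" if l: "l \<in> {1..p}" for l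
  proof (rule increasing_tendsto)
    show "\<forall>\<^sub>F y in at_left (u l). F y \<le> \<alpha> l"
      using ev_left[OF l, of "u l - 1"] less_\<alpha>[OF l] by (auto elim!: eventually_mono intro: less_imp_le)
    fix x assume "x < \<alpha> l"
    then obtain z where z: "z \<in> E" "z < u l" "x < F z" using below_\<alpha>[OF l] by blast
    show "\<forall>\<^sub>F y in at_left (u l). x < F y"
      using ev_left[OF l z(2)] by eventually_elim (use z mono in \<open>auto intro: less_trans\<close>)
  qed
  have lim_\<beta>: "(F \<longlongrightarrow> \<beta> l) (at_right (v l))" if l: "l \<in> {1..p}" for l
  proof (rule decreasing_tendsto)
    show "\<forall>\<^sub>F y in at_right (v l). \<beta> l \<le> F y"
      using ev_right[OF l, of "v l + 1"] greater_\<beta>[OF l] by (auto elim!: eventually_mono intro: less_imp_le)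
    fix x assume "\<beta> l < x"
    then obtain z where z: "z \<in> E" "v l < z" "F z < x" using above_\<beta>[OF l] by blast
    show "\<forall>\<^sub>F y in at_right (v l). F y < x"
      using ev_right[OF l z(2)] by eventually_elim (use z mono in \<open>auto intro: less_trans\<close>)
  qed
  have \<alpha>\<beta>_le: "\<alpha> l \<le> \<beta> l" if l: "l \<in> {1..p}" for l
  proof (rule ccontr)
    assume "\<not> \<alpha> l \<le> \<beta> l"
    then obtain y where y: "y \<in> E" "y < u l" "\<beta> l < F y" using below_\<alpha>[OF l, of "\<beta> l"] by auto
    then obtain z where "z \<in> E" "v l < z" "F z < F y" using above_\<beta>[OF l] by blast
    then show False using mono'[of z y] y uv[OF l] by simp
  qed
  have \<beta>\<alpha>: "\<beta> l < \<alpha> (l + 1)" if l: "l \<in> {1..<p}" for l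
  proof -
    have ls: "l \<in> {1..p}" "l + 1 \<in> {1..p}" using l by auto
    obtain y where y: "y \<in> E" "v l < y" "y < u (l + 1)" using right_ne[OF ls(1) less[OF l]] by blast
    show ?thesis using greater_\<beta>[OF ls(1) y(1,2)] less_\<alpha>[OF ls(2) y(1,3)] by simp
  qed
  have supp: "measure_support \<mu> = (\<Union>l\<in>{1..p}. {\<alpha> l..\<beta> l})"
  proof (intro equalityI subsetI)
    fix x assume x: "x \<in> measure_support \<mu>"
    show "x \<in> (\<Union>l\<in>{1..p}. {\<alpha> l..\<beta> l})"
    proof (rule ccontr)
      assume "x \<notin> (\<Union>l\<in>{1..p}. {\<alpha> l..\<beta> l})"
      then have "x \<in> {..<\<alpha> 1} \<union> (\<Union>l\<in>{1..<p}. {\<beta> l<..<\<alpha> (l + 1)}) \<union> {\<beta> p<..}"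
        using Compl_sorted_intervals[where p = p and u = \<alpha> and v = \<beta>, OF p \<alpha>\<beta>_le \<beta>\<alpha>] by blast
      then consider "x < \<alpha> 1" | l where "l \<in> {1..<p}" "\<beta> l < x" "x < \<alpha> (l + 1)" | "\<beta> p < x" by auto
      \<comment> \<open>Two points of the same component of \<open>E\<close> whose images enclose
        \<open>x\<close>; the intermediate value theorem then makes \<open>x\<close> a value of
        \<open>F\<close> on \<open>E\<close>.\<close>
      then obtain y z where yz: "y \<in> E" "z \<in> E" "F y < x" "x < F z" "{y..z} \<subseteq> E"
      proof cases
        case 1
        obtain z where z: "z \<in> E" "z < u 1" "x < F z" using below_\<alpha>[of 1] 1 p by auto
        obtain y where y: "y \<in> E" "F y < x" using F_unbounded_below by blast
        have "{y..z} \<subseteq> E" using z(2) unfolding E_eq by auto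
        then show thesis using that y z by blast
      next
        case 2
        then have ls: "l \<in> {1..p}" "l + 1 \<in> {1..p}" by auto
        obtain y where y: "y \<in> E" "v l < y" "F y < x" using above_\<beta>[OF ls(1) 2(2)] by blast
        obtain z where z: "z \<in> E" "z < u (l + 1)" "x < F z" using below_\<alpha>[OF ls(2) 2(3)] by blast
        have "{y..z} \<subseteq> {v l<..<u (l + 1)}" using y z by auto
        then have "{y..z} \<subseteq> E" using 2(1) unfolding E_eq by blast
        then show thesis using that y z by blast
      next
        case 3
        obtain y where y: "y \<in> E" "v p < y" "F y < x" using above_\<beta>[of p] 3 p by auto
        \<comment> \<open>On the last component \<open>F\<close> is unbounded because
          \<open>F u \<ge> u\<close> for large \<open>u\<close>.\<close>
        have z: "max hi (x + 1) \<in> E" "x < F (max hi (x + 1))" using hi[rule_format, of "max hi (x + 1)"] by auto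
        have "{y..max hi (x + 1)} \<subseteq> E" using y(2) unfolding E_eq by auto
        then show thesis using that y z by blast
      qed
      have "y < z" using mono'[of y z] yz by simp
      then show False using F_image_interval[OF yz(5), of x] yz x by simp
    qed
  next
    fix x assume "x \<in> (\<Union>l\<in>{1..p}. {\<alpha> l..\<beta> l})"
    then obtain l where l: "l \<in> {1..p}" "\<alpha> l \<le> x" "x \<le> \<beta> l" by auto
    show "x \<in> measure_support \<mu>"
    proof (rule ccontr)
      assume x: "x \<notin> measure_support \<mu>"
      \<comment> \<open>The point \<open>w x\<close> lies in \<open>E\<close>, so it is left of
        \<open>u l\<close> or right of \<open>v l\<close>, and \<open>F\<close> sends it back to
        \<open>x\<close>, which would then be below \<open>\<alpha> l\<close> or above
        \<open>\<beta> l\<close>.\<close>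
      then have "w x \<in> E" "F (w x) = x" by (rule w_in_E, rule F_w)
      then show False using split[of "w x" l] less_\<alpha>[OF l(1), of "w x"] greater_\<beta>[OF l(1), of "w x"] l by auto
    qed
  qed
  have iso_\<mu>: "\<exists>e>0. {\<alpha> l - e<..<\<alpha> l} \<inter> measure_support \<mu> = {} \<and> {\<beta> l<..<\<beta> l + e} \<inter> measure_support \<mu> = {}"
    if l: "l \<in> {1..p}" for l
    by (rule sorted_intervals_isolated[where p = p and u = \<alpha> and v = \<beta>, OF p \<alpha>\<beta>_le \<beta>\<alpha> supp l]) blast+
  have \<alpha>\<beta>: "\<alpha> l < \<beta> l" if l: "l \<in> {1..p}" for l
  proof (rule ccontr)
    assume "\<not> \<alpha> l < \<beta> l"
    then have eq: "\<beta> l = \<alpha> l" using \<alpha>\<beta>_le[OF l] by simp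
    then have "\<alpha> l \<in> measure_support \<mu>" using supp l by auto
    then show False using iso_\<mu>[OF l] support_mu_no_isolated[of "\<alpha> l"] eq by auto
  qed
  have mass: "measure \<mu> {\<alpha> l..\<beta> l} = measure \<tau> {u l..v l}" if l: "l \<in> {1..p}" for l
  proof -
    obtain e where e: "e > 0" "{\<alpha> l - e<..<\<alpha> l} \<inter> measure_support \<mu> = {}" "{\<beta> l<..<\<beta> l + e} \<inter> measure_support \<mu> = {}"
      using iso_\<mu>[OF l] by blast
    \<comment> \<open>The points \<open>y\<close>, \<open>z\<close> of \<open>E\<close> are taken so
      close to \<open>u l\<close>, \<open>v l\<close> that their images stay in the free zones of
      width \<open>e\<close> beside \<open>{\<alpha> l..\<beta> l}\<close>; the tails beyond
      \<open>y\<close> and \<open>z\<close> are matched by \<open>mass_right_F\<close>.\<close>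
    have "\<forall>\<^sub>F y in at_left (u l). \<alpha> l - e < F y" using lim_\<alpha>[OF l] e(1) by (intro order_tendstoD) auto
    from eventually_happens'[OF _ eventually_conj[OF this ev_left[OF l, of "u l - 1"]]]
    obtain y where y: "y \<in> E" "y < u l" "{y<..<u l} \<subseteq> E" "\<alpha> l - e < F y" by auto
    have "\<forall>\<^sub>F y in at_right (v l). F y < \<beta> l + e" using lim_\<beta>[OF l] e(1) by (intro order_tendstoD) auto
    from eventually_happens'[OF _ eventually_conj[OF this ev_right[OF l, of "v l + 1"]]]
    obtain z where z: "z \<in> E" "v l < z" "{v l<..<z} \<subseteq> E" "F z < \<beta> l + e" by auto
    have yz: "y < z" using y z uv[OF l] by simp
    \<comment> \<open>Used once for \<open>\<tau>\<close> and once for \<open>\<mu>\<close>. The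
      right flank \<open>{b'<..b}\<close> contains its end \<open>b\<close>, whence the separate
      condition on \<open>b\<close>.\<close>
    have tail: "measure M {a<..} = measure M {a'..b'} + measure M {b<..}"
      if "real_distribution M" "a < a'" "a' \<le> b'" "b' < b" "{a<..<a'} \<inter> measure_support M = {}"
        "{b'<..<b} \<inter> measure_support M = {}" "b \<notin> measure_support M" for M and a a' b' b :: real
    proof -
      interpret real_distribution M by fact
      have "measure M ({a<..<a'} \<union> {b'<..b}) = 0"
        using that(5-7) emeasure_support_disjoint[of M "{a<..<a'} \<union> {b'<..b}"]
        by (force simp: measure_def disjoint_iff less_le)
      moreover have "{a<..} = ({a<..<a'} \<union> {b'<..b}) \<union> ({a'..b'} \<union> {b<..})" using that(2-4) by auto
      moreover have "measure M (({a<..<a'} \<union> {b'<..b}) \<union> ({a'..b'} \<union> {b<..}))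
          = measure M ({a<..<a'} \<union> {b'<..b}) + measure M ({a'..b'} \<union> {b<..})"
        by (rule finite_measure_Union) (use that(2-4) in auto)
      moreover have "measure M ({a'..b'} \<union> {b<..}) = measure M {a'..b'} + measure M {b<..}"
        by (rule finite_measure_Union) (use that(2-4) in auto)
      ultimately show ?thesis by simp
    qed
    have "measure \<tau> {y<..} = measure \<tau> {u l..v l} + measure \<tau> {z<..}"
      by (rule tail[OF dist_tau]) (use y z uv[OF l] SE in auto)
    moreover have "measure \<mu> {F y<..} = measure \<mu> {\<alpha> l..\<beta> l} + measure \<mu> {F z<..}"
    proof (rule tail[OF dist_mu])
      show "F y < \<alpha> l" "\<beta> l < F z" using less_\<alpha>[OF l] greater_\<beta>[OF l] y z by auto
      show "\<alpha> l \<le> \<beta> l" by (rule \<alpha>\<beta>_le[OF l])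
      show "F z \<notin> measure_support \<mu>" by (rule F_notin_support[OF z(1)])
    qed (use e y z in \<open>auto simp: disjoint_iff\<close>)
    ultimately show ?thesis using mass_right_F y(1) z(1) by simp
  qed
  show ?thesis
    by (rule exI[of _ p], rule exI[of _ u], rule exI[of _ v], rule exI[of _ \<alpha>], rule exI[of _ \<beta>])
      (intro conjI ballI p uv less E_eq meets lim_\<alpha> lim_\<beta> supp \<alpha>\<beta> \<beta>\<alpha> mass; use SE CE in blast)
qed

lemma w_eq: "w x = x * (1 - c * stieltjes \<mu> x)\<^sup>2 - d * (1 - c * stieltjes \<mu> x)" for x :: real
  by (simp add: pmap_def lfac_def gfac_def power2_eq_square algebra_simps)

lemma F_eq: "F x = x * (1 + c * stieltjes \<tau> x)\<^sup>2 + d * (1 + c * stieltjes \<tau> x)" for x :: real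
  by (simp add: pmap_def lfac_def gfac_def power2_eq_square algebra_simps)

lemma homeomorphism_w_F: "homeomorphism (- measure_support \<mu>) E w F"
  unfolding homeomorphism_def
proof (intro conjI ballI)
  show "continuous_on (- measure_support \<mu>) w"
    using w_deriv(1) by (auto intro!: continuous_at_imp_continuous_on DERIV_isCont)
  show "continuous_on E F" using F_continuous by (auto intro!: continuous_at_imp_continuous_on)
  show "w ` (- measure_support \<mu>) = E"
    using w_in_E w_F F_notin_support by (force simp: image_iff)
  show "F ` E = - measure_support \<mu>"
    using w_in_E F_w F_notin_support by (force simp: image_iff)
qed (use F_w w_F in auto)

end

theorem theorem1p3:
  fixes \<gamma> \<rho> :: real and \<tau> \<mu> :: "real measure"
  assumes gamma: "0 < \<gamma>" "\<gamma> \<le> 1"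
    and rho: "0 < \<rho>"
    and tau: "prob_on_halfline \<tau>" "compact (measure_support \<tau>)"
    and mu: "info_plus_noise_law \<rho> \<tau> \<gamma> \<mu>"
  shows
    "(omega \<rho> \<gamma> \<mu> differentiable_on (- measure_support \<mu>) \<and>
      Phi \<rho> \<tau> \<gamma> differentiable_on (- measure_support \<tau>))
     \<and>
     ((\<gamma> < 1 \<longrightarrow> 0 \<notin> measure_support \<mu>) \<and>
      (\<gamma> = 1 \<longrightarrow>
         (0 \<notin> measure_support \<mu> \<longleftrightarrow> 0 \<notin> measure_support \<tau> \<and> stieltjes \<tau> (0::real) > - (1 / \<rho>\<^sup>2))))
     \<and>
     (homeomorphism (- measure_support \<mu>) (E_set \<rho> \<tau> \<gamma>) (omega \<rho> \<gamma> \<mu>) (Phi \<rho> \<tau> \<gamma>) \<and>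
      strict_mono_on (- measure_support \<mu>) (omega \<rho> \<gamma> \<mu>) \<and>
      real_analytic_on (omega \<rho> \<gamma> \<mu>) (- measure_support \<mu>) \<and>
      real_analytic_on (Phi \<rho> \<tau> \<gamma>) (E_set \<rho> \<tau> \<gamma>) \<and>
      (\<forall>x\<in>- measure_support \<mu>. deriv (omega \<rho> \<gamma> \<mu>) x > 0))
     \<and>
     (\<forall>a\<in>- measure_support \<mu>. omega \<rho> \<gamma> \<mu> a \<le> 0 \<longrightarrow> left_of_support a \<mu>)
     \<and>
     (finite_union_of_disjoint_intervals (measure_support \<tau>) \<longrightarrow>
      (\<exists>(p::nat) (u::nat \<Rightarrow> real) (v::nat \<Rightarrow> real) (\<alpha>::nat \<Rightarrow> real) (\<beta>::nat \<Rightarrow> real).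
         p \<ge> 1 \<and>
         (\<forall>l\<in>{1..p}. u l < v l) \<and> (\<forall>l\<in>{1..<p}. v l < u (l + 1)) \<and>
         E_set \<rho> \<tau> \<gamma> = {..<u 1} \<union> (\<Union>l\<in>{1..<p}. {v l<..<u (l + 1)}) \<union> {v p<..} \<and>
         measure_support \<tau> \<subseteq> (\<Union>l\<in>{1..p}. {u l..v l}) \<and>
         (\<forall>l\<in>{1..p}. {u l..v l} \<inter> measure_support \<tau> \<noteq> {}) \<and>
         (\<forall>l\<in>{1..p}. (Phi \<rho> \<tau> \<gamma> \<longlongrightarrow> \<alpha> l) (at_left (u l))) \<and>
         (\<forall>l\<in>{1..p}. (Phi \<rho> \<tau> \<gamma> \<longlongrightarrow> \<beta> l) (at_right (v l))) \<and>
         measure_support \<mu> = (\<Union>l\<in>{1..p}. {\<alpha> l..\<beta> l}) \<and>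
         (\<forall>l\<in>{1..p}. \<alpha> l < \<beta> l) \<and> (\<forall>l\<in>{1..<p}. \<beta> l < \<alpha> (l + 1)) \<and>
         (\<forall>l\<in>{1..p}. measure \<mu> {\<alpha> l..\<beta> l} = measure \<tau> {u l..v l})))"
proof -
  define c d where "c = \<rho>\<^sup>2 * \<gamma>" and "d = \<rho>\<^sup>2 * (1 - \<gamma>)"
  have c0: "c > 0" and d0: "d \<ge> 0" using gamma rho by (simp_all add: c_def d_def)
  note tau_compact = tau(2)
  interpret info_noise_pair c d \<tau> \<mu>
  proof
    show "prob_on_halfline \<mu>" using mu by (simp add: info_plus_noise_law_def)
    show "stieltjes \<mu> z = (\<integral>t. 1 / ((1 - of_real c * stieltjes \<mu> z) * z
        - of_real t / (1 - of_real c * stieltjes \<mu> z) - of_real d) \<partial>\<tau>)" if "Im z > 0" for z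
      using mu that unfolding info_plus_noise_law_def c_def d_def by blast
  qed (use c0 d0 tau in auto)
  have omega: "omega \<rho> \<gamma> \<mu> = w"
    by (rule ext) (unfold omega_def w_eq, simp add: c_def d_def)
  have Phi: "Phi \<rho> \<tau> \<gamma> = F"
    by (rule ext) (unfold Phi_def F_eq, simp add: c_def d_def mult.commute[of \<gamma>])
  have G_pos: "stieltjes \<tau> x > - (1 / c) \<longleftrightarrow> G x > 0" for x :: real
    using c0 by (simp add: gfac_def divide_simps) (auto simp: algebra_simps)
  \<comment> \<open>Points of either set are off the support of \<open>\<tau>\<close>, where
    \<open>F\<close> is differentiable and \<open>deriv\<close> agrees with the formula
    \<open>F'\<close>.\<close>
  have E_set: "E_set \<rho> \<tau> \<gamma> = E"
    unfolding E_set_def E_def Phi c_def[symmetric] G_pos using DERIV_imp_deriv[OF F_deriv(1)] by auto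
  have w_diff: "w differentiable_on (- measure_support \<mu>)"
    using w_deriv(1) by (auto simp: differentiable_on_def real_differentiable_def intro: has_field_derivative_at_within)
  have F_diff: "F differentiable_on (- measure_support \<tau>)"
    using F_deriv(1) by (auto simp: differentiable_on_def real_differentiable_def intro: has_field_derivative_at_within)
  have A1: "0 \<notin> measure_support \<mu>" if "\<gamma> < 1"
    using zero_notin_support_mu rho that by (simp add: d_def)
  have A2: "0 \<notin> measure_support \<mu> \<longleftrightarrow> 0 \<notin> measure_support \<tau> \<and> stieltjes \<tau> (0::real) > - (1 / \<rho>\<^sup>2)" if "\<gamma> = 1"
    using zero_notin_support_mu_iff G_pos[of 0] that by (simp add: c_def d_def)
  have mono: "strict_mono_on (- measure_support \<mu>) w"
    using w_strict_mono by (intro strict_mono_onI) auto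
  have w_an: "real_analytic_on w (- measure_support \<mu>)"
    by (rule real_analytic_pmap[OF dist_mu]) auto
  have F_an: "real_analytic_on F E"
    by (rule real_analytic_pmap[OF dist_tau]) (auto simp: E_def)
  have w'_pos: "deriv w x > 0" if "x \<notin> measure_support \<mu>" for x
    using DERIV_imp_deriv[OF w_deriv(1)[OF that]] w'_ge_1[OF that] by simp
  show ?thesis
    unfolding omega Phi E_set
    by (intro conjI impI ballI w_diff F_diff A1 A2 homeomorphism_w_F mono w_an F_an w'_pos
        left_of_support_mu support_structure[OF tau_compact]) auto
qed

end
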